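(* Let $d\ge 1$ and consider the wreath product $G=A\wr\mathbb{Z}^d$, where $A$ is a non-trivial finitely generated abelian group. Then $\mathbb{Z}^d$ is a non-foldable subset of $G$, and if $t\in A$ is an element of infinite order then $\mathbb{Z}^d\cdot\langle t\rangle$ is a non-foldable subset of $G$. In particular: (i) If $A$ is finite, then $G$ has a Schreier growth gap $n^d$. (ii) If $A$ is infinite, then $G$ has a Schreier growth gap $n^{d+1}$. (iii) Every faithful $G$-set $X$ satisfies $\mathrm{asdim}(G,X)\ge d$. Moreover these bounds are sharp: if $A$ is finite there is a faithful $G$-set $X$ with $\mathrm{vol}_{G,X}(n)\simeq n^d$; if $A$ is infinite there is a faithful $G$-set $X$ with $\mathrm{vol}_{G,X}(n)\simeq n^{d+1}$; and there is a faithful $G$-set $X$ with $\mathrm{asdim}(G,X)=d$.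
   Context: The wreath product $A\wr B$ is the semidirect product $\left(\bigoplus_B A\right)\rtimes B$, where $\bigoplus_B A$ is the group of finitely supported functions $B\to A$ and $B$ acts by $(b\cdot\varphi)(b')=\varphi(b^{-1}b')$. The groups $A$ and $B$ are identified with subgroups of $A\wr B$: $B$ is the semidirect factor and $A$ is the group of functions in $\bigoplus_B A$ supported at the identity of $B$. For subsets $U,V$ of a group, $U\cdot V=\{uv : u\in U, v\in V\}$. Let $G$ be a finitely generated group, $S$ a finite symmetric generating set, and $|\cdot|_S$ the word length. A $G$-set is a non-empty set with a $G$-action (not necessarily transitive); it is faithful if only the identity of $G$ acts trivially. The growth of the action of $G$ on a $G$-set $X$ is $\mathrm{vol}_{G,X}(n)=\max_{x\in X}|\{gx : g\in G,\ |g|_S\le n\}|$. For functions $f,g$ from $\mathbb{N}$ to the non-negative reals, $f(n)\preccurlyeq g(n)$ (equivalently $g(n)\succcurlyeq f(n)$) means that there is a constant $C>0$ such that $f(n)\le C g(Cn)$ for all sufficiently large $n$; $f\simeq g$ means $f\preccurlyeq g$ and $g\preccurlyeq f$. Up to $\simeq$, $\mathrm{vol}_{G,X}$ does not depend on $S$. The group $G$ has a Schreier growth gap $f(n)$ if every faithful $G$-set $X$ satisfies $\mathrm{vol}_{G,X}(n)\succcurlyeq f(n)$. A subset $\mathcal{L}$ of a group $G$ is non-foldable if for every faithful $G$-set $X$ and every finite subset $\Sigma\subset\mathcal{L}$ there exists $x\in X$ such that the map $\Sigma\to X$, $g\mapsto gx$, is injective. The graph $\Gamma(G,X)$ has vertex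 set $X$ and an edge between $x$ and $sx$ for all $x\in X$, $s\in S$; it is endowed with the simplicial distance, with value $+\infty$ between points in different components. A metric space (distances may be $+\infty$) has asymptotic dimension at most $n$ if for every $R>0$ it has a cover $\mathcal{U}$ by subsets of uniformly bounded diameter such that every ball of radius $R$ intersects at most $n+1$ sets of $\mathcal{U}$; its asymptotic dimension is the least such $n\in\mathbb{N}\cup\{\infty\}$. One sets $\mathrm{asdim}(G,X)=\mathrm{asdim}(\Gamma(G,X))$, which does not depend on $S$. *)

theory Defs
  imports "HOL-Algebra.Group_Action" "HOL-Algebra.Multiplicative_Group" "HOL-Algebra.Product_Groups" "HOL-Library.Extended_Real"
begin

section \<open>Wreath products\<close>

definition wreath_shift ::
  "('b, 'n) monoid_scheme \<Rightarrow> 'b \<Rightarrow> ('b \<Rightarrow> 'a) \<Rightarrow> 'b \<Rightarrow> 'a"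
  where "wreath_shift B b \<phi> = (\<lambda>b'\<in>carrier B. \<phi> (inv\<^bsub>B\<^esub> b \<otimes>\<^bsub>B\<^esub> b'))"

definition wreath_product ::
  "('a, 'm) monoid_scheme \<Rightarrow> ('b, 'n) monoid_scheme \<Rightarrow> (('b \<Rightarrow> 'a) \<times> 'b) monoid"
  (infixr \<open>\<wr>\<close> 75)
  where "A \<wr> B =
    \<lparr>carrier = carrier (sum_group (carrier B) (\<lambda>_. A)) \<times> carrier B,
     monoid.mult = (\<lambda>(\<phi>, b) (\<psi>, c).
       (\<phi> \<otimes>\<^bsub>sum_group (carrier B) (\<lambda>_. A)\<^esub> wreath_shift B b \<psi>, b \<otimes>\<^bsub>B\<^esub> c)),
     one = (\<one>\<^bsub>sum_group (carrier B) (\<lambda>_. A)\<^esub>, \<one>\<^bsub>B\<^esub>)\<rparr>"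

text \<open>The identifications of \<open>B\<close> and of \<open>A\<close> with subgroups of \<open>A \<wr> B\<close>.\<close>

definition wreath_top ::
  "('a, 'm) monoid_scheme \<Rightarrow> ('b, 'n) monoid_scheme \<Rightarrow> 'b \<Rightarrow> ('b \<Rightarrow> 'a) \<times> 'b"
  where "wreath_top A B b = (\<one>\<^bsub>sum_group (carrier B) (\<lambda>_. A)\<^esub>, b)"

definition wreath_base ::
  "('a, 'm) monoid_scheme \<Rightarrow> ('b, 'n) monoid_scheme \<Rightarrow> 'a \<Rightarrow> ('b \<Rightarrow> 'a) \<times> 'b"
  where "wreath_base A B a =
    ((\<lambda>b\<in>carrier B. if b = \<one>\<^bsub>B\<^esub> then a else \<one>\<^bsub>A\<^esub>), \<one>\<^bsub>B\<^esub>)"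

definition int_power_group :: "nat \<Rightarrow> (nat \<Rightarrow> int) monoid"
  where "int_power_group d = product_group {..<d} (\<lambda>_. integer_group)"

section \<open>Finitely generated groups and word length\<close>

definition finitely_generated :: "('g, 'm) monoid_scheme \<Rightarrow> bool"
  where "finitely_generated G \<longleftrightarrow>
    (\<exists>S. finite S \<and> S \<subseteq> carrier G \<and> generate G S = carrier G)"

definition symmetric_generating_set :: "('g, 'm) monoid_scheme \<Rightarrow> 'g set \<Rightarrow> bool"
  where "symmetric_generating_set G S \<longleftrightarrow>
    finite S \<and> S \<subseteq> carrier G \<and> (\<forall>s\<in>S. inv\<^bsub>G\<^esub> s \<in> S) \<and> generate G S = carrier G"

definition word_length :: "('g, 'm) monoid_scheme \<Rightarrow> 'g set \<Rightarrow> 'g \<Rightarrow> nat"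
  where "word_length G S g =
    (LEAST n. \<exists>ws. set ws \<subseteq> S \<and> length ws = n \<and> foldr (monoid.mult G) ws \<one>\<^bsub>G\<^esub> = g)"

section \<open>Faithful actions and their growth\<close>

definition faithful_G_set ::
  "('g, 'm) monoid_scheme \<Rightarrow> 'x set \<Rightarrow> ('g \<Rightarrow> 'x \<Rightarrow> 'x) \<Rightarrow> bool"
  where "faithful_G_set G Y \<phi> \<longleftrightarrow> Y \<noteq> {} \<and> faithful_action G Y \<phi>"

text \<open>The maximum ranges over a set of natural numbers that are bounded by the cardinality of a
  ball of \<open>G\<close>, so \<^const>\<open>Max\<close> is meaningful even if \<open>Y\<close> is infinite.\<close>

definition action_growth ::
  "('g, 'm) monoid_scheme \<Rightarrow> 'g set \<Rightarrow> 'x set \<Rightarrow> ('g \<Rightarrow> 'x \<Rightarrow> 'x) \<Rightarrow> nat \<Rightarrow> real"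
  where "action_growth G S Y \<phi> n =
    real (Max ((\<lambda>x. card {\<phi> g x | g. g \<in> carrier G \<and> word_length G S g \<le> n}) ` Y))"

text \<open>The constant is taken to be a natural number so that \<open>C * n\<close> is again an argument of \<open>g\<close>.\<close>

definition growth_le :: "(nat \<Rightarrow> real) \<Rightarrow> (nat \<Rightarrow> real) \<Rightarrow> bool" (infix \<open>\<preceq>\<^sub>g\<close> 50)
  where "f \<preceq>\<^sub>g g \<longleftrightarrow>
    (\<exists>C::nat. C > 0 \<and> (\<forall>\<^sub>F n in sequentially. f n \<le> real C * g (C * n)))"

definition growth_equiv :: "(nat \<Rightarrow> real) \<Rightarrow> (nat \<Rightarrow> real) \<Rightarrow> bool" (infix \<open>\<simeq>\<^sub>g\<close> 50)
  where "f \<simeq>\<^sub>g g \<longleftrightarrow> f \<preceq>\<^sub>g g \<and> g \<preceq>\<^sub>g f"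

text \<open>The type argument is the universe from which the \<open>G\<close>-sets are drawn; a statement with a free
  type variable there speaks about all \<open>G\<close>-sets. Finite generation is part of the definition, since
  otherwise the quantification over \<open>S\<close> would be vacuous.\<close>

definition schreier_growth_gap ::
  "'x itself \<Rightarrow> ('g, 'm) monoid_scheme \<Rightarrow> (nat \<Rightarrow> real) \<Rightarrow> bool"
  where "schreier_growth_gap _ G f \<longleftrightarrow>
    finitely_generated G \<and>
    (\<forall>S (Y :: 'x set) \<phi>. symmetric_generating_set G S \<longrightarrow> faithful_G_set G Y \<phi> \<longrightarrow>
       f \<preceq>\<^sub>g action_growth G S Y \<phi>)"

definition non_foldable :: "'x itself \<Rightarrow> ('g, 'm) monoid_scheme \<Rightarrow> 'g set \<Rightarrow> bool"
  where "non_foldable _ G L \<longleftrightarrow>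
    L \<subseteq> carrier G \<and>
    (\<forall>(Y :: 'x set) \<phi> \<Sigma>. faithful_G_set G Y \<phi> \<longrightarrow> finite \<Sigma> \<longrightarrow> \<Sigma> \<subseteq> L \<longrightarrow>
       (\<exists>x\<in>Y. inj_on (\<lambda>g. \<phi> g x) \<Sigma>))"

section \<open>Asymptotic dimension\<close>

definition asdim_at_most :: "'x set \<Rightarrow> ('x \<Rightarrow> 'x \<Rightarrow> ereal) \<Rightarrow> nat \<Rightarrow> bool"
  where "asdim_at_most Y \<delta> n \<longleftrightarrow>
    (\<forall>R::real. R > 0 \<longrightarrow>
      (\<exists>\<U>. (\<forall>U\<in>\<U>. U \<subseteq> Y) \<and> \<Union>\<U> = Y \<and>
        (\<exists>D::real. \<forall>U\<in>\<U>. \<forall>x\<in>U. \<forall>y\<in>U. \<delta> x y \<le> ereal D) \<and>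
        (\<forall>x\<in>Y. finite {U\<in>\<U>. U \<inter> {y\<in>Y. \<delta> x y \<le> ereal R} \<noteq> {}} \<and>
                card {U\<in>\<U>. U \<inter> {y\<in>Y. \<delta> x y \<le> ereal R} \<noteq> {}} \<le> n + 1)))"

text \<open>The infimum of the empty set is \<open>\<infinity>\<close>, here and for the distance between points in different
  components below.\<close>

definition asdim :: "'x set \<Rightarrow> ('x \<Rightarrow> 'x \<Rightarrow> ereal) \<Rightarrow> enat"
  where "asdim Y \<delta> = (INF n\<in>{n. asdim_at_most Y \<delta> n}. enat n)"

definition schreier_edges ::
  "'g set \<Rightarrow> 'x set \<Rightarrow> ('g \<Rightarrow> 'x \<Rightarrow> 'x) \<Rightarrow> ('x \<times> 'x) set"
  where "schreier_edges S Y \<phi> =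
    {(x, y). x \<in> Y \<and> y \<in> Y \<and> (\<exists>s\<in>S. y = \<phi> s x \<or> x = \<phi> s y)}"

definition simplicial_dist :: "('x \<times> 'x) set \<Rightarrow> 'x \<Rightarrow> 'x \<Rightarrow> ereal"
  where "simplicial_dist E x y = (INF n\<in>{n. (x, y) \<in> E ^^ n}. ereal (real n))"

definition action_asdim :: "'g set \<Rightarrow> 'x set \<Rightarrow> ('g \<Rightarrow> 'x \<Rightarrow> 'x) \<Rightarrow> enat"
  where "action_asdim S Y \<phi> = asdim Y (simplicial_dist (schreier_edges S Y \<phi>))"

end

theory Submission
  imports Defs "HOL-Analysis.Brouwer_Fixpoint"
begin

text \<open>Non-foldability: if every point \<open>y\<close> of a faithful set is fixed by one of finitely many elements
  \<open>g\<close>, then the stabilizer of \<open>y\<close> contains a conjugate of some \<open>g\<close> under each base element \<open>u\<close>. A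
  pigeonhole argument on a grid of base elements yields two conjugates of the same \<open>g\<close>, whose quotient
  is an element \<open>(1 - g) w\<close> of the base. Choosing the grid along the orbits of \<open>g\<close> makes a nontrivial
  base element fix all \<open>y\<close>, since \<open>1 - g ^ m\<close> is injective on the base when \<open>g\<close> acts freely.

  The growth bounds follow by embedding boxes of \<open>\<int>\<^sup>d\<close> and \<open>\<int>\<^sup>d \<times> \<langle>t\<rangle>\<close>. For the asymptotic dimension,
  an embedded box is covered by the components of the preimages of the sets of a cover. These have
  bounded cardinality, hence bounded diameter, and Kuhn's combinatorial lemma forces \<open>d + 1\<close> of them
  to meet a unit cube.

  The bounds are attained on \<open>P \<times> \<int>\<^sup>d\<close> with \<open>(f, b) (p, c) = (f (b c) p, b c)\<close>, where \<open>P\<close> is the union of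
  a finite quotient of \<open>A\<close> and of orbits of homomorphisms \<open>A \<rightarrow> \<int>\<close>. The point \<open>p\<close> only moves near
  \<open>c = 0\<close>, so \<open>P\<close> contributes a one-dimensional set attached along bounded parts of copies of \<open>\<int>\<^sup>d\<close>.\<close>

text \<open>Faithfulness is only contradicted by one base element \<open>v \<noteq> \<one>\<close>
  that fixes all points at once, whereas the pigeonhole returns, for each point, an uncontrolled
  \<open>g\<close> and an uncontrolled gap \<open>n\<close> between two grid points. The choice of
  \<open>v\<close> removes this dependence: with \<open>k\<close> elements \<open>g\<close> outside
  the base and \<open>r = k!\<close>, every gap divides \<open>r\<close>, so
  \<open>1 - g ^ n\<close> divides \<open>1 - g ^ r\<close>, and \<open>v\<close> is a common
  multiple of the operators \<open>(1 - g) (1 - g ^ r)\<close>. It is nontrivial because these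
  operators commute and are injective on the base.

  Elements lying in the base itself act trivially on it and escape this argument. They share one
  nontrivial element in all the cyclic groups they generate: either all its conjugates stabilize the
  point, and then so does \<open>v\<close>, or some conjugation makes the base elements irrelevant.

  For the dimension, the label in Kuhn's lemma asks whether the component of a grid point within its
  cover element reaches a given face; a box too long to be crossed by such a component gives
  opposite faces different labels.\<close>

section \<open>Pigeonhole and common multiples in abelian groups\<close>

text \<open>Counting on a grid with one coordinate per colour and \<open>card T + 1\<close> values
  each: if no line in direction \<open>t\<close> carried the colour \<open>t\<close> twice, the
  class of \<open>t\<close> would inject into the grid with coordinate \<open>t\<close> deleted, and
  all classes together would be too small. Each colour has its own direction so that the progression
  can be adapted to the group element serving as colour.\<close>

lemma (in comm_group) monochromatic_line:
  fixes T :: "'t set"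
  assumes T: "finite T" and c: "\<And>x. x \<in> carrier G \<Longrightarrow> c x \<in> T"
    and y: "\<And>t m. t \<in> T \<Longrightarrow> y t m \<in> carrier G"
  obtains t x m m' where "t \<in> T" "x \<in> carrier G" "m < m'" "m' \<le> card T"
    "c (x \<otimes> y t m) = t" "c (x \<otimes> y t m') = t"
proof -
  \<comment> \<open>The count runs over the index set \<open>J\<close>, not over the points
    \<open>p j\<close>, since \<open>p\<close> may fail to be injective.\<close>
  define J where "J = (T \<rightarrow>\<^sub>E {..card T})"
  define p where "p j = finprod G (\<lambda>t. y t (j t)) T" for j :: "'t \<Rightarrow> nat"
  have p_split: "p j = finprod G (\<lambda>t. y t (j t)) (T - {t}) \<otimes> y t (j t)" if "t \<in> T" for j t
  proof -
    have "p j = finprod G (\<lambda>t. y t (j t)) (insert t (T - {t}))"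
      using that by (simp add: p_def insert_absorb)
    also have "\<dots> = y t (j t) \<otimes> finprod G (\<lambda>t. y t (j t)) (T - {t})"
      using T y that by (intro finprod_insert) auto
    also have "\<dots> = finprod G (\<lambda>t. y t (j t)) (T - {t}) \<otimes> y t (j t)"
      using y that by (intro m_comm finprod_closed) auto
    finally show ?thesis .
  qed
  have "\<exists>t\<in>T. \<exists>j\<in>J. \<exists>j'\<in>J. j t < j' t \<and> (\<forall>s\<in>T - {t}. j s = j' s) \<and> c (p j) = t \<and> c (p j') = t"
  proof (rule ccontr)
    assume neg: "\<not> ?thesis"
    have inj: "inj_on (\<lambda>j. restrict j (T - {t})) {j \<in> J. c (p j) = t}" if t: "t \<in> T" for t
    proof (rule inj_onI)
      fix j j' assume jj: "j \<in> {j \<in> J. c (p j) = t}" "j' \<in> {j \<in> J. c (p j) = t}"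
        and eq: "restrict j (T - {t}) = restrict j' (T - {t})"
      have eq': "\<forall>s\<in>T - {t}. j s = j' s"
        using eq by (metis restrict_apply')
      then have "j t = j' t"
        using neg jj t by (metis (mono_tags, lifting) linorder_neqE_nat mem_Collect_eq)
      then have "\<forall>s\<in>T. j s = j' s"
        using eq' by blast
      then show "j = j'"
        using jj by (intro PiE_ext[of j T "\<lambda>_. {..card T}" j']) (auto simp: J_def)
    qed
    have "card {j \<in> J. c (p j) = t} \<le> Suc (card T) ^ (card T - 1)" if t: "t \<in> T" for t
    proof -
      have "card {j \<in> J. c (p j) = t} \<le> card ((T - {t}) \<rightarrow>\<^sub>E {..card T})"
        by (rule card_inj_on_le[OF inj[OF t]])
          (use T in \<open>auto simp: J_def PiE_iff extensional_def intro!: finite_PiE split: if_splits\<close>)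
      then show ?thesis
        using T t by (simp add: card_PiE)
    qed
    then have 1: "(\<Sum>t\<in>T. card {j \<in> J. c (p j) = t}) \<le> card T * Suc (card T) ^ (card T - 1)"
      using sum_bounded_above[of T "\<lambda>t. card {j \<in> J. c (p j) = t}"] by simp
    have 2: "card (\<Union>t\<in>T. {j \<in> J. c (p j) = t}) \<le> (\<Sum>t\<in>T. card {j \<in> J. c (p j) = t})"
      by (rule card_UN_le[OF T])
    have 3: "(\<Union>t\<in>T. {j \<in> J. c (p j) = t}) = J"
      using c y by (auto simp: p_def)
    have 4: "card J = Suc (card T) ^ card T"
      using T by (simp add: J_def card_PiE)
    have "T \<noteq> {}"
      using c[OF one_closed] by auto
    then have "card T > 0"
      using T by (simp add: card_gt_0_iff)
    then have "card T * Suc (card T) ^ (card T - 1) < Suc (card T) ^ card T"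
      by (cases "card T") auto
    with 1 2 show False
      unfolding 3 4 by linarith
  qed
  then obtain t j j' where tj: "t \<in> T" "j \<in> J" "j' \<in> J" "j t < j' t"
    "\<forall>s\<in>T - {t}. j s = j' s" "c (p j) = t" "c (p j') = t"
    by blast
  define x where "x = finprod G (\<lambda>t. y t (j t)) (T - {t})"
  have x': "x = finprod G (\<lambda>t. y t (j' t)) (T - {t})"
    unfolding x_def using tj y by (intro finprod_cong) (auto simp: simp_implies_def)
  show ?thesis
  proof (rule that)
    show "c (x \<otimes> y t (j t)) = t" "c (x \<otimes> y t (j' t)) = t"
      using p_split[OF tj(1)] tj x' by (simp_all add: x_def)
    show "x \<in> carrier G"
      unfolding x_def using y by (intro finprod_closed) auto
    show "j' t \<le> card T"
      using tj by (auto simp: J_def)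
  qed (use tj in auto)
qed

text \<open>The composite of all \<open>E i\<close> applied to \<open>a\<close> serves: commuting
  moves any factor to the outside, and trivial kernels keep the value away from
  \<open>\<one>\<close>. The clause about \<open>K\<close> is quantified over all sets because
  \<open>v\<close> has to be fixed before the point whose stabilizer determines
  \<open>K\<close>.\<close>

lemma (in comm_group) common_image:
  assumes "finite I" and E: "\<And>i u. i \<in> I \<Longrightarrow> u \<in> carrier G \<Longrightarrow> E i u \<in> carrier G"
    and inj: "\<And>i u. i \<in> I \<Longrightarrow> u \<in> carrier G \<Longrightarrow> E i u = \<one> \<Longrightarrow> u = \<one>"
    and comm: "\<And>i j u. i \<in> I \<Longrightarrow> j \<in> I \<Longrightarrow> u \<in> carrier G \<Longrightarrow> E i (E j u) = E j (E i u)"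
    and a: "a \<in> carrier G" "a \<noteq> \<one>"
  shows "\<exists>v\<in>carrier G. v \<noteq> \<one> \<and> (\<forall>i\<in>I. \<exists>u\<in>carrier G. E i u = v)
    \<and> (\<forall>K. a \<in> K \<longrightarrow> (\<forall>i\<in>I. \<forall>u\<in>K. E i u \<in> K) \<longrightarrow> v \<in> K)"
  using assms(1) E inj comm
proof (induction I)
  case empty
  then show ?case using a by (intro bexI[of _ a]) simp_all
next
  case (insert t I)
  obtain v where v: "v \<in> carrier G" "v \<noteq> \<one>" "\<forall>i\<in>I. \<exists>u\<in>carrier G. E i u = v"
    "\<forall>K. a \<in> K \<longrightarrow> (\<forall>i\<in>I. \<forall>u\<in>K. E i u \<in> K) \<longrightarrow> v \<in> K"
  proof -
    have "\<exists>v\<in>carrier G. v \<noteq> \<one> \<and> (\<forall>i\<in>I. \<exists>u\<in>carrier G. E i u = v)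
      \<and> (\<forall>K. a \<in> K \<longrightarrow> (\<forall>i\<in>I. \<forall>u\<in>K. E i u \<in> K) \<longrightarrow> v \<in> K)"
    proof (rule insert.IH)
      show "E i u \<in> carrier G" if "i \<in> I" "u \<in> carrier G" for i u
        using insert.prems(1)[of i u] that by simp
      show "u = \<one>" if "i \<in> I" "u \<in> carrier G" "E i u = \<one>" for i u
        using insert.prems(2)[of i u] that by simp
      show "E i (E j u) = E j (E i u)" if "i \<in> I" "j \<in> I" "u \<in> carrier G" for i j u
        by (rule insert.prems(3)) (use that in simp_all)
    qed
    then show thesis
      by (elim bexE conjE) (rule that)
  qed
  have "\<exists>u\<in>carrier G. E i u = E t v" if i: "i \<in> insert t I" for i
  proof (cases "i = t")
    case True
    show ?thesis
      unfolding True by (rule bexI[of _ v]) (rule refl, rule v(1))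
  next
    case False
    with i have "i \<in> I" by simp
    with v(3) obtain u where u: "u \<in> carrier G" "E i u = v" by blast
    have "E i (E t u) = E t v"
      unfolding insert.prems(3)[OF i insertI1 u(1)] u(2) by (rule refl)
    then show ?thesis
      by (rule bexI) (rule insert.prems(1)[OF insertI1 u(1)])
  qed
  moreover have "E t v \<noteq> \<one>"
    using insert.prems(2)[of t v] v(1,2) by fastforce
  moreover have "E t v \<in> carrier G"
    using insert.prems(1)[of t v] v(1) by simp
  ultimately show ?case
  proof (intro bexI[of _ "E t v"] conjI allI impI)
    fix K assume "a \<in> K" "\<forall>i\<in>insert t I. \<forall>u\<in>K. E i u \<in> K"
    then show "E t v \<in> K"
      using v(4)[rule_format, of K] by blast
  qed blast+
qed


section \<open>Conjugation and the operators \<open>1 - g\<close>\<close>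

definition conj_by :: "('g, 'm) monoid_scheme \<Rightarrow> 'g \<Rightarrow> 'g \<Rightarrow> 'g"
  where "conj_by G g u = g \<otimes>\<^bsub>G\<^esub> u \<otimes>\<^bsub>G\<^esub> inv\<^bsub>G\<^esub> g"

text \<open>The commutator of \<open>u\<close> and \<open>g\<close>; on an abelian normal subgroup
  written additively it is \<open>(1 - g) u\<close>.\<close>

definition displace :: "('g, 'm) monoid_scheme \<Rightarrow> 'g \<Rightarrow> 'g \<Rightarrow> 'g"
  where "displace G g u = u \<otimes>\<^bsub>G\<^esub> inv\<^bsub>G\<^esub> (conj_by G g u)"

lemma (in group) cancel_inv [simp]:
  assumes "g \<in> carrier G" "x \<in> carrier G"
  shows "inv g \<otimes> (g \<otimes> x) = x" "g \<otimes> (inv g \<otimes> x) = x"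
  using assms by (simp_all flip: m_assoc)

lemma (in group) conj_by_closed [simp, intro]:
  "g \<in> carrier G \<Longrightarrow> u \<in> carrier G \<Longrightarrow> conj_by G g u \<in> carrier G"
  by (simp add: conj_by_def)

lemma (in group) conj_by_mult:
  "g \<in> carrier G \<Longrightarrow> u \<in> carrier G \<Longrightarrow> v \<in> carrier G
    \<Longrightarrow> conj_by G g (u \<otimes> v) = conj_by G g u \<otimes> conj_by G g v"
  by (simp add: conj_by_def m_assoc)

lemma (in group) conj_by_hom: "g \<in> carrier G \<Longrightarrow> group_hom G G (conj_by G g)"
  by (simp add: group_hom_def group_hom_axioms_def hom_def conj_by_mult)

lemma (in group) conj_by_inv:
  "g \<in> carrier G \<Longrightarrow> u \<in> carrier G \<Longrightarrow> conj_by G g (inv u) = inv (conj_by G g u)"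
  by (simp add: conj_by_def m_assoc inv_mult_group)

lemma (in group) conj_by_conj_by:
  "g \<in> carrier G \<Longrightarrow> h \<in> carrier G \<Longrightarrow> u \<in> carrier G
    \<Longrightarrow> conj_by G g (conj_by G h u) = conj_by G (g \<otimes> h) u"
  by (simp add: conj_by_def m_assoc inv_mult_group)

lemma (in group) conj_by_one [simp]: "u \<in> carrier G \<Longrightarrow> conj_by G \<one> u = u"
  by (simp add: conj_by_def)

lemma (in group) conj_by_inv_conj_by [simp]:
  "g \<in> carrier G \<Longrightarrow> u \<in> carrier G \<Longrightarrow> conj_by G (inv g) (conj_by G g u) = u"
  by (simp add: conj_by_conj_by)

lemma (in group) displace_eq_one_iff:
  assumes "g \<in> carrier G" "u \<in> carrier G"
  shows "displace G g u = \<one> \<longleftrightarrow> g \<otimes> u = u \<otimes> g"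
proof -
  have "displace G g u = \<one> \<longleftrightarrow> u = conj_by G g u"
    using assms by (simp add: displace_def inv_solve_right')
  also have "\<dots> \<longleftrightarrow> u \<otimes> g = g \<otimes> u"
    using assms by (auto simp: conj_by_def inv_solve_right)
  finally show ?thesis by auto
qed

section \<open>Abelian normal subgroups with abelian quotient\<close>

text \<open>Containing all commutators makes \<open>N\<close> normal and \<open>G / N\<close>
  abelian at once. Conjugation on \<open>N\<close> then depends only on the class modulo
  \<open>N\<close> and turns \<open>N\<close> into a module over a commutative ring, in which the
  operators \<open>1 - g\<close> are additive and commute.\<close>

locale abelian_extension = group G for G (structure) +
  fixes N
  assumes N: "subgroup N G"
    and N_comm: "\<And>u v. u \<in> N \<Longrightarrow> v \<in> N \<Longrightarrow> u \<otimes> v = v \<otimes> u"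
    and commutator_N: "\<And>g h. g \<in> carrier G \<Longrightarrow> h \<in> carrier G \<Longrightarrow> g \<otimes> h \<otimes> inv g \<otimes> inv h \<in> N"
begin

lemma N_carrier [simp]: "u \<in> N \<Longrightarrow> u \<in> carrier G"
  using N by (meson subgroup.mem_carrier)

lemma N_mult [simp]: "u \<in> N \<Longrightarrow> v \<in> N \<Longrightarrow> u \<otimes> v \<in> N"
  using N by (simp add: subgroup.m_closed)

lemma N_inv [simp]: "u \<in> N \<Longrightarrow> inv u \<in> N"
  using N by (simp add: subgroup.m_inv_closed)

lemma N_one [simp]: "\<one> \<in> N"
  using N by (simp add: subgroup.one_closed)

lemma N_lcomm: "u \<in> N \<Longrightarrow> v \<in> N \<Longrightarrow> w \<in> N \<Longrightarrow> u \<otimes> (v \<otimes> w) = v \<otimes> (u \<otimes> w)"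
  by (simp add: N_comm[of u v] flip: m_assoc)

lemma comm_group_N: "comm_group (G\<lparr>carrier := N\<rparr>)"
  by (rule group.group_comm_groupI[OF subgroup_imp_group[OF N]]) (simp add: N_comm)

lemma conj_by_N [simp]:
  assumes "g \<in> carrier G" "u \<in> N"
  shows "conj_by G g u \<in> N"
proof -
  have "conj_by G g u = (g \<otimes> u \<otimes> inv g \<otimes> inv u) \<otimes> u"
    using assms by (simp add: conj_by_def m_assoc)
  then show ?thesis
    using commutator_N[of g u] assms by simp
qed

lemma conj_by_self: "u \<in> N \<Longrightarrow> v \<in> N \<Longrightarrow> conj_by G u v = v"
  by (simp add: conj_by_def N_comm[of u v] m_assoc)

lemma conj_by_mod_N: "n \<in> N \<Longrightarrow> g \<in> carrier G \<Longrightarrow> u \<in> N \<Longrightarrow> conj_by G (n \<otimes> g) u = conj_by G g u"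
  by (simp add: conj_by_conj_by[symmetric] conj_by_self)

lemma conj_by_commute:
  assumes "g \<in> carrier G" "h \<in> carrier G" "u \<in> N"
  shows "conj_by G g (conj_by G h u) = conj_by G h (conj_by G g u)"
proof -
  have "(g \<otimes> h \<otimes> inv g \<otimes> inv h) \<otimes> (h \<otimes> g) = g \<otimes> h"
    using assms by (simp add: m_assoc)
  then show ?thesis
    using assms conj_by_mod_N[OF commutator_N[of g h], of "h \<otimes> g" u] by (simp add: conj_by_conj_by)
qed

lemma displace_N [simp]: "g \<in> carrier G \<Longrightarrow> u \<in> N \<Longrightarrow> displace G g u \<in> N"
  by (simp add: displace_def)

lemma displace_mult:
  assumes g: "g \<in> carrier G" and u: "u \<in> N" and v: "v \<in> N"
  shows "displace G g (u \<otimes> v) = displace G g u \<otimes> displace G g v"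
proof -
  let ?p = "inv (conj_by G g u)" and ?q = "inv (conj_by G g v)"
  have N: "?p \<in> N" "?q \<in> N" using assms by simp_all
  have "displace G g (u \<otimes> v) = u \<otimes> v \<otimes> (?p \<otimes> ?q)"
    using assms N_comm[OF N] by (simp add: displace_def conj_by_mult inv_mult_group)
  also have "\<dots> = u \<otimes> (?p \<otimes> (v \<otimes> ?q))"
    using assms N N_lcomm[OF v N] by (simp add: m_assoc)
  finally show ?thesis
    using assms N by (simp add: displace_def m_assoc)
qed

lemma displace_inv:
  assumes "g \<in> carrier G" "u \<in> N"
  shows "displace G g (inv u) = inv (displace G g u)"
proof -
  have "inv (displace G g u) = conj_by G g u \<otimes> inv u"
    using assms by (simp add: displace_def inv_mult_group)
  also have "\<dots> = inv u \<otimes> conj_by G g u"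
    using assms by (intro N_comm) simp_all
  finally show ?thesis
    using assms by (simp add: displace_def conj_by_inv)
qed

lemma displace_conj_by:
  "g \<in> carrier G \<Longrightarrow> h \<in> carrier G \<Longrightarrow> u \<in> N
    \<Longrightarrow> displace G g (conj_by G h u) = conj_by G h (displace G g u)"
  by (simp add: displace_def conj_by_mult conj_by_inv conj_by_commute[of g h])

lemma displace_commute:
  "g \<in> carrier G \<Longrightarrow> h \<in> carrier G \<Longrightarrow> u \<in> N
    \<Longrightarrow> displace G g (displace G h u) = displace G h (displace G g u)"
  by (simp add: displace_def[of G h] displace_mult displace_inv displace_conj_by)

text \<open>\<open>1 - g ^ (r * q)\<close> is a multiple of \<open>1 - g ^ r\<close>, the cofactor
  being a sum of powers of \<open>g\<close>, and \<open>M\<close> is stable under these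
  powers.\<close>

lemma displace_pow_mult:
  fixes r q :: nat
  assumes M: "subgroup M G" "M \<subseteq> N" "\<And>u. u \<in> M \<Longrightarrow> conj_by G g u \<in> M"
    and g: "g \<in> carrier G" and u: "u \<in> N" and r: "displace G (g [^] r) u \<in> M"
  shows "displace G (g [^] (r * q)) u \<in> M"
proof -
  have pow: "conj_by G (g [^] m) v \<in> M" if "v \<in> M" for m :: nat and v
  proof (induction m)
    case 0
    then show ?case using that M(2) by auto
  next
    case (Suc m)
    have "g [^] Suc m = g \<otimes> g [^] m"
      using g by (rule nat_pow_Suc2)
    then have "conj_by G (g [^] Suc m) v = conj_by G g (conj_by G (g [^] m) v)"
      using that M(2) g by (subst conj_by_conj_by) auto
    then show ?case
      using M(3) Suc by simp
  qed
  show ?thesis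
  proof (induction q)
    case 0
    then show ?case
      using u subgroup.one_closed[OF M(1)] by (simp add: displace_def)
  next
    case (Suc q)
    let ?h = "g [^] (r * q)" and ?k = "g [^] r"
    have "g [^] (r * Suc q) = ?h \<otimes> ?k"
      using g by (simp add: nat_pow_mult add.commute)
    then have "displace G (g [^] (r * Suc q)) u = u \<otimes> inv (conj_by G ?h (conj_by G ?k u))"
      using u g by (simp add: displace_def conj_by_conj_by)
    also have "\<dots> = displace G ?h u \<otimes> conj_by G ?h (displace G ?k u)"
      using u g by (simp add: displace_def conj_by_mult conj_by_inv m_assoc)
    finally have eq: "displace G (g [^] (r * Suc q)) u
      = displace G ?h u \<otimes> conj_by G ?h (displace G ?k u)" .
    show ?case
      unfolding eq by (intro subgroup.m_closed[OF M(1)] Suc.IH pow r)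
  qed
qed


text \<open>\<open>T1\<close> consists of elements all of whose positive powers act freely on
  \<open>N\<close>; those of \<open>T0\<close> act trivially on \<open>N\<close>, and the shared
  element \<open>a\<close> replaces freeness. If every point were fixed by some element, a
  nontrivial \<open>v\<close> chosen independently of the point would act trivially.\<close>

lemma avoid_fixed_points:
  assumes act: "faithful_action G Y \<phi>"
    and T0: "finite T0" "T0 \<subseteq> N" and T1: "finite T1" "T1 \<subseteq> carrier G"
    and free: "\<And>g m u. g \<in> T1 \<Longrightarrow> 0 < m \<Longrightarrow> u \<in> N \<Longrightarrow> g [^] (m::nat) \<otimes> u = u \<otimes> g [^] m \<Longrightarrow> u = \<one>"
    and a: "a \<in> N" "a \<noteq> \<one>" "\<And>g. g \<in> T0 \<Longrightarrow> a \<in> generate G {g}"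
  shows "\<exists>y\<in>Y. \<forall>g\<in>T0 \<union> T1. \<phi> g y \<noteq> y"
proof (rule ccontr)
  assume "\<not> ?thesis"
  then have fixed: "\<exists>g\<in>T0 \<union> T1. \<phi> g y = y" if "y \<in> Y" for y
    using that by blast
  interpret faithful_action G Y \<phi> by (rule act)
  interpret M: comm_group "G\<lparr>carrier := N\<rparr>" by (rule comm_group_N)
  \<comment> \<open>Any gap between \<open>1\<close> and \<open>card T1\<close> divides
    \<open>r\<close>, so a single exponent covers all outcomes of the pigeonhole.\<close>
  define r where "r = (fact (card T1) :: nat)"
  have r: "r > 0" by (simp add: r_def)
  \<comment> \<open>The outer factor \<open>1 - g\<close> will come from the quotient of two
    conjugates of \<open>g\<close>, the inner factor from the gap between two grid points.\<close>
  define E where "E g u = displace G g (displace G (g [^] r) u)" for g u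
  have T1c: "g \<in> carrier G" if "g \<in> T1" for g using that T1(2) by blast
  have E_N: "E g u \<in> N" if "g \<in> T1" "u \<in> N" for g u
    using that T1c by (simp add: E_def)
  have E_inj: "u = \<one>" if g: "g \<in> T1" and u: "u \<in> N" and eq: "E g u = \<one>" for g u
  proof -
    let ?w = "displace G (g [^] r) u"
    have w: "?w \<in> N" using g u T1c by simp
    then have "g \<otimes> ?w = ?w \<otimes> g"
      using eq g T1c unfolding E_def by (simp add: displace_eq_one_iff)
    then have "?w = \<one>"
      using free[OF g, of 1 ?w] w T1c[OF g] by simp
    then have "g [^] r \<otimes> u = u \<otimes> g [^] r"
      using g u T1c by (simp add: displace_eq_one_iff)
    then show ?thesis
      using free[OF g r u] by simp
  qed
  have E_comm: "E g (E h u) = E h (E g u)" if "g \<in> T1" "h \<in> T1" "u \<in> N" for g h u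
  proof -
    have gh: "g \<in> carrier G" "h \<in> carrier G" using T1c[OF that(1)] T1c[OF that(2)] .
    let ?D = "displace G"
    have N: "?D (h [^] r) u \<in> N" "?D (g [^] r) u \<in> N" "?D (g [^] r) (?D (h [^] r) u) \<in> N"
      using gh that(3) by simp_all
    have "?D g (?D (g [^] r) (?D h (?D (h [^] r) u))) = ?D g (?D h (?D (g [^] r) (?D (h [^] r) u)))"
      by (rule arg_cong[of _ _ "?D g"], rule displace_commute) (use gh N in simp_all)
    also have "\<dots> = ?D h (?D g (?D (g [^] r) (?D (h [^] r) u)))"
      by (rule displace_commute) (use gh N in simp_all)
    also have "?D (g [^] r) (?D (h [^] r) u) = ?D (h [^] r) (?D (g [^] r) u)"
      by (rule displace_commute) (use gh that(3) in simp_all)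
    also have "?D g (?D (h [^] r) (?D (g [^] r) u)) = ?D (h [^] r) (?D g (?D (g [^] r) u))"
      by (rule displace_commute) (use gh N in simp_all)
    finally show ?thesis
      unfolding E_def .
  qed
  have "\<exists>v\<in>N. v \<noteq> \<one> \<and> (\<forall>g\<in>T1. \<exists>u\<in>N. E g u = v)
    \<and> (\<forall>K. a \<in> K \<longrightarrow> (\<forall>g\<in>T1. \<forall>u\<in>K. E g u \<in> K) \<longrightarrow> v \<in> K)"
  proof (rule M.common_image[OF T1(1), of E a, simplified])
    show "E g u \<in> N" if "g \<in> T1" "u \<in> N" for g u
      by (rule E_N[OF that])
    show "u = \<one>" if "g \<in> T1" "u \<in> N" "E g u = \<one>" for g u
      by (rule E_inj[OF that])
    show "E g (E h u) = E h (E g u)" if "g \<in> T1" "h \<in> T1" "u \<in> N" for g h u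
      by (rule E_comm[OF that])
  qed (use a(1,2) in simp_all)
  then obtain v where v: "v \<in> N" "v \<noteq> \<one>" "\<forall>g\<in>T1. \<exists>u\<in>N. E g u = v"
    "\<forall>K. a \<in> K \<longrightarrow> (\<forall>g\<in>T1. \<forall>u\<in>K. E g u \<in> K) \<longrightarrow> v \<in> K"
    by (elim bexE conjE)
  \<comment> \<open>\<open>\<psi> g\<close> is \<open>v\<close> divided by \<open>E g\<close>; in
    direction \<open>g\<close> the grid will follow its orbit under \<open>g\<close>.\<close>
  from bchoice[OF v(3)[unfolded Bex_def]] obtain \<psi> where \<psi>: "\<And>g. g \<in> T1 \<Longrightarrow> \<psi> g \<in> N" "\<And>g. g \<in> T1 \<Longrightarrow> E g (\<psi> g) = v"
    by blast
  have "v \<in> stabilizer G \<phi> y" if y: "y \<in> Y" for y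
  proof -
    define H where "H = stabilizer G \<phi> y"
    have H: "subgroup H G"
      unfolding H_def by (rule stabilizer_subgroup[OF y])
    \<comment> \<open>The assumption is applied to the translate of \<open>y\<close> by
      \<open>inv w\<close>; transported back to \<open>y\<close>, a fixing element becomes a
      conjugate in \<open>H\<close>.\<close>
    have conj_fixed: "\<exists>g\<in>T0 \<union> T1. conj_by G w g \<in> H" if w: "w \<in> carrier G" for w
    proof -
      have "\<phi> (inv w) y \<in> Y"
        using element_image[OF _ y refl] w by simp
      then obtain g where g: "g \<in> T0 \<union> T1" "\<phi> g (\<phi> (inv w) y) = \<phi> (inv w) y"
        using fixed by blast
      have gc: "g \<in> carrier G"
        using g(1) T0(2) T1c by auto
      have "\<phi> (conj_by G w g) y = \<phi> w (\<phi> g (\<phi> (inv w) y))"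
        unfolding conj_by_def using y w gc
        by (simp add: composition_rule element_image[OF _ y refl])
      also have "\<dots> = \<phi> (w \<otimes> inv w) y"
        using y w composition_rule[OF y, of w "inv w"] by (simp add: g(2) del: r_inv)
      also have "\<dots> = y"
        using y w by (simp flip: id_eq_one)
      finally show ?thesis
        using g(1) gc w by (auto simp: H_def stabilizer_def)
    qed
    show ?thesis
    proof (cases "\<forall>w\<in>carrier G. \<exists>g\<in>T0. conj_by G w g \<in> H")
      case True
      \<comment> \<open>The intersection of \<open>N\<close> with the normal core of
        \<open>H\<close>. Being invariant under conjugation, it is stable under every
        \<open>1 - h\<close>, so it inherits \<open>v\<close> from \<open>a\<close>.\<close>
      define K where "K = {u \<in> N. \<forall>w\<in>carrier G. conj_by G w u \<in> H}"
      have "a \<in> K"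
      proof -
        have "conj_by G w a \<in> H" if w: "w \<in> carrier G" for w
        proof -
          obtain g where g: "g \<in> T0" "conj_by G w g \<in> H" using True w by blast
          interpret h: group_hom G G "conj_by G w" by (rule conj_by_hom[OF w])
          have "conj_by G w a \<in> conj_by G w ` generate G {g}"
            using a(3)[OF g(1)] by blast
          also have "\<dots> = generate G {conj_by G w g}"
            using h.generate_img[of "{g}"] g T0(2) by auto
          also have "\<dots> \<subseteq> H"
            using generate_subgroup_incl[OF _ H] g(2) by blast
          finally show ?thesis .
        qed
        then show ?thesis using a(1) by (simp add: K_def)
      qed
      moreover have "displace G h u \<in> K" if "h \<in> carrier G" "u \<in> K" for h u
        using that subgroup.m_closed[OF H] subgroup.m_inv_closed[OF H]
        by (auto simp: K_def displace_def conj_by_mult conj_by_inv conj_by_conj_by)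
      then have "\<forall>g\<in>T1. \<forall>u\<in>K. E g u \<in> K"
        using T1c by (simp add: E_def)
      ultimately have "v \<in> K"
        using v(4)[rule_format, of K] by blast
      then have "conj_by G \<one> v \<in> H"
        unfolding K_def using one_closed by blast
      then show ?thesis
        using v(1) by (simp add: H_def)
    next
      case False
      then obtain w where w: "w \<in> carrier G" "\<forall>g\<in>T0. conj_by G w g \<notin> H" by blast
      \<comment> \<open>For \<open>g \<in> T0\<close> the conjugate by \<open>u \<otimes> w\<close>
        equals that by \<open>w\<close>, since \<open>N\<close> is abelian. Hence \<open>T0\<close>
        stays excluded for every \<open>u\<close>, and \<open>T1\<close> alone colours all of
        \<open>N\<close>.\<close>
      have "\<exists>g\<in>T1. conj_by G (u \<otimes> w) g \<in> H" if u: "u \<in> N" for u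
      proof -
        obtain g where g: "g \<in> T0 \<union> T1" "conj_by G (u \<otimes> w) g \<in> H"
          using conj_fixed[of "u \<otimes> w"] w u by auto
        moreover have "conj_by G (u \<otimes> w) g = conj_by G w g" if "g \<in> T0"
          using that T0(2) u w(1) by (intro conj_by_mod_N) auto
        ultimately show ?thesis using w(2) by auto
      qed
      then obtain c where c: "\<And>u. u \<in> N \<Longrightarrow> c u \<in> T1" "\<And>u. u \<in> N \<Longrightarrow> conj_by G (u \<otimes> w) (c u) \<in> H"
        by metis
      \<comment> \<open>Two points of colour \<open>g\<close> on a line in direction
        \<open>g\<close> differ by \<open>g ^ m' - g ^ m\<close> applied to \<open>\<psi> g\<close>,
        an expression in the very element that coloured them.\<close>
      obtain g x m m' where g: "g \<in> T1" and x: "x \<in> N" and m: "m < m'" "m' \<le> card T1"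
        and cx: "c (x \<otimes> conj_by G (g [^] m) (\<psi> g)) = g" "c (x \<otimes> conj_by G (g [^] m') (\<psi> g)) = g"
        by (rule M.monochromatic_line[OF T1(1), of c "\<lambda>g (m::nat). conj_by G (g [^] m) (\<psi> g)"])
          (use c(1) \<psi>(1) T1c in auto)
      have gc: "g \<in> carrier G" and \<psi>g: "\<psi> g \<in> N" using T1c[OF g] \<psi>(1)[OF g] .
      define y1 where "y1 = conj_by G (g [^] m) (\<psi> g)"
      define y2 where "y2 = conj_by G (g [^] m') (\<psi> g)"
      have yN: "y1 \<in> N" "y2 \<in> N" using gc \<psi>g by (auto simp: y1_def y2_def)
      define h where "h = conj_by G w g"
      have hc: "h \<in> carrier G" using w gc by (simp add: h_def)
      \<comment> \<open>\<open>h\<close> differs from \<open>g\<close> by a commutator, hence acts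
        on \<open>N\<close> as \<open>g\<close> does.\<close>
      have h_eq: "h = (w \<otimes> g \<otimes> inv w \<otimes> inv g) \<otimes> g"
        using w gc by (simp add: h_def conj_by_def m_assoc)
      have conj_h: "conj_by G h u = conj_by G g u" if "u \<in> N" for u
        unfolding h_eq using commutator_N w(1) gc that by (intro conj_by_mod_N) auto
      have p: "conj_by G (x \<otimes> y1) h \<in> H" "conj_by G (x \<otimes> y2) h \<in> H"
        using c(2)[of "x \<otimes> y1"] c(2)[of "x \<otimes> y2"] cx x yN gc w(1)
        by (simp_all add: h_def conj_by_conj_by y1_def y2_def)
      define K where "K = H \<inter> N"
      have K: "subgroup K G" "K \<subseteq> N"
        unfolding K_def using subgroups_Inter_pair[OF H N] by auto
      \<comment> \<open>\<open>g\<close> need not lie in \<open>H\<close>, but the conjugate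
        \<open>?p\<close> of \<open>h\<close> does and acts on \<open>N\<close> in the same way. So
        \<open>K\<close> is invariant under \<open>g\<close> and under its inverse.\<close>
      have conj_K: "conj_by G g u \<in> K" "conj_by G (inv g) u \<in> K" if u: "u \<in> K" for u
      proof -
        let ?p = "conj_by G (x \<otimes> y1) h"
        have uN: "u \<in> N" and uH: "u \<in> H" using u by (auto simp: K_def)
        have p_eq: "?p = ((x \<otimes> y1) \<otimes> h \<otimes> inv (x \<otimes> y1) \<otimes> inv h) \<otimes> h"
          using x yN hc by (simp add: conj_by_def m_assoc)
        have pconj: "conj_by G ?p z = conj_by G g z" if "z \<in> N" for z
          unfolding p_eq using commutator_N x yN hc that
          by (subst conj_by_mod_N) (auto simp: conj_h)
        have pc: "?p \<in> carrier G" using x yN hc by simp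
        have "conj_by G ?p u \<in> H"
          unfolding conj_by_def[of G ?p]
          using p(1) uH subgroup.m_closed[OF H] subgroup.m_inv_closed[OF H] by simp
        then show "conj_by G g u \<in> K"
          using uN gc by (simp add: pconj K_def)
        have "conj_by G (inv ?p) u \<in> H"
          unfolding conj_by_def[of G "inv ?p"]
          using p(1) uH subgroup.m_closed[OF H] subgroup.m_inv_closed[OF H] by simp
        moreover have "conj_by G (inv ?p) u = conj_by G (inv g) u"
        proof -
          have "conj_by G ?p (conj_by G (inv g) u) = u"
            using gc uN by (simp add: pconj conj_by_conj_by)
          then show ?thesis
            using pc gc uN by (metis conj_by_inv_conj_by conj_by_closed inv_closed N_carrier)
        qed
        ultimately show "conj_by G (inv g) u \<in> K"
          using uN gc by (simp add: K_def)
      qed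
      have conj_K_pow: "conj_by G (inv g [^] n) u \<in> K" if u: "u \<in> K" for u and n :: nat
      proof (induction n)
        case 0
        then show ?case using u K(2) by auto
      next
        case (Suc n)
        have "inv g [^] Suc n = inv g \<otimes> inv g [^] n"
          using gc by (intro nat_pow_Suc2) simp
        then have "conj_by G (inv g [^] Suc n) u = conj_by G (inv g) (conj_by G (inv g [^] n) u)"
          using gc u K(2) by (subst conj_by_conj_by) auto
        then show ?case
          using conj_K(2)[OF Suc] by simp
      qed
      \<comment> \<open>The quotient of the two conjugates of \<open>h\<close> in \<open>H\<close>
        lies in \<open>N\<close>, where \<open>x\<close> cancels and \<open>- (1 - g)\<close>
        applied to \<open>y2 - y1\<close> remains (in additive notation).\<close>
      have D: "displace G g (inv y1 \<otimes> y2) \<in> K"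
      proof -
        let ?\<delta> = "inv y1 \<otimes> y2"
        have "conj_by G (x \<otimes> y1) h \<otimes> inv (conj_by G (x \<otimes> y2) h)
          = (x \<otimes> y1) \<otimes> conj_by G h ?\<delta> \<otimes> inv (x \<otimes> y2)"
          using x yN hc by (simp add: conj_by_def m_assoc inv_mult_group)
        also have "\<dots> = inv ?\<delta> \<otimes> conj_by G g ?\<delta>"
        proof -
          have "(x \<otimes> y1) \<otimes> z \<otimes> inv (x \<otimes> y2) = inv ?\<delta> \<otimes> z" if z: "z \<in> N" for z
          proof -
            have "(x \<otimes> y1) \<otimes> z \<otimes> inv (x \<otimes> y2) = inv (x \<otimes> y2) \<otimes> ((x \<otimes> y1) \<otimes> z)"
              using x yN z by (intro N_comm) simp_all
            also have "\<dots> = inv y2 \<otimes> (y1 \<otimes> z)"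
              using x yN z by (simp add: m_assoc inv_mult_group)
            finally show ?thesis
              using yN z by (simp add: m_assoc inv_mult_group)
          qed
          then show ?thesis
            using yN hc gc by (simp add: conj_h)
        qed
        also have "\<dots> = inv (displace G g ?\<delta>)"
          using yN gc N_comm[of "inv ?\<delta>" "conj_by G g ?\<delta>"]
          by (simp add: displace_def inv_mult_group[of ?\<delta>])
        finally have "inv (displace G g ?\<delta>) \<in> H"
          using p subgroup.m_closed[OF H] subgroup.m_inv_closed[OF H] by metis
        then have "inv (inv (displace G g ?\<delta>)) \<in> H"
          by (rule subgroup.m_inv_closed[OF H])
        then show ?thesis
          using yN gc by (simp add: K_def)
      qed
      \<comment> \<open>The preimage of \<open>K\<close> under \<open>1 - g\<close>. It inherits
        invariance under \<open>g\<close>, which allows passing from the exponent \<open>n\<close>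
        to its multiple \<open>r\<close> before the last factor \<open>1 - g\<close> is
        applied.\<close>
      define L where "L = {u \<in> N. displace G g u \<in> K}"
      have L: "subgroup L G" "L \<subseteq> N"
      proof -
        show "subgroup L G"
        proof (rule subgroupI)
          have "displace G g \<one> = \<one>"
            using gc by (simp add: displace_eq_one_iff)
          then show "L \<noteq> {}"
            using subgroup.one_closed[OF K(1)] by (auto simp: L_def intro!: exI[of _ \<one>])
        qed (use gc subgroup.m_closed[OF K(1)] subgroup.m_inv_closed[OF K(1)]
              in \<open>auto simp: L_def displace_mult displace_inv\<close>)
      qed (auto simp: L_def)
      have conj_L: "conj_by G g u \<in> L" if "u \<in> L" for u
        using that gc conj_K(1) by (auto simp: L_def displace_conj_by)
      define n where "n = m' - m"
      have n: "0 < n" "n \<le> card T1" "m' = m + n" using m by (auto simp: n_def)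
      \<comment> \<open>The grid points carry a common factor \<open>g ^ m\<close>. It is removed by
        invariance of \<open>K\<close> under \<open>inv g\<close>.\<close>
      have "displace G (g [^] n) (\<psi> g) \<in> L"
      proof -
        have "conj_by G (inv g [^] m) (inv y1 \<otimes> y2) = inv (\<psi> g) \<otimes> conj_by G (g [^] n) (\<psi> g)"
        proof -
          have "g [^] m' = g [^] m \<otimes> g [^] n" using gc by (simp add: n(3) nat_pow_mult)
          then have "y2 = conj_by G (g [^] m) (conj_by G (g [^] n) (\<psi> g))"
            using gc \<psi>g by (simp add: y2_def conj_by_conj_by)
          then show ?thesis
            using gc \<psi>g by (simp add: y1_def conj_by_mult conj_by_inv nat_pow_inv)
        qed
        moreover have "displace G g (conj_by G (inv g [^] m) (inv y1 \<otimes> y2)) \<in> K"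
          using D gc yN by (subst displace_conj_by) (auto intro!: conj_K_pow)
        ultimately have "inv (\<psi> g) \<otimes> conj_by G (g [^] n) (\<psi> g) \<in> L"
          using gc \<psi>g by (simp add: L_def)
        then have "inv (inv (\<psi> g) \<otimes> conj_by G (g [^] n) (\<psi> g)) \<in> L"
          by (rule subgroup.m_inv_closed[OF L(1)])
        moreover have "inv (inv (\<psi> g) \<otimes> conj_by G (g [^] n) (\<psi> g)) = displace G (g [^] n) (\<psi> g)"
        proof -
          have "inv (inv (\<psi> g) \<otimes> conj_by G (g [^] n) (\<psi> g)) = inv (conj_by G (g [^] n) (\<psi> g)) \<otimes> \<psi> g"
            using gc \<psi>g by (simp add: inv_mult_group)
          also have "\<dots> = \<psi> g \<otimes> inv (conj_by G (g [^] n) (\<psi> g))"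
            using gc \<psi>g by (intro N_comm) simp_all
          finally show ?thesis
            by (simp add: displace_def)
        qed
        ultimately show ?thesis by simp
      qed
      moreover obtain q where "r = n * q"
        using n(1,2) dvd_fact[of n "card T1"] by (auto simp: r_def dvd_def)
      ultimately have "displace G (g [^] r) (\<psi> g) \<in> L"
        using displace_pow_mult[OF L conj_L gc \<psi>g, of n q] by simp
      then have "v \<in> K"
        using \<psi>(2)[OF g] by (simp add: L_def E_def)
      then show ?thesis
        by (simp add: K_def H_def)
    qed
  qed
  then have "\<phi> v y = \<phi> \<one> y" if "y \<in> Y" for y
    using that by (simp add: stabilizer_def flip: id_eq_one)
  moreover have "\<phi> v \<in> extensional Y" "\<phi> \<one> \<in> extensional Y"
    using bij_prop0 v(1) by (auto simp: Bij_def)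
  ultimately have "\<phi> v = \<phi> \<one>"
    by (metis extensionalityI)
  then show False
    using faithful v(1,2) by (auto simp: inj_on_def)
qed

end

text \<open>The orbit map at \<open>x\<close> is injective on \<open>\<Sigma>\<close> if and only if
  no quotient \<open>inv g \<otimes> h\<close> of distinct elements fixes \<open>x\<close>. The
  quotients inside \<open>N\<close> form \<open>T0\<close>, the others \<open>T1\<close>.\<close>

lemma (in abelian_extension) injective_orbit_map:
  assumes act: "faithful_action G Y \<phi>" and \<Sigma>: "finite \<Sigma>" "\<Sigma> \<subseteq> carrier G"
    and free: "\<And>g m u. g \<in> carrier G \<Longrightarrow> g \<notin> N \<Longrightarrow> 0 < m \<Longrightarrow> u \<in> N
      \<Longrightarrow> g [^] (m::nat) \<otimes> u = u \<otimes> g [^] m \<Longrightarrow> u = \<one>"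
    and a: "a \<in> N" "a \<noteq> \<one>"
    and gen: "\<And>g h. g \<in> \<Sigma> \<Longrightarrow> h \<in> \<Sigma> \<Longrightarrow> g \<noteq> h \<Longrightarrow> inv g \<otimes> h \<in> N \<Longrightarrow> a \<in> generate G {inv g \<otimes> h}"
  shows "\<exists>x\<in>Y. inj_on (\<lambda>g. \<phi> g x) \<Sigma>"
proof -
  interpret faithful_action G Y \<phi> by (rule act)
  define T where "T = (\<Union>g\<in>\<Sigma>. (\<lambda>h. inv g \<otimes> h) ` (\<Sigma> - {g}))"
  have T: "finite T" "T \<subseteq> carrier G"
    using \<Sigma> by (auto simp: T_def subset_iff)
  have "\<exists>y\<in>Y. \<forall>g\<in>(T \<inter> N) \<union> (T - N). \<phi> g y \<noteq> y"
  proof (rule avoid_fixed_points[OF act])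
    show "a \<in> generate G {g}" if "g \<in> T \<inter> N" for g
      using that gen by (auto simp: T_def)
    show "u = \<one>" if "g \<in> T - N" "0 < m" "u \<in> N" "g [^] m \<otimes> u = u \<otimes> g [^] m" for g u and m :: nat
      using free[of g m u] that T(2) by blast
  qed (use T a in auto)
  then obtain y where y: "y \<in> Y" "\<And>g. g \<in> T \<Longrightarrow> \<phi> g y \<noteq> y"
    by blast
  have "inj_on (\<lambda>g. \<phi> g y) \<Sigma>"
  proof (rule inj_onI, rule ccontr)
    fix g h assume gh: "g \<in> \<Sigma>" "h \<in> \<Sigma>" "\<phi> g y = \<phi> h y" "g \<noteq> h"
    then have c: "g \<in> carrier G" "h \<in> carrier G" using \<Sigma>(2) by auto
    have "\<phi> (inv g \<otimes> h) y = \<phi> (inv g) (\<phi> g y)"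
      using c y(1) gh(3) by (simp add: composition_rule)
    also have "\<dots> = y"
      using orbit_sym_aux[OF c(1) y(1) refl] .
    moreover have "inv g \<otimes> h \<in> T"
      using gh by (auto simp: T_def)
    ultimately show False
      using y(2) by metis
  qed
  then show ?thesis using y(1) by blast
qed

section \<open>Wreath products and their non-foldable subsets\<close>

locale wreath = A: group A + B: group B for A (structure) and B (structure)
begin

abbreviation "W \<equiv> A \<wr> B"
abbreviation "F \<equiv> carrier (sum_group (carrier B) (\<lambda>_. A))"

lemma F_eq: "F = {f \<in> carrier B \<rightarrow>\<^sub>E carrier A. finite {x \<in> carrier B. f x \<noteq> \<one>\<^bsub>A\<^esub>}}"
  by (simp add: carrier_sum_group A.is_group)

lemma F_closed [simp]: "f \<in> F \<Longrightarrow> x \<in> carrier B \<Longrightarrow> f x \<in> carrier A"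
  by (auto simp: F_eq)

lemma F_ext: "f \<in> F \<Longrightarrow> g \<in> F \<Longrightarrow> (\<And>x. x \<in> carrier B \<Longrightarrow> f x = g x) \<Longrightarrow> f = g"
  unfolding F_eq by (auto intro: PiE_ext)

lemma F_undefined: "f \<in> F \<Longrightarrow> x \<notin> carrier B \<Longrightarrow> f x = undefined"
  unfolding F_eq by auto

lemma F_group: "group (sum_group (carrier B) (\<lambda>_. A))"
  by (simp add: A.is_group)

lemma F_mult [simp]: "f \<in> F \<Longrightarrow> g \<in> F \<Longrightarrow> (\<lambda>x\<in>carrier B. f x \<otimes>\<^bsub>A\<^esub> g x) \<in> F"
  using group.is_monoid[OF F_group, THEN monoid.m_closed, of f g] by simp

lemma F_one [simp]: "(\<lambda>x\<in>carrier B. \<one>\<^bsub>A\<^esub>) \<in> F"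
  using group.is_monoid[OF F_group, THEN monoid.one_closed] by simp

lemma F_inv [simp]: "f \<in> F \<Longrightarrow> (\<lambda>x\<in>carrier B. inv\<^bsub>A\<^esub> f x) \<in> F"
  using group.inv_closed[OF F_group, of f] by (simp add: A.is_group)

lemma shift_apply [simp]:
  "x \<in> carrier B \<Longrightarrow> wreath_shift B b f x = f (inv\<^bsub>B\<^esub> b \<otimes>\<^bsub>B\<^esub> x)"
  by (simp add: wreath_shift_def)

lemma shift_F [simp]:
  assumes "b \<in> carrier B" "f \<in> F"
  shows "wreath_shift B b f \<in> F"
proof -
  have "{x \<in> carrier B. wreath_shift B b f x \<noteq> \<one>\<^bsub>A\<^esub>}
    \<subseteq> (\<lambda>x. b \<otimes>\<^bsub>B\<^esub> x) ` {x \<in> carrier B. f x \<noteq> \<one>\<^bsub>A\<^esub>}"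
  proof
    fix x assume "x \<in> {x \<in> carrier B. wreath_shift B b f x \<noteq> \<one>\<^bsub>A\<^esub>}"
    then show "x \<in> (\<lambda>x. b \<otimes>\<^bsub>B\<^esub> x) ` {x \<in> carrier B. f x \<noteq> \<one>\<^bsub>A\<^esub>}"
      using assms(1) by (intro image_eqI[of _ _ "inv\<^bsub>B\<^esub> b \<otimes>\<^bsub>B\<^esub> x"]) auto
  qed
  moreover have "finite ((\<lambda>x. b \<otimes>\<^bsub>B\<^esub> x) ` {x \<in> carrier B. f x \<noteq> \<one>\<^bsub>A\<^esub>})"
    using assms(2) by (simp add: F_eq)
  ultimately have "finite {x \<in> carrier B. wreath_shift B b f x \<noteq> \<one>\<^bsub>A\<^esub>}"
    by (rule finite_subset)
  moreover have "wreath_shift B b f \<in> carrier B \<rightarrow>\<^sub>E carrier A"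
    using assms by (auto simp: wreath_shift_def)
  ultimately show ?thesis
    unfolding F_eq by blast
qed

lemma W_carrier: "carrier W = F \<times> carrier B"
  by (simp add: wreath_product_def)

lemma W_mult [simp]:
  "(f, b) \<otimes>\<^bsub>W\<^esub> (g, c) = (\<lambda>x\<in>carrier B. f x \<otimes>\<^bsub>A\<^esub> wreath_shift B b g x, b \<otimes>\<^bsub>B\<^esub> c)"
  by (simp add: wreath_product_def)

lemma W_one: "\<one>\<^bsub>W\<^esub> = (\<lambda>x\<in>carrier B. \<one>\<^bsub>A\<^esub>, \<one>\<^bsub>B\<^esub>)"
  by (simp add: wreath_product_def)

lemma W_group: "group W"
proof (rule groupI)
  fix x y z assume x: "x \<in> carrier W" and y: "y \<in> carrier W" and z: "z \<in> carrier W"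
  obtain f b g c h e where eq: "x = (f, b)" "y = (g, c)" "z = (h, e)"
    by (metis surj_pair)
  have m: "f \<in> F" "b \<in> carrier B" "g \<in> F" "c \<in> carrier B" "h \<in> F" "e \<in> carrier B"
    using x y z by (auto simp: eq W_carrier)
  show "x \<otimes>\<^bsub>W\<^esub> y \<in> carrier W"
    using m by (simp add: eq W_carrier)
  show "x \<otimes>\<^bsub>W\<^esub> y \<otimes>\<^bsub>W\<^esub> z = x \<otimes>\<^bsub>W\<^esub> (y \<otimes>\<^bsub>W\<^esub> z)"
    using m by (auto simp: eq A.m_assoc B.m_assoc B.inv_mult_group intro!: restrict_ext)
  show "\<one>\<^bsub>W\<^esub> \<otimes>\<^bsub>W\<^esub> x = x"
    using m by (auto simp: eq W_one restrict_def F_undefined)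
  show "\<exists>y\<in>carrier W. y \<otimes>\<^bsub>W\<^esub> x = \<one>\<^bsub>W\<^esub>"
  proof
    let ?y = "(wreath_shift B (inv\<^bsub>B\<^esub> b) (\<lambda>x\<in>carrier B. inv\<^bsub>A\<^esub> f x), inv\<^bsub>B\<^esub> b)"
    show "?y \<in> carrier W"
      using m by (simp add: W_carrier)
    show "?y \<otimes>\<^bsub>W\<^esub> x = \<one>\<^bsub>W\<^esub>"
      using m by (auto simp: eq W_one intro!: restrict_ext)
  qed
qed (simp add: W_one W_carrier)

sublocale W: group W
  by (rule W_group)

lemma snd_closed [simp]: "x \<in> carrier W \<Longrightarrow> snd x \<in> carrier B"
  by (auto simp: W_carrier)

lemma snd_hom: "group_hom W B snd"
  by unfold_locales (auto simp: hom_def wreath_product_def split: prod.splits)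

sublocale snd: group_hom W B snd
  by (rule snd_hom)

lemma top_hom: "group_hom B W (wreath_top A B)"
  by unfold_locales (auto simp: hom_def wreath_top_def W_carrier intro!: restrict_ext)

sublocale top: group_hom B W "wreath_top A B"
  by (rule top_hom)

lemma base_closed: "a \<in> carrier A \<Longrightarrow> (\<lambda>x\<in>carrier B. if x = \<one>\<^bsub>B\<^esub> then a else \<one>\<^bsub>A\<^esub>) \<in> F"
  by (auto simp: F_eq)

lemma base_hom: "group_hom A W (wreath_base A B)"
  by unfold_locales (auto simp: hom_def wreath_base_def W_carrier base_closed intro!: restrict_ext)

sublocale base: group_hom A W "wreath_base A B"
  by (rule base_hom)

lemma base_eq_one_iff: "a \<in> carrier A \<Longrightarrow> wreath_base A B a = \<one>\<^bsub>W\<^esub> \<longleftrightarrow> a = \<one>\<^bsub>A\<^esub>"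
  by (auto simp: wreath_base_def W_one fun_eq_iff restrict_def)

lemma snd_top [simp]: "snd (wreath_top A B b) = b"
  by (simp add: wreath_top_def)

lemma snd_base [simp]: "snd (wreath_base A B a) = \<one>\<^bsub>B\<^esub>"
  by (simp add: wreath_base_def)

text \<open>An invariant function is constant along the infinite orbit of powers of
  \<open>b\<close>, so a single nontrivial value would already give infinite support.\<close>

lemma shift_eq_self_imp_one:
  assumes u: "u \<in> F" and b: "b \<in> carrier B" "\<And>n::nat. 0 < n \<Longrightarrow> b [^]\<^bsub>B\<^esub> n \<noteq> \<one>\<^bsub>B\<^esub>"
    and eq: "wreath_shift B b u = u"
  shows "u = (\<lambda>x\<in>carrier B. \<one>\<^bsub>A\<^esub>)"
proof (rule F_ext[OF u F_one])
  fix x assume x: "x \<in> carrier B"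
  have step: "u (b \<otimes>\<^bsub>B\<^esub> y) = u y" if "y \<in> carrier B" for y
    using fun_cong[OF eq, of "b \<otimes>\<^bsub>B\<^esub> y"] b that by simp
  have pow: "u (b [^]\<^bsub>B\<^esub> n \<otimes>\<^bsub>B\<^esub> x) = u x" for n :: nat
  proof (induction n)
    case (Suc n)
    have "b [^]\<^bsub>B\<^esub> Suc n \<otimes>\<^bsub>B\<^esub> x = b \<otimes>\<^bsub>B\<^esub> (b [^]\<^bsub>B\<^esub> n \<otimes>\<^bsub>B\<^esub> x)"
      using b x unfolding B.nat_pow_Suc2[OF b(1)] by (simp add: B.m_assoc)
    then show ?case
      using Suc step b x by simp
  qed (use x in simp)
  show "u x = (\<lambda>x\<in>carrier B. \<one>\<^bsub>A\<^esub>) x"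
  proof (rule ccontr)
    assume "\<not> ?thesis"
    then have "range (\<lambda>n::nat. b [^]\<^bsub>B\<^esub> n \<otimes>\<^bsub>B\<^esub> x) \<subseteq> {x \<in> carrier B. u x \<noteq> \<one>\<^bsub>A\<^esub>}"
      using pow x b by auto
    then have "finite (range (\<lambda>n::nat. b [^]\<^bsub>B\<^esub> n \<otimes>\<^bsub>B\<^esub> x))"
      using u by (auto simp: F_eq intro: finite_subset)
    moreover have "inj (\<lambda>n::nat. b [^]\<^bsub>B\<^esub> n \<otimes>\<^bsub>B\<^esub> x)"
    proof (rule linorder_injI)
      fix m n :: nat assume "m < n"
      then have "b [^]\<^bsub>B\<^esub> n = b [^]\<^bsub>B\<^esub> m \<otimes>\<^bsub>B\<^esub> b [^]\<^bsub>B\<^esub> (n - m)"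
        using b by (simp add: B.nat_pow_mult)
      then show "b [^]\<^bsub>B\<^esub> m \<otimes>\<^bsub>B\<^esub> x \<noteq> b [^]\<^bsub>B\<^esub> n \<otimes>\<^bsub>B\<^esub> x"
        using b x \<open>m < n\<close> by (simp add: B.l_cancel_one)
    qed
    ultimately show False
      using finite_imageD by blast
  qed
qed

end

locale abelian_wreath = wreath A B + A: comm_group A + B: comm_group B
  for A (structure) and B (structure) +
  assumes torsion_free: "\<And>b n. b \<in> carrier B \<Longrightarrow> b \<noteq> \<one>\<^bsub>B\<^esub> \<Longrightarrow> 0 < (n::nat) \<Longrightarrow> b [^]\<^bsub>B\<^esub> n \<noteq> \<one>\<^bsub>B\<^esub>"
begin

lemma base_extension: "abelian_extension W {x \<in> carrier W. snd x = \<one>\<^bsub>B\<^esub>}"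
proof (intro abelian_extension.intro abelian_extension_axioms.intro W.is_group)
  show "subgroup {x \<in> carrier W. snd x = \<one>\<^bsub>B\<^esub>} W"
    using snd.subgroup_kernel by (simp add: kernel_def)
next
  fix u v assume "u \<in> {x \<in> carrier W. snd x = \<one>\<^bsub>B\<^esub>}" "v \<in> {x \<in> carrier W. snd x = \<one>\<^bsub>B\<^esub>}"
  then show "u \<otimes>\<^bsub>W\<^esub> v = v \<otimes>\<^bsub>W\<^esub> u"
    by (auto simp: W_carrier A.m_comm intro!: restrict_ext)
next
  fix g h assume "g \<in> carrier W" "h \<in> carrier W"
  then show "g \<otimes>\<^bsub>W\<^esub> h \<otimes>\<^bsub>W\<^esub> inv\<^bsub>W\<^esub> g \<otimes>\<^bsub>W\<^esub> inv\<^bsub>W\<^esub> h \<in> {x \<in> carrier W. snd x = \<one>\<^bsub>B\<^esub>}"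
    by (simp add: B.m_comm[of "snd g" "snd h"] B.m_assoc B.inv_solve_left)
qed

text \<open>Since \<open>A\<close> is commutative, the function part of \<open>g ^ m\<close> cancels
  from the relation and only the shift by its top part remains; torsion-freeness of \<open>B\<close>
  makes that shift have infinite order.\<close>

lemma base_free:
  assumes g: "g \<in> carrier W" "snd g \<noteq> \<one>\<^bsub>B\<^esub>" and u: "u \<in> carrier W" "snd u = \<one>\<^bsub>B\<^esub>"
    and m: "0 < (m::nat)" and comm: "g [^]\<^bsub>W\<^esub> m \<otimes>\<^bsub>W\<^esub> u = u \<otimes>\<^bsub>W\<^esub> g [^]\<^bsub>W\<^esub> m"
  shows "u = \<one>\<^bsub>W\<^esub>"
proof -
  obtain v where v: "u = (v, \<one>\<^bsub>B\<^esub>)" "v \<in> F"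
    using u by (auto simp: W_carrier)
  obtain f b where fb: "g [^]\<^bsub>W\<^esub> m = (f, b)" "f \<in> F" "b \<in> carrier B"
    using W.nat_pow_closed[OF g(1), of m] by (auto simp: W_carrier)
  have "b = snd g [^]\<^bsub>B\<^esub> m"
    using g(1) fb(1) by (metis snd.hom_nat_pow snd_conv)
  then have b: "b \<noteq> \<one>\<^bsub>B\<^esub>"
    using torsion_free g m by simp
  have "wreath_shift B b v = v"
  proof (rule F_ext)
    fix x assume x: "x \<in> carrier B"
    have "f x \<otimes>\<^bsub>A\<^esub> v (inv\<^bsub>B\<^esub> b \<otimes>\<^bsub>B\<^esub> x) = v x \<otimes>\<^bsub>A\<^esub> f x"
      using comm x fb v by (auto simp: fun_eq_iff restrict_def dest!: spec[of _ x])
    then have "f x \<otimes>\<^bsub>A\<^esub> v (inv\<^bsub>B\<^esub> b \<otimes>\<^bsub>B\<^esub> x) = f x \<otimes>\<^bsub>A\<^esub> v x"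
      using fb v x by (simp add: A.m_comm)
    then show "wreath_shift B b v x = v x"
      using fb v x by simp
  qed (use fb v in simp_all)
  then show ?thesis
    using shift_eq_self_imp_one[OF v(2) fb(3)] torsion_free[OF fb(3) b] v by (simp add: W_one)
qed

lemma injective_orbit_map:
  assumes "faithful_action W Y \<phi>" "finite \<Sigma>" "\<Sigma> \<subseteq> carrier W"
    and "a \<in> carrier W" "snd a = \<one>\<^bsub>B\<^esub>" "a \<noteq> \<one>\<^bsub>W\<^esub>"
    and gen: "\<And>g h. g \<in> \<Sigma> \<Longrightarrow> h \<in> \<Sigma> \<Longrightarrow> g \<noteq> h \<Longrightarrow> snd g = snd h
      \<Longrightarrow> a \<in> generate W {inv\<^bsub>W\<^esub> g \<otimes>\<^bsub>W\<^esub> h}"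
  shows "\<exists>x\<in>Y. inj_on (\<lambda>g. \<phi> g x) \<Sigma>"
proof (rule abelian_extension.injective_orbit_map[OF base_extension assms(1-3)])
  fix g h assume gh: "g \<in> \<Sigma>" "h \<in> \<Sigma>" "g \<noteq> h"
    "inv\<^bsub>W\<^esub> g \<otimes>\<^bsub>W\<^esub> h \<in> {x \<in> carrier W. snd x = \<one>\<^bsub>B\<^esub>}"
  have c: "g \<in> carrier W" "h \<in> carrier W"
    using gh(1,2) assms(3) by blast+
  have "inv\<^bsub>B\<^esub> snd g \<otimes>\<^bsub>B\<^esub> snd h = \<one>\<^bsub>B\<^esub>"
    using gh(4) c by simp
  then have "snd g = snd h"
    using c by (simp add: B.inv_solve_left')
  then show "a \<in> generate W {inv\<^bsub>W\<^esub> g \<otimes>\<^bsub>W\<^esub> h}"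
    using gen gh by blast
next
  show "u = \<one>\<^bsub>W\<^esub>" if "g \<in> carrier W" "g \<notin> {x \<in> carrier W. snd x = \<one>\<^bsub>B\<^esub>}" "0 < m"
    "u \<in> {x \<in> carrier W. snd x = \<one>\<^bsub>B\<^esub>}" "g [^]\<^bsub>W\<^esub> m \<otimes>\<^bsub>W\<^esub> u = u \<otimes>\<^bsub>W\<^esub> g [^]\<^bsub>W\<^esub> m" for g u and m :: nat
    using base_free[of g u m] that by blast
qed (use assms(4-6) in simp_all)

text \<open>Distinct elements of the top group have distinct classes modulo the base, so the
  condition on \<open>a\<close> is vacuous and any nontrivial base element can be used.\<close>

lemma non_foldable_top:
  assumes "carrier A \<noteq> {\<one>\<^bsub>A\<^esub>}"
  shows "non_foldable TYPE('x) W (wreath_top A B ` carrier B)"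
proof -
  obtain a where a: "a \<in> carrier A" "a \<noteq> \<one>\<^bsub>A\<^esub>"
    using assms A.one_closed by blast
  have "\<exists>x\<in>Y. inj_on (\<lambda>g. \<phi> g x) \<Sigma>"
    if "faithful_G_set W Y \<phi>" "finite \<Sigma>" "\<Sigma> \<subseteq> wreath_top A B ` carrier B" for Y :: "'x set" and \<phi> \<Sigma>
  proof (rule injective_orbit_map[of _ _ _ "wreath_base A B a"])
    fix g h assume "g \<in> \<Sigma>" "h \<in> \<Sigma>" "g \<noteq> h" "snd g = snd h"
    moreover have "g = wreath_top A B (snd g)" "h = wreath_top A B (snd h)"
      using that(3) \<open>g \<in> \<Sigma>\<close> \<open>h \<in> \<Sigma>\<close> by auto
    ultimately have False by metis
    then show "wreath_base A B a \<in> generate W {inv\<^bsub>W\<^esub> g \<otimes>\<^bsub>W\<^esub> h}" ..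
  qed (use a that in \<open>auto simp: faithful_G_set_def base_eq_one_iff\<close>)
  then show ?thesis
    by (auto simp: non_foldable_def)
qed

lemma non_foldable_top_base:
  assumes t: "t \<in> carrier A" "group.ord A t = 0"
  shows "non_foldable TYPE('x) W (wreath_top A B ` carrier B <#>\<^bsub>W\<^esub> generate W {wreath_base A B t})"
proof -
  let ?t = "wreath_base A B t"
  let ?L = "wreath_top A B ` carrier B <#>\<^bsub>W\<^esub> generate W {?t}"
  have L: "?L = {wreath_top A B b \<otimes>\<^bsub>W\<^esub> ?t [^]\<^bsub>W\<^esub> (k::int) | b k. b \<in> carrier B}"
    unfolding set_mult_def W.generate_pow[OF base.hom_closed[OF t(1)]] by blast
  have t_pow: "?t [^]\<^bsub>W\<^esub> k = wreath_base A B (t [^]\<^bsub>A\<^esub> k)" for k :: int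
    using t by (simp add: base.hom_int_pow)
  have t_one: "?t [^]\<^bsub>W\<^esub> k \<noteq> \<one>\<^bsub>W\<^esub>" if "k \<noteq> 0" for k :: int
    unfolding t_pow using t that by (simp add: base_eq_one_iff A.int_pow_eq_id)
  have "\<exists>x\<in>Y. inj_on (\<lambda>g. \<phi> g x) \<Sigma>"
    if act: "faithful_G_set W Y \<phi>" and \<Sigma>: "finite \<Sigma>" "\<Sigma> \<subseteq> ?L" for Y :: "'x set" and \<phi> \<Sigma>
  proof -
    have "\<forall>g\<in>\<Sigma>. \<exists>k::int. \<exists>b\<in>carrier B. g = wreath_top A B b \<otimes>\<^bsub>W\<^esub> ?t [^]\<^bsub>W\<^esub> k"
      using \<Sigma>(2) unfolding L by blast
    then obtain k :: "_ \<Rightarrow> int" where k: "\<And>g. g \<in> \<Sigma> \<Longrightarrow> \<exists>b\<in>carrier B. g = wreath_top A B b \<otimes>\<^bsub>W\<^esub> ?t [^]\<^bsub>W\<^esub> k g"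
      by metis
    have \<Sigma>c: "\<Sigma> \<subseteq> carrier W"
      using \<Sigma>(2) t unfolding L by auto
    define P where "P = {(g, h) \<in> \<Sigma> \<times> \<Sigma>. k g \<noteq> k h}"
    have P: "finite P"
      unfolding P_def by (rule finite_subset[of _ "\<Sigma> \<times> \<Sigma>"]) (use \<Sigma>(1) in auto)
    \<comment> \<open>Quotients of distinct elements of \<open>\<Sigma>\<close> that fall into the
      base are powers of \<open>?t\<close> with exponent \<open>k h - k g \<noteq> 0\<close>. The
      product of all such exponents puts \<open>?t ^ M\<close> into each of their cyclic groups, and
      infinite order keeps it nontrivial.\<close>
    define M where "M = (\<Prod>(g, h)\<in>P. k h - k g)"
    have M: "M \<noteq> 0"
      using P unfolding M_def by (subst prod_zero_iff) (auto simp: P_def)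
    show ?thesis
    proof (rule injective_orbit_map[of _ _ _ "?t [^]\<^bsub>W\<^esub> M"])
      fix g h assume gh: "g \<in> \<Sigma>" "h \<in> \<Sigma>" "g \<noteq> h" "snd g = snd h"
      obtain b c where b: "b \<in> carrier B" "g = wreath_top A B b \<otimes>\<^bsub>W\<^esub> ?t [^]\<^bsub>W\<^esub> k g"
        and c: "c \<in> carrier B" "h = wreath_top A B c \<otimes>\<^bsub>W\<^esub> ?t [^]\<^bsub>W\<^esub> k h"
        using k gh by metis
      have sndt: "snd (?t [^]\<^bsub>W\<^esub> k) = \<one>\<^bsub>B\<^esub>" for k :: int
        by (simp add: t_pow)
      have "snd g = b" "snd h = c"
        using b(1) c(1) t by (subst b(2) c(2), simp add: sndt)+
      then have "b = c" using gh(4) by simp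
      then have "k g \<noteq> k h"
        using b c gh(3) by metis
      then have "(g, h) \<in> P" using gh by (simp add: P_def)
      then have "k h - k g dvd M"
        unfolding M_def using P by (metis (mono_tags, lifting) case_prod_conv dvd_prodI)
      then obtain q where q: "M = (k h - k g) * q" by (auto simp: dvd_def)
      have "inv\<^bsub>W\<^esub> g \<otimes>\<^bsub>W\<^esub> h = inv\<^bsub>W\<^esub> (wreath_top A B b \<otimes>\<^bsub>W\<^esub> ?t [^]\<^bsub>W\<^esub> k g)
          \<otimes>\<^bsub>W\<^esub> (wreath_top A B b \<otimes>\<^bsub>W\<^esub> ?t [^]\<^bsub>W\<^esub> k h)"
        using b(2) c(2) \<open>b = c\<close> by simp
      also have "\<dots> = ?t [^]\<^bsub>W\<^esub> (- k g) \<otimes>\<^bsub>W\<^esub> ?t [^]\<^bsub>W\<^esub> k h"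
        using b(1) t by (simp add: W.inv_mult_group W.m_assoc W.int_pow_neg)
      also have "\<dots> = ?t [^]\<^bsub>W\<^esub> (k h - k g)"
        using t by (simp flip: W.int_pow_mult)
      finally have eq: "inv\<^bsub>W\<^esub> g \<otimes>\<^bsub>W\<^esub> h = ?t [^]\<^bsub>W\<^esub> (k h - k g)" .
      have "?t [^]\<^bsub>W\<^esub> M = (?t [^]\<^bsub>W\<^esub> (k h - k g)) [^]\<^bsub>W\<^esub> q"
        using t by (simp add: q W.int_pow_pow)
      then show "?t [^]\<^bsub>W\<^esub> M \<in> generate W {inv\<^bsub>W\<^esub> g \<otimes>\<^bsub>W\<^esub> h}"
        unfolding eq using t by (auto simp: W.generate_pow)
    next
      show "snd (?t [^]\<^bsub>W\<^esub> M) = \<one>\<^bsub>B\<^esub>" by (simp add: t_pow)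
    qed (use act \<Sigma> \<Sigma>c t t_one M in \<open>auto simp: faithful_G_set_def\<close>)
  qed
  moreover have "?L \<subseteq> carrier W"
    using t unfolding L by auto
  ultimately show ?thesis
    by (auto simp: non_foldable_def)
qed

end

section \<open>Group actions and word length\<close>

text \<open>The restriction to \<open>Y\<close> supplies the extensionality demanded by
  \<open>Bij Y\<close>; bijectivity comes from the action of the inverse element.\<close>

lemma group_actionI:
  assumes "group G"
    and closed: "\<And>g x. g \<in> carrier G \<Longrightarrow> x \<in> Y \<Longrightarrow> \<psi> g x \<in> Y"
    and mult: "\<And>g h x. g \<in> carrier G \<Longrightarrow> h \<in> carrier G \<Longrightarrow> x \<in> Y \<Longrightarrow> \<psi> (g \<otimes>\<^bsub>G\<^esub> h) x = \<psi> g (\<psi> h x)"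
    and one: "\<And>x. x \<in> Y \<Longrightarrow> \<psi> \<one>\<^bsub>G\<^esub> x = x"
  shows "group_action G Y (\<lambda>g. \<lambda>x\<in>Y. \<psi> g x)"
proof -
  interpret group G by fact
  have bij: "(\<lambda>x\<in>Y. \<psi> g x) \<in> Bij Y" if g: "g \<in> carrier G" for g
  proof -
    have "\<psi> g (\<psi> (inv\<^bsub>G\<^esub> g) x) = x" "\<psi> (inv\<^bsub>G\<^esub> g) (\<psi> g x) = x" if "x \<in> Y" for x
      using mult[of g "inv\<^bsub>G\<^esub> g" x] mult[of "inv\<^bsub>G\<^esub> g" g x] g that one by simp_all
    then have "bij_betw (\<lambda>x\<in>Y. \<psi> g x) Y Y"
      using g closed by (intro bij_betw_byWitness[of _ "\<psi> (inv\<^bsub>G\<^esub> g)"]) auto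
    then show ?thesis
      by (simp add: Bij_def)
  qed
  have "(\<lambda>g. \<lambda>x\<in>Y. \<psi> g x) \<in> hom G (BijGroup Y)"
  proof (rule homI)
    fix g h assume "g \<in> carrier G" "h \<in> carrier G"
    then show "(\<lambda>x\<in>Y. \<psi> (g \<otimes>\<^bsub>G\<^esub> h) x) = (\<lambda>x\<in>Y. \<psi> g x) \<otimes>\<^bsub>BijGroup Y\<^esub> (\<lambda>x\<in>Y. \<psi> h x)"
      using bij closed by (auto simp: BijGroup_def compose_def mult intro!: restrict_ext)
  qed (use bij in \<open>simp add: BijGroup_def\<close>)
  then show ?thesis
    by (intro group_action.intro group_hom.intro group_hom_axioms.intro group_BijGroup is_group)
qed

locale word_metric = group G for G (structure) +
  fixes S
  assumes sym_gen: "symmetric_generating_set G S"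
begin

abbreviation "wl \<equiv> word_length G S"

lemma S_finite: "finite S" and S_carrier: "S \<subseteq> carrier G"
  and S_inv: "s \<in> S \<Longrightarrow> inv s \<in> S" and S_gen: "generate G S = carrier G"
  using sym_gen by (auto simp: symmetric_generating_set_def)

lemma word_carrier: "set ws \<subseteq> S \<Longrightarrow> foldr (\<otimes>) ws \<one> \<in> carrier G"
  using S_carrier by (induction ws) auto

lemma word_append:
  "set vs \<subseteq> S \<Longrightarrow> set ws \<subseteq> S
    \<Longrightarrow> foldr (\<otimes>) (vs @ ws) \<one> = foldr (\<otimes>) vs \<one> \<otimes> foldr (\<otimes>) ws \<one>"
proof (induction vs)
  case (Cons s vs)
  then show ?case
    using S_carrier word_carrier[of vs] word_carrier[of ws] by (simp add: m_assoc subset_iff)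
qed (use word_carrier in simp)

lemma word_exists:
  assumes "g \<in> carrier G"
  shows "\<exists>ws. set ws \<subseteq> S \<and> foldr (\<otimes>) ws \<one> = g"
proof -
  have "g \<in> generate G S" using assms S_gen by simp
  then show ?thesis
  proof (induction rule: generate.induct)
    case one
    show ?case by (rule exI[of _ "[]"]) simp
  next
    case (incl s)
    then show ?case using S_carrier by (intro exI[of _ "[s]"]) auto
  next
    case (inv s)
    then show ?case using S_carrier S_inv by (intro exI[of _ "[inv s]"]) auto
  next
    case (eng g h)
    then obtain vs ws where "set vs \<subseteq> S" "foldr (\<otimes>) vs \<one> = g" "set ws \<subseteq> S" "foldr (\<otimes>) ws \<one> = h"
      by blast
    then show ?case
      using word_append[of vs ws] by (intro exI[of _ "vs @ ws"]) simp
  qed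
qed

lemma word_length_word:
  assumes "g \<in> carrier G"
  shows "\<exists>ws. set ws \<subseteq> S \<and> length ws = wl g \<and> foldr (\<otimes>) ws \<one> = g"
  unfolding word_length_def by (rule LeastI_ex) (use word_exists[OF assms] in blast)

lemma word_length_le: "set ws \<subseteq> S \<Longrightarrow> wl (foldr (\<otimes>) ws \<one>) \<le> length ws"
  unfolding word_length_def by (rule Least_le) blast

lemma word_length_mult:
  assumes "g \<in> carrier G" "h \<in> carrier G"
  shows "wl (g \<otimes> h) \<le> wl g + wl h"
proof -
  obtain vs ws where "set vs \<subseteq> S" "length vs = wl g" "foldr (\<otimes>) vs \<one> = g"
    "set ws \<subseteq> S" "length ws = wl h" "foldr (\<otimes>) ws \<one> = h"
    using word_length_word assms by metis
  then show ?thesis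
    using word_append[of vs ws] word_length_le[of "vs @ ws"] by simp
qed

lemma word_length_one: "wl \<one> = 0"
  using word_length_le[of "[]"] by simp

lemma word_length_pow: "g \<in> carrier G \<Longrightarrow> wl (g [^] n) \<le> n * wl g" for n :: nat
proof (induction n)
  case (Suc n)
  then show ?case
    using word_length_mult[of "g [^] n" g] by simp
qed (simp add: word_length_one)

lemma finite_ball: "finite {g \<in> carrier G. wl g \<le> n}"
proof (rule finite_subset)
  show "finite ((\<lambda>ws. foldr (\<otimes>) ws \<one>) ` {ws. set ws \<subseteq> S \<and> length ws \<le> n})"
    using finite_lists_length_le[OF S_finite] by simp
  show "{g \<in> carrier G. wl g \<le> n} \<subseteq> (\<lambda>ws. foldr (\<otimes>) ws \<one>) ` {ws. set ws \<subseteq> S \<and> length ws \<le> n}"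
    using word_length_word by fastforce
qed

lemma orbit_ball_eq: "{\<phi> g x | g. g \<in> carrier G \<and> wl g \<le> n} = (\<lambda>g. \<phi> g x) ` {g \<in> carrier G. wl g \<le> n}"
  by auto

lemma finite_ball_sizes:
  "finite ((\<lambda>x. card {\<phi> g x | g. g \<in> carrier G \<and> wl g \<le> n}) ` Y)"
proof (rule finite_subset)
  show "(\<lambda>x. card {\<phi> g x | g. g \<in> carrier G \<and> wl g \<le> n}) ` Y \<subseteq> {..card {g \<in> carrier G. wl g \<le> n}}"
    unfolding orbit_ball_eq using card_image_le[OF finite_ball] by auto
qed simp

lemma action_growth_ge:
  assumes "x \<in> Y" "\<Sigma> \<subseteq> carrier G" "inj_on (\<lambda>g. \<phi> g x) \<Sigma>" "\<And>g. g \<in> \<Sigma> \<Longrightarrow> wl g \<le> n"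
  shows "real (card \<Sigma>) \<le> action_growth G S Y \<phi> n"
proof -
  have "card \<Sigma> = card ((\<lambda>g. \<phi> g x) ` \<Sigma>)"
    using assms(3) by (simp add: card_image)
  also have "\<dots> \<le> card ((\<lambda>g. \<phi> g x) ` {g \<in> carrier G. wl g \<le> n})"
    using finite_ball assms by (intro card_mono) auto
  also have "\<dots> \<le> Max ((\<lambda>x. card {\<phi> g x | g. g \<in> carrier G \<and> wl g \<le> n}) ` Y)"
    unfolding orbit_ball_eq[symmetric]
    by (rule Max_ge[OF finite_ball_sizes]) (rule imageI[OF assms(1)])
  finally show ?thesis
    by (simp add: action_growth_def)
qed

lemma action_growth_le:
  assumes "Y \<noteq> {}" "\<And>x. x \<in> Y \<Longrightarrow> card ((\<lambda>g. \<phi> g x) ` {g \<in> carrier G. wl g \<le> n}) \<le> M"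
  shows "action_growth G S Y \<phi> n \<le> real M"
  unfolding action_growth_def of_nat_le_iff
  by (rule Max.boundedI[OF finite_ball_sizes]) (use assms in \<open>auto simp only: orbit_ball_eq\<close>)

end

section \<open>The group \<open>\<int>\<^sup>d\<close>\<close>

definition unit_vec :: "nat \<Rightarrow> nat \<Rightarrow> nat \<Rightarrow> int"
  where "unit_vec d i = (\<lambda>j\<in>{..<d}. if j = i then 1 else 0)"

text \<open>Made for induction over the coordinates: passing from \<open>k\<close> to
  \<open>Suc k\<close> multiplies by a power of a single unit vector.\<close>

definition truncate_vec :: "nat \<Rightarrow> nat \<Rightarrow> (nat \<Rightarrow> int) \<Rightarrow> nat \<Rightarrow> int"
  where "truncate_vec d k c = (\<lambda>j\<in>{..<d}. if j < k then c j else 0)"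

lemma carrier_int_power [simp]: "carrier (int_power_group d) = {..<d} \<rightarrow>\<^sub>E UNIV"
  by (simp add: int_power_group_def)

lemma mult_int_power: "x \<otimes>\<^bsub>int_power_group d\<^esub> y = (\<lambda>i\<in>{..<d}. x i + y i)"
  by (simp add: int_power_group_def)

lemma one_int_power: "\<one>\<^bsub>int_power_group d\<^esub> = (\<lambda>i\<in>{..<d}. 0)"
  by (simp add: int_power_group_def)

lemma inv_int_power:
  "x \<in> {..<d} \<rightarrow>\<^sub>E UNIV \<Longrightarrow> inv\<^bsub>int_power_group d\<^esub> x = (\<lambda>i\<in>{..<d}. - x i)"
  by (simp add: int_power_group_def)

lemma comm_group_int_power: "comm_group (int_power_group d)"
proof (rule group.group_comm_groupI)
  show "group (int_power_group d)"
    by (simp add: int_power_group_def)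
qed (simp add: mult_int_power add.commute)

lemma nat_pow_int_power:
  "x \<in> {..<d} \<rightarrow>\<^sub>E UNIV \<Longrightarrow> x [^]\<^bsub>int_power_group d\<^esub> (n::nat) = (\<lambda>i\<in>{..<d}. int n * x i)"
proof (induction n)
  case (Suc n)
  have "x [^]\<^bsub>int_power_group d\<^esub> Suc n = (\<lambda>i\<in>{..<d}. (\<lambda>i\<in>{..<d}. int n * x i) i + x i)"
    using Suc by (simp only: nat_pow_Suc mult_int_power)
  also have "\<dots> = (\<lambda>i\<in>{..<d}. int (Suc n) * x i)"
    by (rule restrict_ext) (simp add: distrib_right)
  finally show ?case .
qed (simp add: one_int_power)

lemma int_pow_int_power:
  assumes "x \<in> {..<d} \<rightarrow>\<^sub>E UNIV"
  shows "x [^]\<^bsub>int_power_group d\<^esub> (k::int) = (\<lambda>i\<in>{..<d}. k * x i)"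
proof -
  show ?thesis
  proof (cases "k < 0")
    case True
    have "x [^]\<^bsub>int_power_group d\<^esub> k = inv\<^bsub>int_power_group d\<^esub> (\<lambda>i\<in>{..<d}. int (nat (- k)) * x i)"
      unfolding int_pow_def2 nat_pow_int_power[OF assms] using True by (simp only: if_True)
    also have "\<dots> = (\<lambda>i\<in>{..<d}. - ((\<lambda>i\<in>{..<d}. int (nat (- k)) * x i) i))"
      by (rule inv_int_power) simp
    also have "\<dots> = (\<lambda>i\<in>{..<d}. k * x i)"
      using True by (intro restrict_ext) simp
    finally show ?thesis .
  next
    case False
    then show ?thesis
      unfolding int_pow_def2 nat_pow_int_power[OF assms] by (simp only: if_False int_nat_eq) simp
  qed
qed

lemma unit_vec_closed [simp]: "unit_vec d i \<in> {..<d} \<rightarrow>\<^sub>E UNIV"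
  by (simp add: unit_vec_def)

lemma truncate_vec_0: "truncate_vec d 0 c = \<one>\<^bsub>int_power_group d\<^esub>"
  by (simp add: truncate_vec_def one_int_power)

lemma truncate_vec_closed [simp]: "truncate_vec d k c \<in> {..<d} \<rightarrow>\<^sub>E UNIV"
  by (simp add: truncate_vec_def)

lemma truncate_vec_Suc:
  "truncate_vec d (Suc k) c
    = truncate_vec d k c \<otimes>\<^bsub>int_power_group d\<^esub> unit_vec d k [^]\<^bsub>int_power_group d\<^esub> c k"
  by (auto simp: truncate_vec_def int_pow_int_power mult_int_power unit_vec_def less_Suc_eq
      intro!: restrict_ext)

lemma truncate_vec_self: "c \<in> {..<d} \<rightarrow>\<^sub>E UNIV \<Longrightarrow> truncate_vec d d c = c"
  by (auto simp: truncate_vec_def fun_eq_iff restrict_def PiE_iff extensional_def)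

lemma generate_unit_vecs:
  "generate (int_power_group d) (unit_vec d ` {..<d}) = carrier (int_power_group d)"
proof -
  interpret Z: comm_group "int_power_group d" by (rule comm_group_int_power)
  let ?H = "generate (int_power_group d) (unit_vec d ` {..<d})"
  have H: "subgroup ?H (int_power_group d)"
    by (rule Z.generate_is_subgroup) (simp add: image_subset_iff)
  have "truncate_vec d k c \<in> ?H" if "k \<le> d" for c k
    using that
  proof (induction k)
    case 0
    then show ?case
      using subgroup.one_closed[OF H] by (simp add: truncate_vec_0)
  next
    case (Suc k)
    then have "unit_vec d k \<in> ?H"
      by (intro generate.incl) auto
    then show ?case
      unfolding truncate_vec_Suc
      using Suc by (intro subgroup.m_closed[OF H] Z.subgroup_int_pow_closed[OF H]) auto
  qed
  then have "c \<in> ?H" if "c \<in> {..<d} \<rightarrow>\<^sub>E UNIV" for c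
    using truncate_vec_self[OF that] by (metis order_refl)
  then show ?thesis
    using subgroup.subset[OF H] by auto
qed

lemma torsion_free_int_power:
  assumes "b \<in> carrier (int_power_group d)" "b \<noteq> \<one>\<^bsub>int_power_group d\<^esub>" "0 < (n::nat)"
  shows "b [^]\<^bsub>int_power_group d\<^esub> n \<noteq> \<one>\<^bsub>int_power_group d\<^esub>"
proof
  assume *: "b [^]\<^bsub>int_power_group d\<^esub> n = \<one>\<^bsub>int_power_group d\<^esub>"
  have b: "b \<in> {..<d} \<rightarrow>\<^sub>E UNIV"
    using assms(1) by simp
  have "(\<lambda>i\<in>{..<d}. int n * b i) i = (\<lambda>i\<in>{..<d}. 0) i" for i
    using * unfolding nat_pow_int_power[OF b] one_int_power by (rule fun_cong)
  then have "b i = 0" if "i < d" for i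
    using assms(3) that by (metis lessThan_iff mult_eq_0_iff of_nat_0_eq_iff neq0_conv restrict_apply')
  then have "b = \<one>\<^bsub>int_power_group d\<^esub>"
    unfolding one_int_power using b by (intro PiE_ext[OF b, of "\<lambda>i\<in>{..<d}. 0"]) simp_all
  then show False using assms(2) by simp
qed

section \<open>Generators of a wreath product\<close>

context wreath
begin

text \<open>Conjugation by top elements carries the copy of \<open>A\<close> at the identity to any
  position. Finitely supported functions are products of such single lamps, and a top factor
  completes an arbitrary element.\<close>

lemma generate_base_top:
  assumes SA: "SA \<subseteq> carrier A" "generate A SA = carrier A" and SB: "SB \<subseteq> carrier B" "generate B SB = carrier B"
  shows "generate W (wreath_base A B ` SA \<union> wreath_top A B ` SB) = carrier W"
proof -
  let ?H = "generate W (wreath_base A B ` SA \<union> wreath_top A B ` SB)"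
  have H: "subgroup ?H W"
    using SA(1) SB(1) by (intro W.generate_is_subgroup) (auto intro!: base.hom_closed top.hom_closed)
  have "wreath_base A B ` carrier A \<subseteq> ?H"
    using base.generate_img[OF SA(1)] SA(2) W.mono_generate[of "wreath_base A B ` SA"] by simp
  then have baseH: "wreath_base A B a \<in> ?H" if "a \<in> carrier A" for a
    using that by blast
  have "wreath_top A B ` carrier B \<subseteq> ?H"
    using top.generate_img[OF SB(1)] SB(2) W.mono_generate[of "wreath_top A B ` SB"] by simp
  then have topH: "wreath_top A B b \<in> ?H" if "b \<in> carrier B" for b
    using that by blast
  have single: "((\<lambda>x\<in>carrier B. if x = b then a else \<one>\<^bsub>A\<^esub>), \<one>\<^bsub>B\<^esub>) \<in> ?H"
    if a: "a \<in> carrier A" and b: "b \<in> carrier B" for a b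
  proof -
    have "wreath_top A B b \<otimes>\<^bsub>W\<^esub> wreath_base A B a \<otimes>\<^bsub>W\<^esub> wreath_top A B (inv\<^bsub>B\<^esub> b)
      = ((\<lambda>x\<in>carrier B. if x = b then a else \<one>\<^bsub>A\<^esub>), \<one>\<^bsub>B\<^esub>)"
      using a b by (auto simp: wreath_top_def wreath_base_def B.inv_solve_left' intro!: restrict_ext)
    then show ?thesis
      using subgroup.m_closed[OF H subgroup.m_closed[OF H topH[OF b] baseH[OF a]] topH[OF B.inv_closed[OF b]]]
      by simp
  qed
  have fin: "(f, \<one>\<^bsub>B\<^esub>) \<in> ?H" if "finite X" "f \<in> F" "\<And>x. x \<in> carrier B \<Longrightarrow> x \<notin> X \<Longrightarrow> f x = \<one>\<^bsub>A\<^esub>" for f X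
    using that
  proof (induction X arbitrary: f)
    case empty
    then have "f = (\<lambda>x\<in>carrier B. \<one>\<^bsub>A\<^esub>)"
      by (intro F_ext) auto
    then show ?case
      using subgroup.one_closed[OF H] by (simp only: W_one)
  next
    case (insert b X)
    show ?case
    proof (cases "b \<in> carrier B")
      case False
      then have "f x = \<one>\<^bsub>A\<^esub>" if "x \<in> carrier B" "x \<notin> X" for x
        using insert.prems(2)[of x] that by auto
      then show ?thesis
        by (rule insert.IH[OF insert.prems(1)])
    next
      case True
      define g where "g = (\<lambda>x\<in>carrier B. if x = b then \<one>\<^bsub>A\<^esub> else f x)"
      have "finite {x \<in> carrier B. g x \<noteq> \<one>\<^bsub>A\<^esub>}"
        by (rule finite_subset[of _ X]) (use insert in \<open>auto simp: g_def\<close>)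
      then have g: "g \<in> F"
        using insert.prems(1) by (auto simp: F_eq g_def)
      have "(g, \<one>\<^bsub>B\<^esub>) \<in> ?H"
      proof (rule insert.IH[OF g])
        show "g x = \<one>\<^bsub>A\<^esub>" if "x \<in> carrier B" "x \<notin> X" for x
          using insert.prems(2)[of x] that by (cases "x = b") (simp_all add: g_def)
      qed
      then have "(g, \<one>\<^bsub>B\<^esub>) \<otimes>\<^bsub>W\<^esub> ((\<lambda>x\<in>carrier B. if x = b then f b else \<one>\<^bsub>A\<^esub>), \<one>\<^bsub>B\<^esub>) \<in> ?H"
        using True insert.prems(1) by (intro subgroup.m_closed[OF H] single) auto
      moreover have "(g, \<one>\<^bsub>B\<^esub>) \<otimes>\<^bsub>W\<^esub> ((\<lambda>x\<in>carrier B. if x = b then f b else \<one>\<^bsub>A\<^esub>), \<one>\<^bsub>B\<^esub>) = (f, \<one>\<^bsub>B\<^esub>)"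
        using insert.prems(1) by (auto simp: g_def fun_eq_iff F_undefined)
      ultimately show ?thesis by simp
    qed
  qed
  have "(f, b) \<in> ?H" if f: "f \<in> F" and b: "b \<in> carrier B" for f b
  proof -
    have "(f, \<one>\<^bsub>B\<^esub>) \<in> ?H"
      using f by (intro fin[of "{x \<in> carrier B. f x \<noteq> \<one>\<^bsub>A\<^esub>}"]) (auto simp: F_eq)
    then have "(f, \<one>\<^bsub>B\<^esub>) \<otimes>\<^bsub>W\<^esub> wreath_top A B b \<in> ?H"
      using topH[OF b] by (rule subgroup.m_closed[OF H])
    moreover have "(f, \<one>\<^bsub>B\<^esub>) \<otimes>\<^bsub>W\<^esub> wreath_top A B b = (f, b)"
      using f b by (auto simp: wreath_top_def fun_eq_iff F_undefined)
    ultimately show ?thesis by simp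
  qed
  then show ?thesis
    using subgroup.subset[OF H] unfolding W_carrier by blast
qed

end

section \<open>Lower bounds for growth from embedded boxes\<close>

locale lamplighter = A: comm_group A for A (structure) +
  fixes d :: nat

sublocale lamplighter \<subseteq> abelian_wreath A "int_power_group d"
  by (intro abelian_wreath.intro wreath.intro abelian_wreath_axioms.intro A.is_group
      comm_group.axioms(2) comm_group_int_power A.comm_group_axioms torsion_free_int_power)


text \<open>With the corner at the origin all coordinates are nonnegative, so only natural powers of
  the unit vectors are needed to reach the points of the box.\<close>

definition nat_box :: "nat \<Rightarrow> nat \<Rightarrow> (nat \<Rightarrow> int) set"
  where "nat_box d n = {..<d} \<rightarrow>\<^sub>E {0..int n}"

lemma finite_box [simp]: "finite (nat_box d n)"
  by (simp add: nat_box_def finite_PiE)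

lemma card_box: "card (nat_box d n) = Suc n ^ d"
  by (simp add: nat_box_def card_PiE nat_add_distrib)

lemma box_closed: "c \<in> nat_box d n \<Longrightarrow> c \<in> {..<d} \<rightarrow>\<^sub>E UNIV"
  by (auto simp: nat_box_def)

context lamplighter
begin

abbreviation "top_el \<equiv> wreath_top A (int_power_group d)"
abbreviation "base_el \<equiv> wreath_base A (int_power_group d)"

lemma finitely_generated_W:
  assumes "finitely_generated A"
  shows "finitely_generated W"
proof -
  obtain SA where SA: "finite SA" "SA \<subseteq> carrier A" "generate A SA = carrier A"
    using assms by (auto simp: finitely_generated_def)
  have SB: "unit_vec d ` {..<d} \<subseteq> carrier (int_power_group d)"
    by (simp add: image_subset_iff)
  have "finite (base_el ` SA \<union> top_el ` unit_vec d ` {..<d})"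
    using SA(1) by simp
  moreover have "base_el ` SA \<union> top_el ` unit_vec d ` {..<d} \<subseteq> carrier W"
    using base.hom_closed top.hom_closed SA(2) SB by blast
  ultimately show ?thesis
    unfolding finitely_generated_def using generate_base_top[OF SA(2,3) SB generate_unit_vecs] by blast
qed

lemma word_length_box:
  assumes "symmetric_generating_set W S"
  shows "\<exists>L>0. \<forall>n. \<forall>c\<in>nat_box d n. word_length W S (top_el c) \<le> L * n"
proof -
  interpret word_metric W S by unfold_locales (rule assms)
  define L where "L = (\<Sum>i<d. wl (top_el (unit_vec d i)))"
  have trunc: "wl (top_el (truncate_vec d k c)) \<le> (\<Sum>i<k. wl (top_el (unit_vec d i))) * n"
    if "k \<le> d" "c \<in> nat_box d n" for k c n
    using that(1)
  proof (induction k)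
    case 0
    then show ?case
      using top.hom_one word_length_one by (simp add: truncate_vec_0)
  next
    case (Suc k)
    have ck: "0 \<le> c k" "c k \<le> int n"
      using that(2) Suc.prems by (auto simp: nat_box_def PiE_iff)
    let ?u = "top_el (unit_vec d k)"
    have u: "?u \<in> carrier W" by (simp add: top.hom_closed)
    have "top_el (truncate_vec d (Suc k) c) = top_el (truncate_vec d k c) \<otimes>\<^bsub>W\<^esub> ?u [^]\<^bsub>W\<^esub> c k"
      unfolding truncate_vec_Suc using B.int_pow_closed[of "unit_vec d k" "c k"]
      by (subst top.hom_mult) (simp_all add: top.hom_int_pow)
    also have "?u [^]\<^bsub>W\<^esub> c k = ?u [^]\<^bsub>W\<^esub> nat (c k)"
      using ck(1) int_pow_int[of W ?u "nat (c k)"] by (simp only: int_nat_eq if_True)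
    finally have "wl (top_el (truncate_vec d (Suc k) c)) \<le> wl (top_el (truncate_vec d k c)) + wl (?u [^]\<^bsub>W\<^esub> nat (c k))"
      using u by (simp add: word_length_mult top.hom_closed)
    also have "wl (?u [^]\<^bsub>W\<^esub> nat (c k)) \<le> n * wl ?u"
    proof -
      have "nat (c k) \<le> n" using ck by simp
      from mult_right_mono[OF this, of "wl ?u"] show ?thesis
        using word_length_pow[OF u, of "nat (c k)"] by linarith
    qed
    also have "wl (top_el (truncate_vec d k c)) \<le> (\<Sum>i<k. wl (top_el (unit_vec d i))) * n"
      using Suc by simp
    finally show ?case
      by (simp add: algebra_simps)
  qed
  \<comment> \<open>\<open>Suc\<close> makes the constant positive even if the sum vanishes, as
    \<open>growth_le\<close> demands.\<close>
  have "wl (top_el c) \<le> Suc L * n" if "c \<in> nat_box d n" for n c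
    using trunc[OF order_refl that] truncate_vec_self[OF box_closed[OF that]] by (simp add: L_def)
  then show ?thesis
    by (intro exI[of _ "Suc L"]) auto
qed

lemma growth_lower_bound:
  assumes ntriv: "carrier A \<noteq> {\<one>\<^bsub>A\<^esub>}" and S: "symmetric_generating_set W S"
    and act: "faithful_G_set W Y \<phi>"
  shows "(\<lambda>n. real n ^ d) \<preceq>\<^sub>g action_growth W S Y \<phi>"
proof -
  interpret word_metric W S by unfold_locales (rule S)
  obtain L where L: "L > 0" "\<And>n c. c \<in> nat_box d n \<Longrightarrow> wl (top_el c) \<le> L * n"
    using word_length_box[OF S] by blast
  have "real n ^ d \<le> real L * action_growth W S Y \<phi> (L * n)" for n
  proof -
    have sub: "top_el ` nat_box d n \<subseteq> top_el ` carrier (int_power_group d)"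
      using box_closed by auto
    then obtain x where x: "x \<in> Y" "inj_on (\<lambda>g. \<phi> g x) (top_el ` nat_box d n)"
      using non_foldable_top[OF ntriv] act unfolding non_foldable_def by (metis finite_box finite_imageI)
    have "real n ^ d \<le> real (card (top_el ` nat_box d n))"
    proof -
      have "inj_on top_el (nat_box d n)"
        by (rule inj_onI) (metis snd_top)
      then have "card (top_el ` nat_box d n) = Suc n ^ d"
        by (simp add: card_image card_box)
      then show ?thesis
        by (simp add: power_mono)
    qed
    also have "\<dots> \<le> action_growth W S Y \<phi> (L * n)"
    proof (rule action_growth_ge[where \<phi> = \<phi>, OF x(1) _ x(2)])
      show "top_el ` nat_box d n \<subseteq> carrier W"
        by (rule image_subsetI, rule top.hom_closed) (use box_closed in simp)
      show "wl g \<le> L * n" if "g \<in> top_el ` nat_box d n" for g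
        using that by (elim imageE) (simp only: L(2))
    qed
    \<comment> \<open>\<open>growth_le\<close> uses one constant both as factor and as rescaling, so
      the estimate is weakened by the factor \<open>L \<ge> 1\<close>.\<close>
    also have "\<dots> \<le> real L * action_growth W S Y \<phi> (L * n)"
      using L(1) mult_right_mono[of 1 "real L" "action_growth W S Y \<phi> (L * n)"]
      by (simp add: action_growth_def)
    finally show ?thesis .
  qed
  then show ?thesis
    unfolding growth_le_def using L(1) by (intro exI[of _ L]) simp
qed

lemma growth_lower_bound_infinite_order:
  assumes t: "t \<in> carrier A" "group.ord A t = 0" and S: "symmetric_generating_set W S"
    and act: "faithful_G_set W Y \<phi>"
  shows "(\<lambda>n. real n ^ (d + 1)) \<preceq>\<^sub>g action_growth W S Y \<phi>"
proof -
  interpret word_metric W S by unfold_locales (rule S)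
  obtain L where L: "L > 0" "\<And>n c. c \<in> nat_box d n \<Longrightarrow> wl (top_el c) \<le> L * n"
    using word_length_box[OF S] by blast
  define M where "M = L + wl (base_el t)"
  have M: "M > 0" using L by (simp add: M_def)
  have tW: "base_el t \<in> carrier W" using t by (simp add: base.hom_closed)
  have "real n ^ (d + 1) \<le> real M * action_growth W S Y \<phi> (M * n)" for n
  proof -
    \<comment> \<open>The powers of \<open>t\<close> add one dimension to the box. From a value of
      \<open>e\<close> the position is read off by \<open>snd\<close>; after cancelling it, the lamp
      at the identity determines the exponent because \<open>t\<close> has infinite order.\<close>
    define e where "e = (\<lambda>(c, m). top_el c \<otimes>\<^bsub>W\<^esub> base_el t [^]\<^bsub>W\<^esub> (m::nat))"
    define \<Sigma> where "\<Sigma> = e ` (nat_box d n \<times> {..n})"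
    have top_W: "top_el c \<in> carrier W" if "c \<in> nat_box d n" for c
      using box_closed[OF that] by (simp add: top.hom_closed)
    have "inj_on e (nat_box d n \<times> {..n})"
    proof (rule inj_onI, clarify)
      fix c m c' m' assume c: "c \<in> nat_box d n" "c' \<in> nat_box d n" and eq: "e (c, m) = e (c', m')"
      have snd_e: "snd (e (c, m)) = c" if "c \<in> nat_box d n" for c m
      proof -
        have "snd (e (c, m)) = c \<otimes>\<^bsub>int_power_group d\<^esub> \<one>\<^bsub>int_power_group d\<^esub> [^]\<^bsub>int_power_group d\<^esub> m"
          unfolding e_def using top_W[OF that] tW by (simp add: snd.hom_mult snd.hom_nat_pow)
        also have "\<dots> = c"
          using box_closed[OF that] by (simp add: B.nat_pow_one)
        finally show ?thesis .
      qed
      have "c = c'" using eq snd_e c by metis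
      then have "base_el t [^]\<^bsub>W\<^esub> m = base_el t [^]\<^bsub>W\<^esub> m'"
        using eq tW top_W[OF c(1)] by (simp add: e_def)
      then have "base_el (t [^]\<^bsub>A\<^esub> m) = base_el (t [^]\<^bsub>A\<^esub> m')"
        using t by (simp add: base.hom_nat_pow)
      then have "fst (base_el (t [^]\<^bsub>A\<^esub> m)) \<one>\<^bsub>int_power_group d\<^esub> = fst (base_el (t [^]\<^bsub>A\<^esub> m')) \<one>\<^bsub>int_power_group d\<^esub>"
        by simp
      then have "t [^]\<^bsub>A\<^esub> m = t [^]\<^bsub>A\<^esub> m'"
        by (simp add: wreath_base_def del: carrier_int_power)
      then have "m = m'"
        using A.int_pow_eq[OF t(1), of "int m" "int m'"] t(2) by (simp add: int_pow_int)
      then show "c = c' \<and> m = m'" using \<open>c = c'\<close> by simp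
    qed
    then have card: "card \<Sigma> = Suc n ^ (d + 1)"
      by (simp add: \<Sigma>_def card_image card_cartesian_product card_box)
    have "\<Sigma> \<subseteq> top_el ` carrier (int_power_group d) <#>\<^bsub>W\<^esub> generate W {base_el t}"
    proof
      fix g assume "g \<in> \<Sigma>"
      then obtain c m where "c \<in> nat_box d n" "g = top_el c \<otimes>\<^bsub>W\<^esub> base_el t [^]\<^bsub>W\<^esub> (int m)"
        by (auto simp: \<Sigma>_def e_def int_pow_int)
      moreover from this have "top_el c \<in> top_el ` carrier (int_power_group d)"
        using box_closed[of c d n] by simp
      moreover have "base_el t [^]\<^bsub>W\<^esub> (int m) \<in> generate W {base_el t}"
        unfolding W.generate_pow[OF tW] by blast
      ultimately show "g \<in> top_el ` carrier (int_power_group d) <#>\<^bsub>W\<^esub> generate W {base_el t}"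
        unfolding set_mult_def by blast
    qed
    moreover have "finite \<Sigma>" by (simp add: \<Sigma>_def)
    ultimately obtain x where x: "x \<in> Y" "inj_on (\<lambda>g. \<phi> g x) \<Sigma>"
      using non_foldable_top_base[OF t] act unfolding non_foldable_def by metis
    have "real n ^ (d + 1) \<le> real (card \<Sigma>)"
      unfolding card by (simp only: of_nat_power) (rule power_mono; simp)
    also have "\<dots> \<le> action_growth W S Y \<phi> (M * n)"
    proof (rule action_growth_ge[where \<phi> = \<phi>, OF x(1) _ x(2)])
      show "\<Sigma> \<subseteq> carrier W"
        using top_W tW by (auto simp: \<Sigma>_def e_def simp del: W_mult)
      show "wl g \<le> M * n" if g: "g \<in> \<Sigma>" for g
      proof -
        obtain c m where cm: "c \<in> nat_box d n" "m \<le> n" "g = top_el c \<otimes>\<^bsub>W\<^esub> base_el t [^]\<^bsub>W\<^esub> m"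
          using g unfolding \<Sigma>_def e_def by (elim imageE SigmaE) (simp del: W_mult)
        have "wl g \<le> wl (top_el c) + wl (base_el t [^]\<^bsub>W\<^esub> m)"
          unfolding cm(3) using top_W[OF cm(1)] tW by (intro word_length_mult) auto
        also have "\<dots> \<le> L * n + n * wl (base_el t)"
          using L(2)[OF cm(1)] word_length_pow[OF tW, of m] mult_right_mono[OF cm(2), of "wl (base_el t)"]
          by linarith
        finally show ?thesis by (simp add: M_def algebra_simps)
      qed
    qed
    also have "\<dots> \<le> real M * action_growth W S Y \<phi> (M * n)"
      using M mult_right_mono[of 1 "real M" "action_growth W S Y \<phi> (M * n)"]
      by (simp add: action_growth_def)
    finally show ?thesis .
  qed
  then show ?thesis
    unfolding growth_le_def using M by (intro exI[of _ M]) simp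
qed

end

section \<open>Distances in Schreier graphs\<close>

text \<open>The infimum over a nonempty set of path lengths is attained, and without any path it is
  infinite, so it exceeds every real \<open>R\<close>.\<close>

lemma simplicial_dist_le_iff:
  "simplicial_dist E x y \<le> ereal R \<longleftrightarrow> (\<exists>n. real n \<le> R \<and> (x, y) \<in> E ^^ n)"
proof
  assume le: "simplicial_dist E x y \<le> ereal R"
  have "\<exists>n. (x, y) \<in> E ^^ n"
  proof (rule ccontr)
    assume "\<nexists>n. (x, y) \<in> E ^^ n"
    then have "{n. (x, y) \<in> E ^^ n} = {}" by blast
    then have "simplicial_dist E x y = \<infinity>"
      unfolding simplicial_dist_def by (simp add: top_ereal_def)
    then show False using le by simp
  qed
  define m where "m = (LEAST n. (x, y) \<in> E ^^ n)"
  have m: "(x, y) \<in> E ^^ m"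
    unfolding m_def by (rule LeastI_ex) fact
  have "ereal (real m) \<le> simplicial_dist E x y"
    unfolding simplicial_dist_def by (rule INF_greatest) (simp add: m_def Least_le)
  then show "\<exists>n. real n \<le> R \<and> (x, y) \<in> E ^^ n"
    using le m by (intro exI[of _ m]) (metis ereal_less_eq(3) order_trans)
next
  assume "\<exists>n. real n \<le> R \<and> (x, y) \<in> E ^^ n"
  then obtain n where n: "real n \<le> R" "(x, y) \<in> E ^^ n" by blast
  then have "simplicial_dist E x y \<le> ereal (real n)"
    unfolding simplicial_dist_def by (intro INF_lower) simp
  also have "\<dots> \<le> ereal R" using n by simp
  finally show "simplicial_dist E x y \<le> ereal R" .
qed

locale word_action = word_metric G S + group_action G Y \<phi> for G (structure) and S and Y and \<phi>
begin

abbreviation "sdist \<equiv> simplicial_dist (schreier_edges S Y \<phi>)"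

lemma action_closed: "g \<in> carrier G \<Longrightarrow> x \<in> Y \<Longrightarrow> \<phi> g x \<in> Y"
  using element_image by blast

lemma action_one: "x \<in> Y \<Longrightarrow> \<phi> \<one> x = x"
  by (metis id_eq_one restrict_apply')

lemma word_length_generator: "s \<in> S \<Longrightarrow> wl s \<le> 1"
  using word_length_le[of "[s]"] S_carrier by auto

lemma schreier_path_word:
  assumes "x \<in> Y" "set ws \<subseteq> S"
  shows "(x, \<phi> (foldr (\<otimes>) ws \<one>) x) \<in> schreier_edges S Y \<phi> ^^ length ws"
  using assms(2)
proof (induction ws)
  case Nil
  then show ?case using assms(1) action_one by simp
next
  case (Cons s ws)
  let ?y = "\<phi> (foldr (\<otimes>) ws \<one>) x"
  have s: "s \<in> carrier G" "foldr (\<otimes>) ws \<one> \<in> carrier G"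
    using Cons.prems S_carrier word_carrier[of ws] by auto
  then have y: "?y \<in> Y" using assms(1) action_closed by blast
  have eq: "\<phi> (foldr (\<otimes>) (s # ws) \<one>) x = \<phi> s ?y"
    using composition_rule[OF assms(1) s] by simp
  have "(?y, \<phi> s ?y) \<in> schreier_edges S Y \<phi>"
    using y s action_closed Cons.prems by (auto simp: schreier_edges_def)
  then show ?case
    unfolding eq using Cons by auto
qed

lemma sdist_action_le:
  assumes "x \<in> Y" "g \<in> carrier G" "real (wl g) \<le> R"
  shows "sdist x (\<phi> g x) \<le> ereal R"
proof -
  obtain ws where "set ws \<subseteq> S" "length ws = wl g" "foldr (\<otimes>) ws \<one> = g"
    using word_length_word[OF assms(2)] by blast
  then show ?thesis
    using schreier_path_word[OF assms(1), of ws] assms(3) by (auto simp: simplicial_dist_le_iff)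
qed

text \<open>Edges are undirected; symmetry of \<open>S\<close> lets either orientation be realized
  by a generator.\<close>

lemma schreier_edgeE:
  assumes "(x, y) \<in> schreier_edges S Y \<phi>"
  obtains s where "s \<in> S" "y = \<phi> s x" "x \<in> Y" "y \<in> Y"
proof -
  obtain s where s: "s \<in> S" "x \<in> Y" "y \<in> Y" "y = \<phi> s x \<or> x = \<phi> s y"
    using assms by (auto simp: schreier_edges_def)
  show ?thesis
  proof (cases "y = \<phi> s x")
    case False
    then have "y = \<phi> (inv s) x"
      using s orbit_sym_aux[of s y x] S_carrier by auto
    then show ?thesis using s S_inv that by blast
  qed (use s that in blast)
qed

lemma schreier_path_imp_action:
  assumes "x \<in> Y"
  shows "(x, y) \<in> schreier_edges S Y \<phi> ^^ n \<Longrightarrow> \<exists>g\<in>carrier G. wl g \<le> n \<and> y = \<phi> g x"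
proof (induction n arbitrary: y)
  case 0
  then show ?case
    using action_one[OF assms] word_length_one by (intro bexI[of _ \<one>]) auto
next
  case (Suc n)
  then obtain z where z: "(x, z) \<in> schreier_edges S Y \<phi> ^^ n" "(z, y) \<in> schreier_edges S Y \<phi>"
    by auto
  from Suc.IH[OF z(1)] obtain g where g: "g \<in> carrier G" "wl g \<le> n" "z = \<phi> g x" by blast
  from z(2) obtain s where s: "s \<in> S" "y = \<phi> s z"
    by (rule schreier_edgeE)
  have sc: "s \<in> carrier G" using s(1) S_carrier by blast
  have "y = \<phi> (s \<otimes> g) x"
    using composition_rule[OF assms sc g(1)] s(2) g(3) by simp
  moreover have "wl (s \<otimes> g) \<le> Suc n"
    using word_length_mult[OF sc g(1)] word_length_generator[OF s(1)] g(2) by linarith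
  ultimately show ?case
    using sc g(1) by blast
qed

lemma sdist_le_imp_action:
  assumes "x \<in> Y" "sdist x y \<le> ereal R"
  shows "\<exists>g\<in>carrier G. wl g \<le> nat \<lfloor>R\<rfloor> \<and> y = \<phi> g x"
proof -
  obtain n where n: "real n \<le> R" "(x, y) \<in> schreier_edges S Y \<phi> ^^ n"
    using assms(2) by (auto simp: simplicial_dist_le_iff)
  then have "n \<le> nat \<lfloor>R\<rfloor>" by linarith
  then show ?thesis
    using schreier_path_imp_action[OF assms(1) n(2)] by (meson order_trans)
qed

end

section \<open>Lower bound for the asymptotic dimension\<close>

text \<open>Kuhn's lemma yields an odd, hence nonzero, number of simplices on which the reduced
  label takes all values. Of the simplex only its inclusion in a unit cube with corner
  \<open>q\<close> is kept, since adjacency below is that of king moves within a cube.\<close>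

lemma king_cube_labels:
  assumes "0 < p"
    and "\<And>x j. (\<And>j. x j \<le> p) \<Longrightarrow> j < n \<Longrightarrow> x j = 0 \<Longrightarrow> lab x j = (0::nat)"
    and "\<And>x j. (\<And>j. x j \<le> p) \<Longrightarrow> j < n \<Longrightarrow> x j = p \<Longrightarrow> lab x j = 1"
  obtains q s where "(\<lambda>x. reduced n (lab x)) ` s = {..n}" "\<And>j. j < n \<Longrightarrow> q j < p"
    "\<And>x j. x \<in> s \<Longrightarrow> x j \<le> p" "\<And>x j. x \<in> s \<Longrightarrow> j < n \<Longrightarrow> q j \<le> x j \<and> x j \<le> Suc (q j)"
proof -
  have "odd (card {s. ksimplex p n s \<and> (reduced n \<circ> lab) ` s = {..n}})"
    by (rule kuhn_combinatorial) (use assms in blast)+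
  then have "{s. ksimplex p n s \<and> (reduced n \<circ> lab) ` s = {..n}} \<noteq> {}"
    by (metis card.empty even_zero)
  then obtain s where s: "ksimplex p n s" "(reduced n \<circ> lab) ` s = {..n}"
    by blast
  then obtain q u where "kuhn_simplex p n q u s"
    by (auto elim: ksimplex.cases)
  then interpret kuhn_simplex p n q u s .
  show ?thesis
  proof (rule that)
    show "(\<lambda>x. reduced n (lab x)) ` s = {..n}"
      using s(2) by (simp add: comp_def)
    show "q j < p" if "j < n" for j
      using base that by auto
    show "x j \<le> p" if "x \<in> s" for x j
      using s_le_p[OF that] .
    show "q j \<le> x j \<and> x j \<le> Suc (q j)" if "x \<in> s" "j < n" for x j
      using that by (auto simp: s_eq enum_def)
  qed
qed

text \<open>A path that rises by at most one per step cannot skip a height.\<close>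

lemma discrete_intermediate_value:
  fixes h :: "'a \<Rightarrow> nat"
  assumes "(z, w) \<in> K\<^sup>*" "\<And>x y. (x, y) \<in> K \<Longrightarrow> h y \<le> Suc (h x)" "h z = 0" "k \<le> h w"
  shows "\<exists>v. (z, v) \<in> K\<^sup>* \<and> h v = k"
  using assms(1,4)
proof (induction arbitrary: k)
  case base
  then show ?case using assms(3) by auto
next
  case (step x y)
  show ?case
  proof (cases "k \<le> h x")
    case False
    then have "h y = k"
      using assms(2)[OF step.hyps(2)] step.prems by linarith
    then show ?thesis
      using rtrancl.rtrancl_into_rtrancl[OF step.hyps] by blast
  qed (use step.IH in blast)
qed

context lamplighter
begin

lemma asdim_lower_bound:
  assumes ntriv: "carrier A \<noteq> {\<one>\<^bsub>A\<^esub>}" and S: "symmetric_generating_set W S"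
    and act: "faithful_G_set W Y \<phi>"
    and asdim: "asdim_at_most Y (simplicial_dist (schreier_edges S Y \<phi>)) n"
  shows "d \<le> n"
proof (rule ccontr)
  assume "\<not> d \<le> n"
  then have "n < d" by simp
  interpret faithful_action W Y \<phi>
    using act by (simp add: faithful_G_set_def)
  interpret word_action W S Y \<phi>
    by unfold_locales (rule S)
  obtain L where L: "\<And>n c. c \<in> nat_box d n \<Longrightarrow> wl (top_el c) \<le> L * n" "L > 0"
    using word_length_box[OF S] by blast
  \<comment> \<open>The scale is \<open>L\<close> because the vertices of a unit cube differ from
    its corner by elements of \<open>nat_box d 1\<close>, of word length at most
    \<open>L\<close>.\<close>
  obtain \<U> D where \<U>: "\<Union>\<U> = Y" "\<And>U x y. U \<in> \<U> \<Longrightarrow> x \<in> U \<Longrightarrow> y \<in> U \<Longrightarrow> sdist x y \<le> ereal D"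
    "\<And>x. x \<in> Y \<Longrightarrow> finite {U \<in> \<U>. U \<inter> {y \<in> Y. sdist x y \<le> ereal (real L)} \<noteq> {}}"
    "\<And>x. x \<in> Y \<Longrightarrow> card {U \<in> \<U>. U \<inter> {y \<in> Y. sdist x y \<le> ereal (real L)} \<noteq> {}} \<le> n + 1"
  proof -
    have "0 < real L" using L(2) by simp
    with asdim have "\<exists>\<U>. (\<forall>U\<in>\<U>. U \<subseteq> Y) \<and> \<Union>\<U> = Y \<and> (\<exists>D::real. \<forall>U\<in>\<U>. \<forall>x\<in>U. \<forall>y\<in>U. sdist x y \<le> ereal D) \<and>
        (\<forall>x\<in>Y. finite {U\<in>\<U>. U \<inter> {y\<in>Y. sdist x y \<le> ereal (real L)} \<noteq> {}} \<and>
                card {U\<in>\<U>. U \<inter> {y\<in>Y. sdist x y \<le> ereal (real L)} \<noteq> {}} \<le> n + 1)"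
      unfolding asdim_at_most_def by blast
    then obtain \<U> D where 1: "\<Union>\<U> = Y" "\<forall>U\<in>\<U>. \<forall>x\<in>U. \<forall>y\<in>U. sdist x y \<le> ereal D"
      "\<forall>x\<in>Y. finite {U\<in>\<U>. U \<inter> {y\<in>Y. sdist x y \<le> ereal (real L)} \<noteq> {}} \<and>
                card {U\<in>\<U>. U \<inter> {y\<in>Y. sdist x y \<le> ereal (real L)} \<noteq> {}} \<le> n + 1"
      by (elim exE conjE)
    show thesis
      by (rule that[OF 1(1) 1(2)[rule_format] 1(3)[THEN bspec, THEN conjunct1] 1(3)[THEN bspec, THEN conjunct2]])
  qed
  define M where "M = card {g \<in> carrier W. wl g \<le> nat \<lfloor>D\<rfloor>}"
  have U_card: "finite V \<and> card V \<le> M" if U: "U \<in> \<U>" and V: "V \<subseteq> U" for U V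
  proof (cases "V = {}")
    case False
    then obtain x where x: "x \<in> V" by blast
    then have "x \<in> Y" using U V \<U>(1) by blast
    have sub: "V \<subseteq> (\<lambda>g. \<phi> g x) ` {g \<in> carrier W. wl g \<le> nat \<lfloor>D\<rfloor>}"
    proof
      fix y assume "y \<in> V"
      then have "sdist x y \<le> ereal D" using \<U>(2)[OF U] x V by blast
      from sdist_le_imp_action[OF \<open>x \<in> Y\<close> this]
      show "y \<in> (\<lambda>g. \<phi> g x) ` {g \<in> carrier W. wl g \<le> nat \<lfloor>D\<rfloor>}" by blast
    qed
    show ?thesis
      using surj_card_le[OF finite_ball sub] finite_subset[OF sub finite_imageI[OF finite_ball]]
      by (simp add: M_def)
  qed simp
  \<comment> \<open>Crossing the box would take \<open>p + 1\<close> distinct points of one cover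
    element, while a cover element has at most \<open>M\<close> points.\<close>
  define p where "p = Suc M"
  have "top_el ` nat_box d p \<subseteq> top_el ` carrier (int_power_group d)"
    using box_closed by auto
  then obtain x0 where x0: "x0 \<in> Y" "inj_on (\<lambda>g. \<phi> g x0) (top_el ` nat_box d p)"
    using non_foldable_top[OF ntriv] act unfolding non_foldable_def by (metis finite_box finite_imageI)
  define grid where "grid = {z. \<forall>j::nat. z j \<le> p}"
  define vec where "vec z = (\<lambda>j\<in>{..<d}. int (z j))" for z
  define pt where "pt z = \<phi> (top_el (vec z)) x0" for z
  have vec_closed: "vec z \<in> carrier (int_power_group d)" for z
    by (simp add: vec_def)
  have pt_Y: "pt z \<in> Y" for z
    unfolding pt_def using x0(1) top.hom_closed[OF vec_closed] by (intro action_closed)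
  have pt_inj: "z j = w j" if "z \<in> grid" "w \<in> grid" "pt z = pt w" "j < d" for z w j
  proof -
    have box: "vec v \<in> nat_box d p" if "v \<in> grid" for v
      using that by (auto simp: vec_def nat_box_def grid_def)
    have "top_el (vec z) = top_el (vec w)"
      using inj_onD[OF x0(2) that(3)[unfolded pt_def] imageI[OF box[OF that(1)]] imageI[OF box[OF that(2)]]] .
    then have "vec z = vec w" by (metis snd_top)
    then have "vec z j = vec w j" by simp
    then show ?thesis using that(4) by (simp add: vec_def)
  qed
  have "\<forall>z. \<exists>U. U \<in> \<U> \<and> pt z \<in> U"
    using pt_Y \<U>(1) by blast
  then obtain u where u: "\<And>z. u z \<in> \<U>" "\<And>z. pt z \<in> u z" by metis
  \<comment> \<open>King moves between grid points whose images both lie in \<open>U\<close>; its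
    classes are the components of the preimage of \<open>U\<close>.\<close>
  define K where "K U = {(z, w). z \<in> grid \<and> w \<in> grid \<and> pt z \<in> U \<and> pt w \<in> U
    \<and> (\<forall>j<d. z j \<le> Suc (w j) \<and> w j \<le> Suc (z j))}" for U
  \<comment> \<open>Whether the component of \<open>z\<close> touches the face \<open>p\<close> in
    direction \<open>i\<close>. This is trivially \<open>1\<close> on that face, and constant on
    components.\<close>
  define lab where "lab z i = (if \<exists>w. (z, w) \<in> (K (u z))\<^sup>* \<and> w i = p then 1 else 0 :: nat)" for z i
  have K_grid: "w \<in> grid \<and> pt w \<in> U" if "(z, w) \<in> (K U)\<^sup>*" "z \<in> grid" "pt z \<in> U" for z w U
    using that by (induction) (auto simp: K_def)
  obtain q s where qs: "(\<lambda>z. reduced d (lab z)) ` s = {..d}" "\<And>j. j < d \<Longrightarrow> q j < p"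
    "\<And>z j. z \<in> s \<Longrightarrow> z j \<le> p" "\<And>z j. z \<in> s \<Longrightarrow> j < d \<Longrightarrow> q j \<le> z j \<and> z j \<le> Suc (q j)"
  proof (rule king_cube_labels[of p d lab])
    show "0 < p" by (simp add: p_def)
    show "lab z j = 1" if "\<And>j. z j \<le> p" "j < d" "z j = p" for z j
      using that(3) by (auto simp: lab_def)
    show "lab z j = 0" if z: "\<And>j. z j \<le> p" "j < d" "z j = 0" for z j
    proof (rule ccontr)
      assume "lab z j \<noteq> 0"
      then obtain w where w: "(z, w) \<in> (K (u z))\<^sup>*" "w j = p"
        by (auto simp: lab_def split: if_splits)
      \<comment> \<open>A component joining face \<open>0\<close> to face \<open>p\<close> would
        contain a point of every intermediate height, and the images of these points in
        \<open>u z\<close> are distinct.\<close>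
      have "\<exists>v. (z, v) \<in> (K (u z))\<^sup>* \<and> v j = k" if "k \<le> p" for k
        using discrete_intermediate_value[OF w(1), of "\<lambda>v. v j" k] z that w(2) by (auto simp: K_def)
      then obtain v where v: "\<And>k. k \<le> p \<Longrightarrow> (z, v k) \<in> (K (u z))\<^sup>*" "\<And>k. k \<le> p \<Longrightarrow> v k j = k"
        by metis
      have zg: "z \<in> grid" using z(1) by (simp add: grid_def)
      have vg: "v k \<in> grid" "pt (v k) \<in> u z" if "k \<le> p" for k
        using K_grid[OF v(1)[OF that] zg u(2)] by simp_all
      have "inj_on (\<lambda>k. pt (v k)) {..p}"
      proof (rule inj_onI)
        fix k l assume "k \<in> {..p}" "l \<in> {..p}" "pt (v k) = pt (v l)"
        then show "k = l"
          using pt_inj[of "v k" "v l" j] vg v(2) z(2) by (metis atMost_iff)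
      qed
      then have "card ((\<lambda>k. pt (v k)) ` {..p}) = Suc p"
        by (simp add: card_image)
      moreover have "(\<lambda>k. pt (v k)) ` {..p} \<subseteq> u z"
        using vg by auto
      ultimately show False
        using U_card[OF u(1)[of z], of "(\<lambda>k. pt (v k)) ` {..p}"] by (simp add: p_def)
    qed
  qed (rule that)
  have s_grid: "z \<in> grid" if "z \<in> s" for z
    using qs(3)[OF that] by (simp add: grid_def)
  \<comment> \<open>Vertices of one cube lying in the same cover element are a king move apart, so
    they share a component and all labels. Hence \<open>d + 1\<close> distinct reduced labels need
    \<open>d + 1\<close> distinct cover elements.\<close>
  have inj: "reduced d (lab z) = reduced d (lab w)" if zw: "z \<in> s" "w \<in> s" and eq: "u z = u w" for z w
  proof -
    have adj: "(z, w) \<in> K (u z)" "(w, z) \<in> K (u z)"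
    proof -
      have "z j \<le> Suc (w j) \<and> w j \<le> Suc (z j)" if "j < d" for j
        using qs(4)[OF zw(1) that] qs(4)[OF zw(2) that] by linarith
      then show "(z, w) \<in> K (u z)" "(w, z) \<in> K (u z)"
        using s_grid zw u(2)[of z] u(2)[of w] eq by (auto simp: K_def)
    qed
    have "lab z i = lab w i" for i
      using adj unfolding lab_def eq by (metis converse_rtrancl_into_rtrancl)
    then have "lab z = lab w" by blast
    then show ?thesis by simp
  qed
  have near: "sdist (pt q) (pt z) \<le> ereal (real L)" if z: "z \<in> s" for z
  proof -
    define c where "c = (\<lambda>j\<in>{..<d}. int (z j) - int (q j))"
    have c: "c \<in> nat_box d 1"
      using qs(4)[OF z] by (fastforce simp: c_def nat_box_def)
    have cc: "c \<in> carrier (int_power_group d)" by (simp add: c_def)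
    have "vec z = c \<otimes>\<^bsub>int_power_group d\<^esub> vec q"
      by (simp add: vec_def c_def mult_int_power cong: restrict_cong)
    then have "pt z = \<phi> (top_el c) (pt q)"
      unfolding pt_def using top.hom_mult[OF cc vec_closed, of q] x0(1)
      by (simp add: composition_rule top.hom_closed[OF cc] top.hom_closed[OF vec_closed])
    moreover have "real (wl (top_el c)) \<le> real L"
      using L(1)[OF c] by simp
    ultimately show ?thesis
      using sdist_action_le[OF pt_Y top.hom_closed[OF cc]] by simp
  qed
  have "\<forall>r\<in>{..d}. \<exists>z\<in>s. reduced d (lab z) = r"
    using qs(1) by (metis (no_types, lifting) imageE)
  then obtain z where z: "\<And>r. r \<le> d \<Longrightarrow> z r \<in> s" "\<And>r. r \<le> d \<Longrightarrow> reduced d (lab (z r)) = r"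
    by (metis atMost_iff)
  have "inj_on (\<lambda>r. u (z r)) {..d}"
  proof (rule inj_onI)
    fix r r' assume "r \<in> {..d}" "r' \<in> {..d}" "u (z r) = u (z r')"
    then show "r = r'"
      using inj[of "z r" "z r'"] z by (metis atMost_iff)
  qed
  then have "Suc d = card ((\<lambda>r. u (z r)) ` {..d})"
    by (simp add: card_image)
  also have "\<dots> \<le> card {U \<in> \<U>. U \<inter> {y \<in> Y. sdist (pt q) y \<le> ereal (real L)} \<noteq> {}}"
  proof (rule card_mono[OF \<U>(3)[OF pt_Y]], rule image_subsetI)
    fix r assume "r \<in> {..d}"
    then have "pt (z r) \<in> u (z r) \<inter> {y \<in> Y. sdist (pt q) y \<le> ereal (real L)}"
      using u(2) pt_Y near z(1) by simp
    then show "u (z r) \<in> {U \<in> \<U>. U \<inter> {y \<in> Y. sdist (pt q) y \<le> ereal (real L)} \<noteq> {}}"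
      using u(1) by blast
  qed
  also have "\<dots> \<le> n + 1"
    by (rule \<U>(4)[OF pt_Y])
  finally show False using \<open>n < d\<close> by simp
qed

corollary action_asdim_ge:
  assumes "carrier A \<noteq> {\<one>\<^bsub>A\<^esub>}" "symmetric_generating_set W S" "faithful_G_set W Y \<phi>"
  shows "action_asdim S Y \<phi> \<ge> enat d"
  unfolding action_asdim_def asdim_def
  by (rule INF_greatest) (use asdim_lower_bound[OF assms] in simp)

end

section \<open>Finitely generated abelian groups\<close>

lemma (in group) subgroup_nat_pow_closed:
  assumes "subgroup H G" "h \<in> H"
  shows "h [^] (n::nat) \<in> H"
  using subgroup_int_pow_closed[OF assms, of "int n"] by (simp only: int_pow_int)

lemma (in comm_group) generate_insert_eq:
  assumes S: "S \<subseteq> carrier G" and s: "s \<in> carrier G" and x: "x \<in> generate G (insert s S)"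
  shows "\<exists>b\<in>generate G S. \<exists>k::int. x = b \<otimes> s [^] k"
  using x
proof (induction rule: generate.induct)
  case one
  show ?case
    by (intro bexI[OF _ generate.one] exI[of _ 0]) simp
next
  case (incl y)
  show ?case
  proof (cases "y = s")
    case True
    then show ?thesis
      using s by (intro bexI[OF _ generate.one] exI[of _ 1]) (simp add: int_pow_1)
  next
    case False
    then have "y \<in> generate G S" "y \<in> carrier G"
      using incl S by (auto intro: generate.incl)
    then show ?thesis
      by (intro bexI[of _ y] exI[of _ 0]) simp_all
  qed
next
  case (inv y)
  show ?case
  proof (cases "y = s")
    case True
    then show ?thesis
      using s by (intro bexI[OF _ generate.one] exI[of _ "-1"]) (simp add: int_pow_neg int_pow_1)
  next
    case False
    then have "inv y \<in> generate G S" "y \<in> carrier G"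
      using inv S by (auto intro: generate.inv)
    then show ?thesis
      by (intro bexI[of _ "inv y"] exI[of _ 0]) simp_all
  qed
next
  case (eng x y)
  then obtain b c :: 'a and k l :: int where bc: "b \<in> generate G S" "x = b \<otimes> s [^] k"
    "c \<in> generate G S" "y = c \<otimes> s [^] l"
    by blast
  have car: "b \<in> carrier G" "c \<in> carrier G" "s [^] k \<in> carrier G" "s [^] l \<in> carrier G"
    using bc generate_in_carrier[OF S] s by auto
  have "x \<otimes> y = b \<otimes> c \<otimes> (s [^] k \<otimes> s [^] l)"
    unfolding bc(2,4) using car by (simp add: m_assoc m_lcomm[of "s [^] k" c])
  also have "s [^] k \<otimes> s [^] l = s [^] (k + l)"
    using s by (simp add: int_pow_mult)
  finally show ?case
    using generate.eng[OF bc(1,3)] by blast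
qed

text \<open>Homomorphisms to \<open>\<int>\<close> separate \<open>B = generate G S\<close> modulo torsion, and a subgroup \<open>F\<close> of
  finite index takes care of the torsion. If \<open>s ^ n \<in> B\<close>, then homomorphisms extend from \<open>B\<close> to
  the group generated by \<open>B\<close> and \<open>s\<close> after precomposition with \<open>x \<mapsto> x ^ n\<close>, and \<open>F\<close> still has
  finite index there.\<close>

lemma (in comm_group) separating_homs_generate:
  assumes "finite S" "S \<subseteq> carrier G"
  shows "\<exists>H F R. finite H \<and> (\<forall>h\<in>H. \<forall>x\<in>generate G S. \<forall>y\<in>generate G S. h (x \<otimes> y) = (h x + h y :: int))
    \<and> subgroup F G \<and> F \<subseteq> generate G S \<and> finite R \<and> R \<subseteq> generate G S
    \<and> (\<forall>x\<in>generate G S. \<exists>f\<in>F. \<exists>r\<in>R. x = f \<otimes> r) \<and> (\<forall>x\<in>F. (\<forall>h\<in>H. h x = 0) \<longrightarrow> x = \<one>)"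
  using assms
proof (induction S)
  case empty
  have g: "generate G {} = {\<one>}" by (rule generate_empty)
  show ?case
    unfolding g using generate_is_subgroup[of "{}"]
    by (intro exI[of _ "{}"] exI[of _ "{\<one>}"]) (simp add: g)
next
  case (insert s S)
  let ?B = "generate G S" and ?B' = "generate G (insert s S)"
  have s: "s \<in> carrier G" and S: "S \<subseteq> carrier G" using insert.prems by auto
  obtain H F R where H1: "finite H" "\<forall>h\<in>H. \<forall>x\<in>?B. \<forall>y\<in>?B. h (x \<otimes> y) = (h x + h y :: int)"
    and F: "subgroup F G" "F \<subseteq> ?B" and R1: "finite R" "R \<subseteq> ?B" "\<forall>x\<in>?B. \<exists>f\<in>F. \<exists>r\<in>R. x = f \<otimes> r"
    and triv1: "\<forall>x\<in>F. (\<forall>h\<in>H. h x = 0) \<longrightarrow> x = \<one>"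
    using insert.IH[OF S] by (elim exE conjE)
  note H = H1(1) H1(2)[rule_format] and R = R1(1,2) bspec[OF R1(3)]
    and triv = bspec[OF triv1, THEN mp]
  have B: "subgroup ?B G" and B': "subgroup ?B' G"
    using generate_is_subgroup S insert.prems by auto
  have BB': "?B \<subseteq> ?B'" by (rule mono_generate) blast
  have sB': "s [^] k \<in> ?B'" for k :: int
    by (rule subgroup_int_pow_closed[OF B']) (simp add: generate.incl)
  have Bc: "x \<in> carrier G" if "x \<in> ?B" for x using generate_in_carrier[OF S that] .
  have Fc: "x \<in> carrier G" if "x \<in> F" for x using subgroup.mem_carrier[OF F(1) that] .
  have sc: "s [^] k \<in> carrier G" for k :: int using s by simp
  show ?case
  proof (cases "\<exists>n::nat. 0 < n \<and> s [^] n \<in> ?B")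
    case True
    then obtain n :: nat where n: "0 < n" "s [^] n \<in> ?B" by blast
    have decomp: "\<exists>c\<in>?B. \<exists>j<n. x = c \<otimes> s [^] j" if x: "x \<in> ?B'" for x
    proof -
      obtain b k where bk: "b \<in> ?B" "x = b \<otimes> s [^] (k::int)"
        using generate_insert_eq[OF S s x] by blast
      have "s [^] k = s [^] (int n * (k div int n) + k mod int n)" by simp
      also have "\<dots> = s [^] (int n * (k div int n)) \<otimes> s [^] (k mod int n)"
        using s by (rule int_pow_mult)
      also have "s [^] (int n * (k div int n)) = (s [^] n) [^] (k div int n)"
        using int_pow_pow[OF s, of "int n" "k div int n"] int_pow_int[of G s n] by simp
      finally have "x = (b \<otimes> (s [^] n) [^] (k div int n)) \<otimes> s [^] (k mod int n)"
        using bk s Bc[OF bk(1)] by (simp add: m_assoc)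
      moreover have "s [^] (k mod int n) = s [^] nat (k mod int n)"
        using n(1) int_pow_int[of G s "nat (k mod int n)"] by simp
      moreover have "nat (k mod int n) < n"
        using n(1) by (simp add: nat_less_iff)
      moreover have "b \<otimes> (s [^] n) [^] (k div int n) \<in> ?B"
        by (intro subgroup.m_closed[OF B] bk subgroup_int_pow_closed[OF B] n)
      ultimately show ?thesis by metis
    qed
    have pow_B: "x [^] n \<in> ?B" if x: "x \<in> ?B'" for x
    proof -
      obtain b k where bk: "b \<in> ?B" "x = b \<otimes> s [^] (k::nat)"
        using decomp[OF x] by blast
      have "x [^] n = b [^] n \<otimes> (s [^] k) [^] n"
        unfolding bk(2) using Bc[OF bk(1)] s by (simp add: nat_pow_distrib)
      also have "(s [^] k) [^] n = (s [^] n) [^] k"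
        using s by (simp add: nat_pow_pow mult.commute)
      finally show ?thesis
        using subgroup.m_closed[OF B subgroup_nat_pow_closed[OF B bk(1)] subgroup_nat_pow_closed[OF B n(2)]]
        by simp
    qed
    let ?R = "(\<lambda>(r, j). r \<otimes> s [^] j) ` (R \<times> {..<n})"
    have "h ((x \<otimes> y) [^] n) = h (x [^] n) + h (y [^] n)" if "h \<in> H" "x \<in> ?B'" "y \<in> ?B'" for h x y
    proof -
      have "x \<in> carrier G" "y \<in> carrier G"
        using that subgroup.mem_carrier[OF B'] by auto
      then show ?thesis
        using H(2)[OF that(1) pow_B[OF that(2)] pow_B[OF that(3)]] by (simp add: nat_pow_distrib)
    qed
    moreover have "\<exists>f\<in>F. \<exists>r\<in>?R. x = f \<otimes> r" if x: "x \<in> ?B'" for x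
    proof -
      obtain b j where bj: "b \<in> ?B" "j < n" "x = b \<otimes> s [^] j"
        using decomp[OF x] by blast
      obtain f r where fr: "f \<in> F" "r \<in> R" "b = f \<otimes> r" using R(3)[OF bj(1)] by blast
      have "x = f \<otimes> (r \<otimes> s [^] j)"
        using bj(3) fr Fc[OF fr(1)] R(2) Bc[of r] s by (auto simp: m_assoc)
      moreover have "r \<otimes> s [^] j \<in> ?R" using fr(2) bj(2) by force
      ultimately show ?thesis using fr(1) by blast
    qed
    \<comment> \<open>On \<open>F\<close> the new homomorphism \<open>x \<mapsto> h (x ^ n)\<close>
      equals \<open>n * h x\<close>, so it vanishes only where \<open>h\<close> does.\<close>
    moreover have "x = \<one>" if x: "x \<in> F" and h0: "\<forall>h\<in>H. h (x [^] n) = 0" for x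
    proof (rule triv[OF x], rule ballI)
      fix h assume h: "h \<in> H"
      have xB: "x \<in> ?B" using x F(2) by blast
      have "h (x [^] Suc m) = int (Suc m) * h x" for m :: nat
      proof (induction m)
        case 0
        then show ?case using Bc[OF xB] by simp
      next
        case (Suc m)
        have "h (x [^] Suc (Suc m)) = h (x [^] Suc m) + h x"
          using H(2)[OF h subgroup_nat_pow_closed[OF B xB, of "Suc m"] xB] by simp
        then show ?case
          using Suc by (simp add: algebra_simps)
      qed
      from this[of "n - 1"] have "int n * h x = 0"
        using h0 h n(1) by (metis Suc_pred')
      then show "h x = 0"
        using n(1) by simp
    qed
    moreover have "?R \<subseteq> ?B'"
    proof clarify
      fix r j assume "r \<in> R" "j < n"
      then show "r \<otimes> s [^] (j::nat) \<in> ?B'"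
        using subgroup.m_closed[OF B' _ sB'[of "int j"], of r] R(2) BB' by (auto simp: int_pow_int)
    qed
    ultimately show ?thesis
      using H(1) F BB' R(1)
      by (intro exI[of _ "(\<lambda>h x. h (x [^] n)) ` H"] exI[of _ F] exI[of _ ?R]) auto
  next
    case False
    \<comment> \<open>Here \<open>s\<close> has infinite order modulo \<open>?B\<close>, so the
      enlarged group is the direct product of \<open>?B\<close> and the powers of \<open>s\<close>.
      The old homomorphisms extend along the projection \<open>\<beta>\<close>, the exponent
      \<open>\<kappa>\<close> is a new one, and \<open>F\<close> absorbs the powers of
      \<open>s\<close> so that \<open>R\<close> can stay the same.\<close>
    have zero: "k = 0" if "s [^] k \<in> ?B" for k :: int
    proof (rule ccontr)
      assume "k \<noteq> 0"
      have "s [^] int (nat \<bar>k\<bar>) \<in> ?B"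
        using that subgroup.m_inv_closed[OF B that] s by (cases "k \<ge> 0") (simp_all add: int_pow_neg)
      then show False
        using False \<open>k \<noteq> 0\<close> unfolding int_pow_int by (metis zero_less_abs_iff zero_less_nat_eq)
    qed
    have uniq: "k = l \<and> b = c" if b: "b \<in> ?B" and c: "c \<in> ?B" and eq: "b \<otimes> s [^] k = c \<otimes> s [^] l" for b c and k l :: int
    proof -
      have "inv c \<otimes> b = inv c \<otimes> (b \<otimes> s [^] k) \<otimes> inv (s [^] k)"
        using Bc[OF b] Bc[OF c] s by (simp add: m_assoc)
      also have "\<dots> = s [^] l \<otimes> inv (s [^] k)"
        unfolding eq using Bc[OF c] s by (simp add: m_assoc)
      also have "\<dots> = s [^] (l - k)"
        using s by (simp add: int_pow_diff)
      finally have "s [^] (l - k) \<in> ?B"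
        using subgroup.m_closed[OF B subgroup.m_inv_closed[OF B c] b] by simp
      then have "k = l" using zero by fastforce
      then show ?thesis using eq Bc[OF b] Bc[OF c] s by simp
    qed
    have "\<forall>x. \<exists>b k. x \<in> ?B' \<longrightarrow> b \<in> ?B \<and> x = b \<otimes> s [^] (k::int)"
      using generate_insert_eq[OF S s] by blast
    then obtain \<beta> \<kappa> where bk: "\<And>x. x \<in> ?B' \<Longrightarrow> \<beta> x \<in> ?B" "\<And>x. x \<in> ?B' \<Longrightarrow> x = \<beta> x \<otimes> s [^] (\<kappa> x :: int)"
      by metis
    have bk_eq: "\<beta> (b \<otimes> s [^] k) = b" "\<kappa> (b \<otimes> s [^] k) = k" if b: "b \<in> ?B" for b and k :: int
    proof -
      have "b \<otimes> s [^] k \<in> ?B'"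
        using b BB' sB' by (intro subgroup.m_closed[OF B']) auto
      from uniq[OF bk(1)[OF this] b bk(2)[OF this, symmetric]]
      show "\<beta> (b \<otimes> s [^] k) = b" "\<kappa> (b \<otimes> s [^] k) = k" by auto
    qed
    have mult_eq: "(b \<otimes> s [^] k) \<otimes> (c \<otimes> s [^] l) = (b \<otimes> c) \<otimes> s [^] (k + l)"
      if "b \<in> carrier G" "c \<in> carrier G" for b c and k l :: int
      using that s by (simp add: int_pow_mult m_assoc m_lcomm[of "s [^] k" c])
    have bk_mult: "\<beta> (x \<otimes> y) = \<beta> x \<otimes> \<beta> y" "\<kappa> (x \<otimes> y) = \<kappa> x + \<kappa> y" if "x \<in> ?B'" "y \<in> ?B'" for x y
    proof -
      have b: "\<beta> x \<in> ?B" "\<beta> y \<in> ?B" using bk(1) that by auto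
      have "x \<otimes> y = (\<beta> x \<otimes> \<beta> y) \<otimes> s [^] (\<kappa> x + \<kappa> y)"
        using mult_eq[OF Bc[OF b(1)] Bc[OF b(2)], of "\<kappa> x" "\<kappa> y"] bk(2) that by simp
      then show "\<beta> (x \<otimes> y) = \<beta> x \<otimes> \<beta> y" "\<kappa> (x \<otimes> y) = \<kappa> x + \<kappa> y"
        using bk_eq[OF subgroup.m_closed[OF B b]] by simp_all
    qed
    define F' where "F' = (\<lambda>(f, k). f \<otimes> s [^] (k::int)) ` (F \<times> UNIV)"
    have F'_iff: "x \<in> F' \<longleftrightarrow> (\<exists>f\<in>F. \<exists>k::int. x = f \<otimes> s [^] k)" for x
      by (auto simp: F'_def)
    have F'_sub: "subgroup F' G"
    proof (rule subgroupI)
      show "F' \<subseteq> carrier G"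
        using Fc sc by (auto simp: F'_iff)
      show "F' \<noteq> {}"
        using subgroup.one_closed[OF F(1)] by (auto simp: F'_def)
    next
      fix x assume "x \<in> F'"
      then obtain f k where "f \<in> F" "x = f \<otimes> s [^] (k::int)" by (auto simp: F'_iff)
      then have "inv x = inv f \<otimes> s [^] (- k)" "inv f \<in> F"
        using s Fc subgroup.m_inv_closed[OF F(1)] by (auto simp: inv_mult int_pow_neg)
      then show "inv x \<in> F'" by (auto simp: F'_iff)
    next
      fix x y assume "x \<in> F'" "y \<in> F'"
      then obtain f g k l where "f \<in> F" "x = f \<otimes> s [^] (k::int)" "g \<in> F" "y = g \<otimes> s [^] (l::int)"
        by (auto simp: F'_iff)
      then show "x \<otimes> y \<in> F'"
        using mult_eq[OF Fc Fc] subgroup.m_closed[OF F(1)] by (auto simp: F'_iff)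
    qed
    have "F' \<subseteq> ?B'"
    proof
      fix x assume "x \<in> F'"
      then obtain f k where "f \<in> F" "x = f \<otimes> s [^] (k::int)" by (auto simp: F'_iff)
      then show "x \<in> ?B'"
        using subgroup.m_closed[OF B' _ sB'] F(2) BB' by blast
    qed
    moreover have "\<exists>f\<in>F'. \<exists>r\<in>R. x = f \<otimes> r" if x: "x \<in> ?B'" for x
    proof -
      obtain f r where fr: "f \<in> F" "r \<in> R" "\<beta> x = f \<otimes> r" using R(3)[OF bk(1)[OF x]] by blast
      have rc: "r \<in> carrier G" using fr(2) R(2) Bc by blast
      have "x = f \<otimes> r \<otimes> s [^] \<kappa> x"
        using bk(2)[OF x] fr(3) by simp
      also have "\<dots> = (f \<otimes> s [^] \<kappa> x) \<otimes> r"
        using rc Fc[OF fr(1)] s by (simp add: m_assoc m_comm[of r])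
      finally have "x = (f \<otimes> s [^] \<kappa> x) \<otimes> r" .
      moreover have "f \<otimes> s [^] \<kappa> x \<in> F'" using fr(1) by (auto simp: F'_iff)
      ultimately show ?thesis using fr(2) by blast
    qed
    moreover have "x = \<one>" if x: "x \<in> F'" and "\<kappa> x = 0" and h0: "\<forall>h\<in>H. h (\<beta> x) = 0" for x
    proof -
      obtain f k where fk: "f \<in> F" "x = f \<otimes> s [^] (k::int)" using x by (auto simp: F'_iff)
      have "\<beta> x = f" "\<kappa> x = k" using bk_eq[of f k] fk F(2) by auto
      then have "f = \<one>" "k = 0"
        using triv[OF fk(1)] h0 \<open>\<kappa> x = 0\<close> by auto
      then show ?thesis using fk by simp
    qed
    ultimately show ?thesis
      using H F'_sub R(1,2) BB' bk_mult bk(1)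
      by (intro exI[of _ "insert \<kappa> ((\<lambda>h x. h (\<beta> x)) ` H)"] exI[of _ F'] exI[of _ R]) auto
  qed
qed

lemma (in comm_group) separating_homs:
  assumes "finitely_generated G"
  obtains H F R where "finite H" "\<And>h x y. h \<in> H \<Longrightarrow> x \<in> carrier G \<Longrightarrow> y \<in> carrier G \<Longrightarrow> h (x \<otimes> y) = (h x + h y :: int)"
    "subgroup F G" "finite R" "R \<subseteq> carrier G" "\<And>x. x \<in> carrier G \<Longrightarrow> \<exists>f\<in>F. \<exists>r\<in>R. x = f \<otimes> r"
    "\<And>x. x \<in> F \<Longrightarrow> \<forall>h\<in>H. h x = 0 \<Longrightarrow> x = \<one>"
proof -
  obtain S where S: "finite S" "S \<subseteq> carrier G" "generate G S = carrier G"
    using assms by (auto simp: finitely_generated_def)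
  obtain H F R where 1: "finite H" "\<forall>h\<in>H. \<forall>x\<in>carrier G. \<forall>y\<in>carrier G. h (x \<otimes> y) = (h x + h y :: int)"
    "subgroup F G" "F \<subseteq> carrier G" "finite R" "R \<subseteq> carrier G"
    "\<forall>x\<in>carrier G. \<exists>f\<in>F. \<exists>r\<in>R. x = f \<otimes> r" "\<forall>x\<in>F. (\<forall>h\<in>H. h x = 0) \<longrightarrow> x = \<one>"
    using separating_homs_generate[OF S(1,2)] unfolding S(3) by (elim exE conjE)
  show ?thesis
    by (rule that[OF 1(1) _ 1(3,5,6) bspec[OF 1(7)]]) (use 1(2) 1(8)[THEN bspec, THEN mp] in simp_all)
qed

text \<open>On a torsion group every homomorphism to \<int> vanishes, so \<open>F\<close> is trivial
  and the finite set \<open>R\<close> is the whole group.\<close>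

lemma (in comm_group) infinite_imp_infinite_order:
  assumes "finitely_generated G" "infinite (carrier G)"
  shows "\<exists>t\<in>carrier G. ord t = 0"
proof (rule ccontr)
  assume "\<not> ?thesis"
  then have tor: "\<exists>n::nat. 0 < n \<and> x [^] n = \<one>" if "x \<in> carrier G" for x
    using that by (metis neq0_conv ord_eq_0)
  obtain H F R where H: "finite H" "\<And>h x y. h \<in> H \<Longrightarrow> x \<in> carrier G \<Longrightarrow> y \<in> carrier G \<Longrightarrow> h (x \<otimes> y) = (h x + h y :: int)"
    and F: "subgroup F G" and R: "finite R" "R \<subseteq> carrier G" "\<And>x. x \<in> carrier G \<Longrightarrow> \<exists>f\<in>F. \<exists>r\<in>R. x = f \<otimes> r"
    and triv: "\<And>x. x \<in> F \<Longrightarrow> \<forall>h\<in>H. h x = 0 \<Longrightarrow> x = \<one>"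
    by (rule separating_homs[OF assms(1)]) (rule that)
  have "h x = 0" if h: "h \<in> H" and x: "x \<in> carrier G" for h x
  proof -
    have one: "h \<one> = 0" using H(2)[OF h, of \<one> \<one>] by simp
    have "h (x [^] m) = int m * h x" for m :: nat
    proof (induction m)
      case (Suc m)
      then show ?case using H(2)[OF h, of "x [^] m" x] x by (simp add: algebra_simps)
    qed (use one in simp)
    then show ?thesis using tor[OF x] one by (metis mult_eq_0_iff neq0_conv of_nat_0_eq_iff)
  qed
  then have "F \<subseteq> {\<one>}"
    using triv subgroup.mem_carrier[OF F] by blast
  then have "carrier G \<subseteq> R"
    using R(2,3) by fastforce
  then show False
    using assms(2) R(1) finite_subset by blast
qed

section \<open>Faithful actions that are one-dimensional from afar\<close>

text \<open>Each class of \<open>\<kappa>\<close> resembles a subset of a line with height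
  \<open>\<eta>\<close>: a group element changes heights by a bounded amount, and finitely many
  elements, the same for all classes, join points of similar height. This uniformity later bounds
  fibres and diameters; countability allows the model to live on natural numbers.\<close>

locale line_action = group A for A (structure) +
  fixes P :: "'p set" and \<alpha> :: "'a \<Rightarrow> 'p \<Rightarrow> 'p" and \<kappa> :: "'p \<Rightarrow> 'k" and \<eta> :: "'p \<Rightarrow> int"
  assumes P_ne: "P \<noteq> {}" and P_countable: "countable P"
    and \<alpha>_closed: "\<And>a p. a \<in> carrier A \<Longrightarrow> p \<in> P \<Longrightarrow> \<alpha> a p \<in> P"
    and \<alpha>_mult: "\<And>a b p. a \<in> carrier A \<Longrightarrow> b \<in> carrier A \<Longrightarrow> p \<in> P \<Longrightarrow> \<alpha> (a \<otimes> b) p = \<alpha> a (\<alpha> b p)"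
    and \<alpha>_one: "\<And>p. p \<in> P \<Longrightarrow> \<alpha> \<one> p = p"
    and \<alpha>_faithful: "\<And>a. a \<in> carrier A \<Longrightarrow> (\<And>p. p \<in> P \<Longrightarrow> \<alpha> a p = p) \<Longrightarrow> a = \<one>"
    and \<kappa>_inv: "\<And>a p. a \<in> carrier A \<Longrightarrow> p \<in> P \<Longrightarrow> \<kappa> (\<alpha> a p) = \<kappa> p"
    and \<eta>_bounded: "\<And>a. a \<in> carrier A \<Longrightarrow> \<exists>L::nat. \<forall>p\<in>P. \<bar>\<eta> (\<alpha> a p) - \<eta> p\<bar> \<le> int L"
    and finite_transporter: "\<And>r. \<exists>\<Lambda>. finite \<Lambda> \<and> \<Lambda> \<subseteq> carrier A
      \<and> (\<forall>p\<in>P. \<forall>q\<in>P. \<kappa> p = \<kappa> q \<longrightarrow> \<bar>\<eta> p - \<eta> q\<bar> \<le> r \<longrightarrow> (\<exists>a\<in>\<Lambda>. \<alpha> a p = q))"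

text \<open>Fixing the cosets of \<open>F\<close> forces an element into \<open>F\<close>, and
  fixing the point \<open>0\<close> of each orbit of integers makes all homomorphisms in
  \<open>H\<close> vanish on it, which gives faithfulness. The cosets, being finitely many, can
  share one class of height \<open>0\<close>.\<close>

lemma (in comm_group) line_action_exists:
  assumes "finitely_generated G"
  shows "\<exists>P \<alpha> \<kappa> \<eta>. line_action G (P :: ('a set + ('a \<Rightarrow> int) \<times> int) set) \<alpha> (\<kappa> :: _ \<Rightarrow> ('a \<Rightarrow> int) option) \<eta>"
proof -
  obtain H F R where H: "finite H" "\<And>h x y. h \<in> H \<Longrightarrow> x \<in> carrier G \<Longrightarrow> y \<in> carrier G \<Longrightarrow> h (x \<otimes> y) = (h x + h y :: int)"
    and F: "subgroup F G" and R: "finite R" "R \<subseteq> carrier G" "\<And>x. x \<in> carrier G \<Longrightarrow> \<exists>f\<in>F. \<exists>r\<in>R. x = f \<otimes> r"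
    and triv: "\<And>x. x \<in> F \<Longrightarrow> \<forall>h\<in>H. h x = 0 \<Longrightarrow> x = \<one>"
    by (rule separating_homs[OF assms(1)]) (rule that)
  have F_carrier: "F \<subseteq> carrier G" by (rule subgroup.subset[OF F])
  have h_one: "h \<one> = 0" if "h \<in> H" for h
    using H(2)[OF that, of \<one> \<one>] by simp
  have h_inv: "h (inv x) = - h x" if "h \<in> H" "x \<in> carrier G" for h x
    using H(2)[OF that(1), of x "inv x"] that h_one[OF that(1)] by simp
  define P where "P = Inl ` (rcosets F) \<union> Inr ` (SIGMA h:H. h ` carrier G)"
  \<comment> \<open>Right translation of cosets is a left action because the group is
    commutative.\<close>
  define \<alpha> where "\<alpha> a p = (case p of Inl C \<Rightarrow> Inl (C #> a) | Inr (h, m) \<Rightarrow> Inr (h, m + h a))"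
    for a and p :: "'a set + ('a \<Rightarrow> int) \<times> int"
  define \<kappa> where "\<kappa> p = (case p of Inl C \<Rightarrow> None | Inr (h, m) \<Rightarrow> Some h)"
    for p :: "'a set + ('a \<Rightarrow> int) \<times> int"
  define \<eta> where "\<eta> p = (case p of Inl C \<Rightarrow> 0 | Inr (h, m) \<Rightarrow> m)"
    for p :: "'a set + ('a \<Rightarrow> int) \<times> int"
  have P_cases: "(\<exists>x\<in>carrier G. p = Inl (F #> x)) \<or> (\<exists>h\<in>H. \<exists>x\<in>carrier G. p = Inr (h, h x))" if "p \<in> P" for p
    using that by (auto simp: P_def RCOSETS_def)
  have P_Inl: "Inl (F #> x) \<in> P" if "x \<in> carrier G" for x
    using that by (auto simp: P_def RCOSETS_def)
  have P_Inr: "Inr (h, h x) \<in> P" if "h \<in> H" "x \<in> carrier G" for h x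
    using that by (auto simp: P_def)
  have coset_R: "\<exists>r\<in>R. F #> x = F #> r" if x: "x \<in> carrier G" for x
  proof -
    obtain f r where fr: "f \<in> F" "r \<in> R" "x = f \<otimes> r" using R(3)[OF x] by blast
    then have "x \<in> F #> r" by (auto simp: r_coset_def)
    then have "F #> x = F #> r"
      using repr_independence[OF _ _ F, of x r] fr(2) R(2) by blast
    then show ?thesis using fr(2) by blast
  qed
  have \<alpha>_Inl: "\<alpha> a (Inl (F #> x)) = Inl (F #> (x \<otimes> a))" if "a \<in> carrier G" "x \<in> carrier G" for a x
    using that F_carrier by (simp add: \<alpha>_def coset_mult_assoc)
  have \<alpha>_Inr: "\<alpha> a (Inr (h, h x)) = Inr (h, h (x \<otimes> a))" if "h \<in> H" "a \<in> carrier G" "x \<in> carrier G" for a h x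
    using that H(2) by (simp add: \<alpha>_def)
  have "line_action G P \<alpha> \<kappa> \<eta>"
  proof unfold_locales
    show "P \<noteq> {}" using P_Inl[OF one_closed] by blast
    have "rcosets F \<subseteq> (\<lambda>r. F #> r) ` R"
      using coset_R by (auto simp: RCOSETS_def)
    then have "finite (rcosets F)" using R(1) finite_surj by blast
    moreover have "countable (SIGMA h:H. h ` carrier G)"
      by (rule countable_SIGMA[OF countable_finite[OF H(1)] countableI_type])
    ultimately show "countable P"
      unfolding P_def by (simp add: countable_finite)
  next
    fix a p assume a: "a \<in> carrier G" and p: "p \<in> P"
    show "\<alpha> a p \<in> P"
      using P_cases[OF p] a \<alpha>_Inl \<alpha>_Inr P_Inl P_Inr by fastforce
    show "\<kappa> (\<alpha> a p) = \<kappa> p"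
      using P_cases[OF p] by (auto simp: \<alpha>_def \<kappa>_def)
  next
    fix a b p assume ab: "a \<in> carrier G" "b \<in> carrier G" and p: "p \<in> P"
    show "\<alpha> (a \<otimes> b) p = \<alpha> a (\<alpha> b p)"
      using P_cases[OF p]
    proof (elim disjE bexE)
      fix x assume "x \<in> carrier G" "p = Inl (F #> x)"
      then show ?thesis
        using ab by (simp add: \<alpha>_Inl m_assoc m_comm[of a b])
    next
      fix h x assume "h \<in> H" "x \<in> carrier G" "p = Inr (h, h x)"
      then show ?thesis
        using ab by (simp add: \<alpha>_Inr m_assoc m_comm[of a b])
    qed
  next
    fix p assume "p \<in> P"
    then show "\<alpha> \<one> p = p"
      using P_cases by (fastforce simp: \<alpha>_Inl \<alpha>_Inr)
  next
    fix a assume a: "a \<in> carrier G" and fixed: "\<And>p. p \<in> P \<Longrightarrow> \<alpha> a p = p"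
    have "F #> a = F #> \<one>"
      using fixed[OF P_Inl[OF one_closed]] \<alpha>_Inl[OF a one_closed] a by simp
    then have "a \<in> F"
      using rcos_self[OF a F] F_carrier by (simp add: coset_mult_one)
    moreover have "h a = 0" if "h \<in> H" for h
      using fixed[OF P_Inr[OF that one_closed]] \<alpha>_Inr[OF that a one_closed] a h_one[OF that] by simp
    ultimately show "a = \<one>" using triv by blast
  next
    fix a assume a: "a \<in> carrier G"
    have "\<bar>\<eta> (\<alpha> a p) - \<eta> p\<bar> \<le> int (\<Sum>h\<in>H. nat \<bar>h a\<bar>)" if p: "p \<in> P" for p
    proof (cases p)
      case (Inl C)
      then show ?thesis by (simp add: \<eta>_def \<alpha>_def sum_nonneg)
    next
      case (Inr hm)
      then obtain h m where hm: "p = Inr (h, m)" by (cases hm) auto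
      then have "h \<in> H" using p by (auto simp: P_def)
      then have "\<bar>h a\<bar> \<le> (\<Sum>h\<in>H. \<bar>h a\<bar>)"
        using H(1) by (intro member_le_sum) auto
      then show ?thesis
        by (simp add: hm \<eta>_def \<alpha>_def)
    qed
    then show "\<exists>L::nat. \<forall>p\<in>P. \<bar>\<eta> (\<alpha> a p) - \<eta> p\<bar> \<le> int L" by blast
  next
    fix r :: int
    \<comment> \<open>Selects a group element with a prescribed value under \<open>h\<close>; the
      default \<open>\<one>\<close> keeps \<open>c\<close> inside the carrier for values that are
      not attained.\<close>
    define c where "c = (\<lambda>(h :: 'a \<Rightarrow> int, m). if \<exists>a\<in>carrier G. h a = m then SOME a. a \<in> carrier G \<and> h a = m else \<one>)"
    have c: "c (h, h a) \<in> carrier G \<and> h (c (h, h a)) = h a" if "a \<in> carrier G" for h :: "'a \<Rightarrow> int" and a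
    proof -
      have "\<exists>b. b \<in> carrier G \<and> h b = h a" using that by blast
      from someI_ex[OF this] show ?thesis using that by (auto simp: c_def)
    qed
    have c_closed: "c hm \<in> carrier G" for hm
    proof (cases hm)
      case (Pair h m)
      show ?thesis
      proof (cases "\<exists>a\<in>carrier G. h a = m")
        case True
        then show ?thesis using c[of _ h] Pair by blast
      next
        case False
        then show ?thesis by (simp add: c_def Pair)
      qed
    qed
    define \<Lambda> where "\<Lambda> = (\<lambda>(x, y). inv x \<otimes> y) ` (R \<times> R) \<union> c ` (H \<times> {-r..r})"
    have "\<exists>a\<in>\<Lambda>. \<alpha> a p = q" if pq: "p \<in> P" "q \<in> P" "\<kappa> p = \<kappa> q" "\<bar>\<eta> p - \<eta> q\<bar> \<le> r" for p q
      using P_cases[OF pq(1)]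
    proof (elim disjE bexE)
      fix x assume x: "x \<in> carrier G" "p = Inl (F #> x)"
      then obtain y where y: "y \<in> carrier G" "q = Inl (F #> y)"
        using P_cases[OF pq(2)] pq(3) by (auto simp: \<kappa>_def)
      obtain x' y' where xy: "x' \<in> R" "F #> x = F #> x'" "y' \<in> R" "F #> y = F #> y'"
        using coset_R x(1) y(1) by metis
      have c: "x' \<in> carrier G" "y' \<in> carrier G" using xy R(2) by auto
      then have "\<alpha> (inv x' \<otimes> y') p = q"
        unfolding x(2) y(2) xy(2,4) by (subst \<alpha>_Inl) simp_all
      moreover have "inv x' \<otimes> y' \<in> \<Lambda>" using xy by (force simp: \<Lambda>_def)
      ultimately show ?thesis by blast
    next
      fix h x assume h: "h \<in> H" and x: "x \<in> carrier G" "p = Inr (h, h x)"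
      then obtain y where y: "y \<in> carrier G" "q = Inr (h, h y)"
        using P_cases[OF pq(2)] pq(3) by (auto simp: \<kappa>_def)
      define z where "z = inv x \<otimes> y"
      have z: "z \<in> carrier G" "h z = h y - h x"
        using x y h H(2)[OF h, of "inv x" y] by (simp_all add: z_def h_inv)
      have "h z \<in> {-r..r}"
        using z(2) pq(4) x(2) y(2) by (simp add: \<eta>_def abs_le_iff)
      then have "c (h, h z) \<in> \<Lambda>"
        using h unfolding \<Lambda>_def by blast
      moreover have "\<alpha> (c (h, h z)) p = q"
        using c[OF z(1), of h] z(2) by (simp add: \<alpha>_def x(2) y(2))
      ultimately show ?thesis by blast
    qed
    moreover have "finite \<Lambda>" using R(1) H(1) by (simp add: \<Lambda>_def)
    moreover have "\<Lambda> \<subseteq> carrier G" using R(2) c_closed by (auto simp: \<Lambda>_def)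
    ultimately show "\<exists>\<Lambda>. finite \<Lambda> \<and> \<Lambda> \<subseteq> carrier G
      \<and> (\<forall>p\<in>P. \<forall>q\<in>P. \<kappa> p = \<kappa> q \<longrightarrow> \<bar>\<eta> p - \<eta> q\<bar> \<le> r \<longrightarrow> (\<exists>a\<in>\<Lambda>. \<alpha> a p = q))"
      by (intro exI[of _ \<Lambda>]) simp
  qed
  then show ?thesis by blast
qed

section \<open>An action with minimal growth and dimension\<close>

text \<open>The bijection \<open>pos\<close> separates the action from the type of its points, so
  that a set of natural numbers can carry it.\<close>

locale lamplighter_model = lamplighter A d + line_action A P \<alpha> \<kappa> \<eta>
  for A (structure) and d and P :: "'p set" and \<alpha> and \<kappa> :: "'p \<Rightarrow> 'k" and \<eta> +
  fixes Y :: "'y set" and pos :: "'y \<Rightarrow> 'p \<times> (nat \<Rightarrow> int)"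
  assumes pos: "bij_betw pos Y (P \<times> carrier (int_power_group d))"
begin

abbreviation "Zd \<equiv> int_power_group d"
abbreviation "lamp y \<equiv> fst (pos y)"
abbreviation "site y \<equiv> snd (pos y)"

text \<open>The lamp function is evaluated at the site reached after the translation. With this
  order the shift in the wreath multiplication cancels and products act as composites.\<close>

definition move :: "((nat \<Rightarrow> int) \<Rightarrow> 'a) \<times> (nat \<Rightarrow> int) \<Rightarrow> 'y \<Rightarrow> 'y"
  where "move g y = inv_into Y pos (\<alpha> (fst g (snd g \<otimes>\<^bsub>Zd\<^esub> site y)) (lamp y), snd g \<otimes>\<^bsub>Zd\<^esub> site y)"

definition act :: "((nat \<Rightarrow> int) \<Rightarrow> 'a) \<times> (nat \<Rightarrow> int) \<Rightarrow> 'y \<Rightarrow> 'y"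
  where "act g = (\<lambda>y\<in>Y. move g y)"

lemma pos_inj: "y \<in> Y \<Longrightarrow> y' \<in> Y \<Longrightarrow> pos y = pos y' \<Longrightarrow> y = y'"
  using pos by (auto simp: bij_betw_def inj_on_def)

lemma lamp_P [simp]: "y \<in> Y \<Longrightarrow> lamp y \<in> P"
  using bij_betwE[OF pos] by (metis mem_Times_iff)

lemma site_Zd: "y \<in> Y \<Longrightarrow> site y \<in> carrier Zd"
  using bij_betwE[OF pos] by (metis mem_Times_iff)

lemma pos_surj:
  assumes "p \<in> P" "c \<in> carrier Zd"
  shows "\<exists>y\<in>Y. lamp y = p \<and> site y = c"
proof -
  have "(p, c) \<in> pos ` Y"
    using assms pos by (simp add: bij_betw_def)
  then show ?thesis by (metis fst_conv imageE snd_conv)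
qed

lemma W_D:
  assumes "g \<in> carrier W"
  shows "fst g \<in> F" "snd g \<in> carrier Zd"
  using assms by (auto simp: W_carrier simp del: carrier_int_power)

lemma fst_closed:
  assumes "g \<in> carrier W" "x \<in> carrier Zd"
  shows "fst g x \<in> carrier A"
  by (rule F_closed[OF W_D(1)[OF assms(1)] assms(2)])

lemma move_closed_pos:
  assumes g: "g \<in> carrier W" and y: "y \<in> Y"
  shows "move g y \<in> Y \<and> pos (move g y) = (\<alpha> (fst g (snd g \<otimes>\<^bsub>Zd\<^esub> site y)) (lamp y), snd g \<otimes>\<^bsub>Zd\<^esub> site y)"
proof -
  have c: "snd g \<otimes>\<^bsub>Zd\<^esub> site y \<in> carrier Zd"
    by (rule B.m_closed[OF W_D(2)[OF g] site_Zd[OF y]])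
  have "\<alpha> (fst g (snd g \<otimes>\<^bsub>Zd\<^esub> site y)) (lamp y) \<in> P"
    by (rule \<alpha>_closed[OF fst_closed[OF g c] lamp_P[OF y]])
  then have "(\<alpha> (fst g (snd g \<otimes>\<^bsub>Zd\<^esub> site y)) (lamp y), snd g \<otimes>\<^bsub>Zd\<^esub> site y) \<in> pos ` Y"
    using c pos unfolding bij_betw_def by blast
  then show ?thesis
    unfolding move_def by (simp add: inv_into_into f_inv_into_f)
qed

lemma lamp_move: "g \<in> carrier W \<Longrightarrow> y \<in> Y \<Longrightarrow> lamp (move g y) = \<alpha> (fst g (snd g \<otimes>\<^bsub>Zd\<^esub> site y)) (lamp y)"
  and site_move: "g \<in> carrier W \<Longrightarrow> y \<in> Y \<Longrightarrow> site (move g y) = snd g \<otimes>\<^bsub>Zd\<^esub> site y"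
  and move_closed: "g \<in> carrier W \<Longrightarrow> y \<in> Y \<Longrightarrow> move g y \<in> Y"
  using move_closed_pos by simp_all

lemma move_mult:
  assumes g: "g \<in> carrier W" and h: "h \<in> carrier W" and y: "y \<in> Y"
  shows "move (g \<otimes>\<^bsub>W\<^esub> h) y = move g (move h y)"
proof (rule pos_inj)
  show "move (g \<otimes>\<^bsub>W\<^esub> h) y \<in> Y" "move g (move h y) \<in> Y"
    using assms move_closed by simp_all
  let ?b = "snd g" and ?c = "snd h" and ?x = "site y"
  have b: "?b \<in> carrier Zd" and c: "?c \<in> carrier Zd" and x: "?x \<in> carrier Zd"
    using W_D(2) g h site_Zd[OF y] by blast+
  have z: "?b \<otimes>\<^bsub>Zd\<^esub> (?c \<otimes>\<^bsub>Zd\<^esub> ?x) \<in> carrier Zd" "?c \<otimes>\<^bsub>Zd\<^esub> ?x \<in> carrier Zd"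
    using b c x by (blast intro: B.m_closed)+
  have "fst (g \<otimes>\<^bsub>W\<^esub> h) (?b \<otimes>\<^bsub>Zd\<^esub> (?c \<otimes>\<^bsub>Zd\<^esub> ?x))
    = fst g (?b \<otimes>\<^bsub>Zd\<^esub> (?c \<otimes>\<^bsub>Zd\<^esub> ?x)) \<otimes> fst h (?c \<otimes>\<^bsub>Zd\<^esub> ?x)"
  proof -
    have "g \<otimes>\<^bsub>W\<^esub> h = (\<lambda>x\<in>carrier Zd. fst g x \<otimes> wreath_shift Zd ?b (fst h) x, ?b \<otimes>\<^bsub>Zd\<^esub> ?c)"
      using W_mult[of "fst g" "snd g" "fst h" "snd h"] by simp
    then show ?thesis
      using z shift_apply[OF z(1), of ?b "fst h"] B.cancel_inv(1)[OF b z(2)]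
      by (simp del: carrier_int_power)
  qed
  moreover have "snd (g \<otimes>\<^bsub>W\<^esub> h) \<otimes>\<^bsub>Zd\<^esub> ?x = ?b \<otimes>\<^bsub>Zd\<^esub> (?c \<otimes>\<^bsub>Zd\<^esub> ?x)"
    using snd.hom_mult[OF g h] B.m_assoc[OF b c x] by simp
  ultimately show "pos (move (g \<otimes>\<^bsub>W\<^esub> h) y) = pos (move g (move h y))"
    using g h y move_closed[OF h y] \<alpha>_mult[OF fst_closed[OF g z(1)] fst_closed[OF h z(2)] lamp_P[OF y]]
    by (simp add: move_closed_pos)
qed

lemma move_one: "y \<in> Y \<Longrightarrow> move \<one>\<^bsub>W\<^esub> y = y"
proof (rule pos_inj)
  assume y: "y \<in> Y"
  show "pos (move \<one>\<^bsub>W\<^esub> y) = pos y"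
    using move_closed_pos[OF W.one_closed y] site_Zd[OF y] \<alpha>_one[OF lamp_P[OF y]]
    by (simp add: W_one B.l_one del: carrier_int_power one_int_power)
qed (simp_all add: move_closed)

lemma act_faithful: "faithful_G_set W Y act"
proof -
  have ga: "group_action W Y act"
    unfolding act_def
    by (rule group_actionI[OF W.is_group]) (use move_closed move_mult move_one in auto)
  have "inj_on act (carrier W)"
  proof (rule inj_onI)
    fix g h assume g: "g \<in> carrier W" and h: "h \<in> carrier W" and eq: "act g = act h"
    have move_eq: "move g y = move h y" if "y \<in> Y" for y
      using fun_cong[OF eq, of y] that by (simp add: act_def)
    obtain p0 where p0: "p0 \<in> P" using P_ne by blast
    obtain y0 where y0: "y0 \<in> Y" "lamp y0 = p0" "site y0 = \<one>\<^bsub>Zd\<^esub>"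
      using pos_surj[OF p0 B.one_closed] by blast
    have snd_eq: "snd g = snd h"
      using move_eq[OF y0(1)] site_move[OF g y0(1)] site_move[OF h y0(1)] y0(3)
        B.r_one[OF W_D(2)[OF g]] B.r_one[OF W_D(2)[OF h]] by simp
    have "fst g x = fst h x" if x: "x \<in> carrier Zd" for x
    proof -
      have gx: "fst g x \<in> carrier A" and hx: "fst h x \<in> carrier A"
        using fst_closed g h x by blast+
      have "\<alpha> (inv (fst g x) \<otimes> fst h x) p = p" if p: "p \<in> P" for p
      proof -
        have ic: "inv\<^bsub>Zd\<^esub> (snd g) \<otimes>\<^bsub>Zd\<^esub> x \<in> carrier Zd"
          by (rule B.m_closed[OF B.inv_closed[OF W_D(2)[OF g]] x])
        obtain y where y: "y \<in> Y" "lamp y = p" "site y = inv\<^bsub>Zd\<^esub> (snd g) \<otimes>\<^bsub>Zd\<^esub> x"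
          using pos_surj[OF p ic] by blast
        have "snd g \<otimes>\<^bsub>Zd\<^esub> site y = x"
          unfolding y(3) by (rule B.cancel_inv(2)[OF W_D(2)[OF g] x])
        then have "\<alpha> (fst g x) p = \<alpha> (fst h x) p"
          using move_eq[OF y(1)] lamp_move[OF g y(1)] lamp_move[OF h y(1)] y(2) snd_eq by simp
        then have "\<alpha> (inv (fst g x) \<otimes> fst h x) p = \<alpha> (inv (fst g x) \<otimes> fst g x) p"
          using \<alpha>_mult[OF A.inv_closed[OF gx] hx p] \<alpha>_mult[OF A.inv_closed[OF gx] gx p] by (simp del: A.l_inv)
        then show ?thesis using gx p \<alpha>_one by simp
      qed
      then have "inv (fst g x) \<otimes> fst h x = \<one>"
        using gx hx by (intro \<alpha>_faithful) auto
      then show ?thesis using gx hx by (simp add: A.inv_solve_left')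
    qed
    then have "fst g = fst h"
      by (rule F_ext[OF W_D(1)[OF g] W_D(1)[OF h]])
    then show "g = h" using snd_eq by (rule prod_eqI)
  qed
  moreover obtain p0 where p0: "p0 \<in> P" using P_ne by blast
  then have "Y \<noteq> {}"
    using pos_surj[OF p0 B.one_closed] by blast
  ultimately show ?thesis
    using ga by (simp add: faithful_G_set_def faithful_action_def faithful_action_axioms_def)
qed

text \<open>The last clause expresses the finite support of the lamp function of \<open>g\<close>:
  arriving far from the origin leaves the lamp alone. It refers to the target site, where the
  function is evaluated.\<close>

definition displacement_bound :: "nat \<Rightarrow> ((nat \<Rightarrow> int) \<Rightarrow> 'a) \<times> (nat \<Rightarrow> int) \<Rightarrow> bool"
  where "displacement_bound L g \<longleftrightarrow> (\<forall>y\<in>Y. \<bar>\<eta> (lamp (move g y)) - \<eta> (lamp y)\<bar> \<le> int L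
    \<and> (\<forall>i<d. \<bar>site (move g y) i - site y i\<bar> \<le> int L)
    \<and> ((\<exists>i<d. \<bar>site (move g y) i\<bar> > int L) \<longrightarrow> lamp (move g y) = lamp y))"

lemma displacement_bound_mono: "displacement_bound L g \<Longrightarrow> L \<le> L' \<Longrightarrow> displacement_bound L' g"
  unfolding displacement_bound_def by (meson of_nat_le_iff order_le_less_trans order_trans)

lemma displacement_bound_exists:
  assumes g: "g \<in> carrier W"
  shows "\<exists>L. displacement_bound L g"
proof -
  define X where "X = {x \<in> carrier Zd. fst g x \<noteq> \<one>}"
  have X: "finite X"
    using W_D(1)[OF g] unfolding F_eq X_def by blast
  have "\<forall>x\<in>X. \<exists>L::nat. \<forall>p\<in>P. \<bar>\<eta> (\<alpha> (fst g x) p) - \<eta> p\<bar> \<le> int L"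
    using \<eta>_bounded fst_closed[OF g] by (simp add: X_def del: carrier_int_power)
  then obtain l where l: "\<And>x p. x \<in> X \<Longrightarrow> p \<in> P \<Longrightarrow> \<bar>\<eta> (\<alpha> (fst g x) p) - \<eta> p\<bar> \<le> int (l x)"
    by metis
  \<comment> \<open>The three sums bound the height change over the support \<open>X\<close>, the
    translation, and the extent of \<open>X\<close>.\<close>
  define L where "L = (\<Sum>x\<in>X. l x) + (\<Sum>i<d. nat \<bar>snd g i\<bar>) + (\<Sum>x\<in>X. \<Sum>i<d. nat \<bar>x i\<bar>)"
  have "\<bar>\<eta> (lamp (move g y)) - \<eta> (lamp y)\<bar> \<le> int L
    \<and> (\<forall>i<d. \<bar>site (move g y) i - site y i\<bar> \<le> int L)
    \<and> ((\<exists>i<d. \<bar>site (move g y) i\<bar> > int L) \<longrightarrow> lamp (move g y) = lamp y)" if y: "y \<in> Y" for y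
  proof -
    let ?x = "snd g \<otimes>\<^bsub>Zd\<^esub> site y"
    have x: "?x \<in> carrier Zd"
      by (rule B.m_closed[OF W_D(2)[OF g] site_Zd[OF y]])
    have lampX: "lamp (move g y) = lamp y" if "?x \<notin> X"
    proof -
      have "fst g ?x = \<one>" using that x unfolding X_def by blast
      then show ?thesis using lamp_move[OF g y] \<alpha>_one[OF lamp_P[OF y]] by simp
    qed
    have 1: "\<bar>\<eta> (lamp (move g y)) - \<eta> (lamp y)\<bar> \<le> int L"
    proof (cases "?x \<in> X")
      case True
      have "l ?x \<le> (\<Sum>x\<in>X. l x)"
        using X True by (intro member_le_sum) auto
      then have "l ?x \<le> L" unfolding L_def by linarith
      then show ?thesis
        using l[OF True lamp_P[OF y]] lamp_move[OF g y] by simp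
    qed (use lampX in simp)
    have 2: "\<bar>site (move g y) i - site y i\<bar> \<le> int L" if i: "i < d" for i
    proof -
      have "nat \<bar>snd g i\<bar> \<le> (\<Sum>i<d. nat \<bar>snd g i\<bar>)"
        using i by (intro member_le_sum) auto
      then have "\<bar>snd g i\<bar> \<le> int L" unfolding L_def by linarith
      then show ?thesis
        using i by (simp add: site_move[OF g y] mult_int_power)
    qed
    have 3: "lamp (move g y) = lamp y" if i: "i < d" "\<bar>site (move g y) i\<bar> > int L" for i
    proof (rule lampX, rule notI)
      assume xX: "?x \<in> X"
      have "nat \<bar>?x i\<bar> \<le> (\<Sum>i<d. nat \<bar>?x i\<bar>)"
        using i by (intro member_le_sum) auto
      also have "\<dots> \<le> (\<Sum>x\<in>X. \<Sum>i<d. nat \<bar>x i\<bar>)"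
        using X xX by (intro member_le_sum[of ?x X "\<lambda>x. \<Sum>i<d. nat \<bar>x i\<bar>"]) auto
      finally have "nat \<bar>?x i\<bar> \<le> L" unfolding L_def by linarith
      then show False
        using i(2) site_move[OF g y] by simp
    qed
    show ?thesis using 1 2 3 by blast
  qed
  then show ?thesis unfolding displacement_bound_def by blast
qed

lemma uniform_displacement_bound:
  assumes "finite S" "S \<subseteq> carrier W"
  shows "\<exists>L>0. \<forall>s\<in>S. displacement_bound L s"
proof -
  obtain l where l: "\<And>s. s \<in> S \<Longrightarrow> displacement_bound (l s) s"
    using displacement_bound_exists assms(2) by (metis subsetD)
  have "displacement_bound (Suc (\<Sum>s\<in>S. l s)) s" if "s \<in> S" for s
    using assms(1) that member_le_sum[of s S l] by (intro displacement_bound_mono[OF l[OF that]]) auto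
  then show ?thesis by blast
qed

lemma \<kappa>_move: "g \<in> carrier W \<Longrightarrow> y \<in> Y \<Longrightarrow> \<kappa> (lamp (move g y)) = \<kappa> (lamp y)"
  using \<kappa>_inv fst_closed B.m_closed[OF W_D(2) site_Zd] by (simp add: lamp_move del: carrier_int_power)


lemma act_apply: "y \<in> Y \<Longrightarrow> act g y = move g y"
  by (simp add: act_def)

text \<open>In the last claim, \<open>n\<close> steps of size at most \<open>L\<close> that start
  beyond \<open>L + L * n\<close> in some coordinate always arrive beyond \<open>L\<close> in it, so
  no letter of the word touches the lamp.\<close>

lemma word_displacement:
  assumes S: "symmetric_generating_set W S" and L: "\<forall>s\<in>S. displacement_bound L s" and y: "y \<in> Y"
    and g: "g \<in> carrier W"
  defines "n \<equiv> word_length W S g"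
  shows "\<bar>\<eta> (lamp (move g y)) - \<eta> (lamp y)\<bar> \<le> int (L * n)"
    and "\<And>i. i < d \<Longrightarrow> \<bar>site (move g y) i - site y i\<bar> \<le> int (L * n)"
    and "\<And>i. i < d \<Longrightarrow> \<bar>site y i\<bar> > int (L + L * n) \<Longrightarrow> lamp (move g y) = lamp y"
proof -
  interpret word_metric W S by unfold_locales (rule S)
  have word: "\<bar>\<eta> (lamp (move w y)) - \<eta> (lamp y)\<bar> \<le> int (L * m)
      \<and> (\<forall>i<d. \<bar>site (move w y) i - site y i\<bar> \<le> int (L * m))
      \<and> (\<forall>i<d. \<bar>site y i\<bar> > int (L + L * m) \<longrightarrow> lamp (move w y) = lamp y)"
    if "set ws \<subseteq> S" "m = length ws" "w = foldr (\<otimes>\<^bsub>W\<^esub>) ws \<one>\<^bsub>W\<^esub>" for ws m w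
    using that
  proof (induction ws arbitrary: m w)
    case Nil
    then show ?case using move_one[OF y] by simp
  next
    case (Cons s ws)
    define v where "v = foldr (\<otimes>\<^bsub>W\<^esub>) ws \<one>\<^bsub>W\<^esub>"
    define z where "z = move v y"
    have s: "s \<in> S" "s \<in> carrier W" and v: "v \<in> carrier W"
      using Cons.prems S_carrier word_carrier[of ws] by (auto simp: v_def simp del: W_mult)
    have zY: "z \<in> Y" unfolding z_def by (rule move_closed[OF v y])
    have w: "move w y = move s z"
      using move_mult[OF s(2) v y] Cons.prems(3) by (simp add: v_def z_def del: W_mult)
    have IH: "\<bar>\<eta> (lamp z) - \<eta> (lamp y)\<bar> \<le> int (L * length ws)"
      "\<And>i. i < d \<Longrightarrow> \<bar>site z i - site y i\<bar> \<le> int (L * length ws)"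
      "\<And>i. i < d \<Longrightarrow> \<bar>site y i\<bar> > int (L + L * length ws) \<Longrightarrow> lamp z = lamp y"
      using Cons.IH[OF _ refl v_def] Cons.prems(1) by (auto simp: z_def)
    have st: "\<bar>\<eta> (lamp (move s z)) - \<eta> (lamp z)\<bar> \<le> int L"
      "\<And>i. i < d \<Longrightarrow> \<bar>site (move s z) i - site z i\<bar> \<le> int L"
      "\<And>i. i < d \<Longrightarrow> \<bar>site (move s z) i\<bar> > int L \<Longrightarrow> lamp (move s z) = lamp z"
      using L s(1) zY unfolding displacement_bound_def by blast+
    have m: "int (L * m) = int L + int (L * length ws)"
      using Cons.prems(2) by simp
    show ?case
      unfolding w
    proof (intro conjI allI impI)
      show "\<bar>\<eta> (lamp (move s z)) - \<eta> (lamp y)\<bar> \<le> int (L * m)"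
        using IH(1) st(1) m by linarith
      show "\<bar>site (move s z) i - site y i\<bar> \<le> int (L * m)" if "i < d" for i
        using IH(2)[OF that] st(2)[OF that] m by linarith
      show "lamp (move s z) = lamp y" if i: "i < d" and far: "\<bar>site y i\<bar> > int (L + L * m)" for i
      proof -
        have "\<bar>site y i\<bar> > int (L + L * length ws)"
          using far m by linarith
        moreover have "\<bar>site (move s z) i\<bar> > int L"
          using far m IH(2)[OF i] st(2)[OF i] by linarith
        ultimately show ?thesis using IH(3)[OF i] st(3)[OF i] by simp
      qed
    qed
  qed
  obtain ws where ws: "set ws \<subseteq> S" "n = length ws" "g = foldr (\<otimes>\<^bsub>W\<^esub>) ws \<one>\<^bsub>W\<^esub>"
    using word_length_word[OF g] unfolding n_def by metis
  show "\<bar>\<eta> (lamp (move g y)) - \<eta> (lamp y)\<bar> \<le> int (L * n)"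
    "\<And>i. i < d \<Longrightarrow> \<bar>site (move g y) i - site y i\<bar> \<le> int (L * n)"
    "\<And>i. i < d \<Longrightarrow> \<bar>site y i\<bar> > int (L + L * n) \<Longrightarrow> lamp (move g y) = lamp y"
    using word[OF ws] by blast+
qed

text \<open>The sites reached contribute the exponent \<open>d\<close> and the lamps reached,
  collected in \<open>Q y n\<close>, the exponent \<open>e\<close>. It is applied with
  \<open>e = 0\<close> for finite \<open>A\<close> and with \<open>e = 1\<close> for lamps on a
  line.\<close>

lemma growth_leI:
  assumes S: "symmetric_generating_set W S"
    and lamps: "\<And>y n. y \<in> Y \<Longrightarrow> finite (Q y n)
      \<and> (\<forall>g\<in>carrier W. word_length W S g \<le> n \<longrightarrow> lamp (move g y) \<in> Q y n)
      \<and> card (Q y n) \<le> (2 * L * n + 1) ^ e * M"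
    and L: "\<forall>s\<in>S. displacement_bound L s"
  shows "action_growth W S Y act \<preceq>\<^sub>g (\<lambda>n. real n ^ (d + e))"
proof -
  interpret word_metric W S by unfold_locales (rule S)
  have Y_ne: "Y \<noteq> {}"
    using act_faithful by (simp add: faithful_G_set_def)
  have ball: "card ((\<lambda>g. act g y) ` {g \<in> carrier W. wl g \<le> n}) \<le> (2 * L * n + 1) ^ (d + e) * M" if y: "y \<in> Y" for y n
  proof -
    let ?I = "\<lambda>i. {site y i - int (L * n)..site y i + int (L * n)}"
    let ?B = "(\<lambda>g. act g y) ` {g \<in> carrier W. wl g \<le> n}"
    have sub: "pos ` ?B \<subseteq> Q y n \<times> PiE {..<d} ?I"
    proof
      fix x assume "x \<in> pos ` ?B"
      then obtain g where g: "g \<in> carrier W" "wl g \<le> n" "x = pos (move g y)"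
        using act_apply[OF y] by auto
      have "site (move g y) i \<in> ?I i" if "i < d" for i
      proof -
        have "int (L * wl g) \<le> int (L * n)" using g(2) by (simp add: mult_left_mono)
        then show ?thesis
          using word_displacement(2)[OF S L y g(1) that] by (simp only: atLeastAtMost_iff) linarith
      qed
      moreover have "site (move g y) \<in> {..<d} \<rightarrow>\<^sub>E UNIV"
        using site_Zd[OF move_closed[OF g(1) y]] by simp
      ultimately have "site (move g y) \<in> PiE {..<d} ?I"
        by (simp add: PiE_iff)
      moreover have "lamp (move g y) \<in> Q y n"
        using lamps[OF y] g by blast
      ultimately show "x \<in> Q y n \<times> PiE {..<d} ?I"
        unfolding g(3) by (simp only: mem_Times_iff)
    qed
    have fin: "finite (Q y n \<times> PiE {..<d} ?I)"
      using lamps[OF y] by (simp add: finite_PiE)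
    have "inj_on pos ?B"
      using act_apply[OF y] move_closed[OF _ y] by (auto intro!: inj_onI pos_inj)
    then have "card ?B = card (pos ` ?B)"
      by (simp add: card_image)
    also have "\<dots> \<le> card (Q y n \<times> PiE {..<d} ?I)"
      by (rule card_mono[OF fin sub])
    also have "\<dots> = card (Q y n) * (2 * L * n + 1) ^ d"
    proof -
      have "card (?I i) = 2 * L * n + 1" for i
      proof -
        have "card (?I i) = nat (2 * int (L * n) + 1)" by simp
        also have "\<dots> = 2 * L * n + 1" by (simp add: nat_add_distrib nat_mult_distrib)
        finally show ?thesis .
      qed
      then show ?thesis
        by (simp add: card_cartesian_product card_PiE)
    qed
    also have "\<dots> \<le> ((2 * L * n + 1) ^ e * M) * (2 * L * n + 1) ^ d"
      using lamps[OF y] by (intro mult_right_mono) auto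
    finally show ?thesis
      by (simp add: power_add mult.commute mult.left_commute)
  qed
  \<comment> \<open>Absorbs \<open>2 * L * n + 1 \<le> (2 * L + 1) * n\<close>, valid for
    \<open>n \<ge> 1\<close>, as well as the factor \<open>M\<close>; \<open>Suc\<close> keeps it
    positive.\<close>
  define C where "C = (2 * L + 1) * Suc M"
  have "action_growth W S Y act n \<le> real C * real (C * n) ^ (d + e)" if n: "n \<ge> 1" for n
  proof -
    have "action_growth W S Y act n \<le> real ((2 * L * n + 1) ^ (d + e) * M)"
      by (rule action_growth_le[OF Y_ne ball])
    also have "\<dots> \<le> real ((C * n) ^ (d + e) * C)"
    proof -
      have "2 * L * n + 1 \<le> (2 * L + 1) * n" using n by simp
      also have "\<dots> \<le> C * n" unfolding C_def by (intro mult_right_mono) auto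
      finally have "(2 * L * n + 1) ^ (d + e) \<le> (C * n) ^ (d + e)" by (rule power_mono) simp
      moreover have "M \<le> C" by (simp add: C_def)
      ultimately show ?thesis
        unfolding of_nat_le_iff by (rule mult_mono) simp_all
    qed
    finally show ?thesis by (simp add: mult.commute)
  qed
  then show ?thesis
    unfolding growth_le_def
    by (intro exI[of _ C] conjI) (auto simp: C_def eventually_sequentially intro!: exI[of _ 1])
qed

lemma growth_le_finite:
  assumes S: "symmetric_generating_set W S" and fin: "finite (carrier A)"
  shows "action_growth W S Y act \<preceq>\<^sub>g (\<lambda>n. real n ^ d)"
proof -
  interpret word_metric W S by unfold_locales (rule S)
  obtain L where L: "\<forall>s\<in>S. displacement_bound L s"
    using uniform_displacement_bound[OF S_finite S_carrier] by blast
  have "action_growth W S Y act \<preceq>\<^sub>g (\<lambda>n. real n ^ (d + 0))"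
  proof (rule growth_leI[OF S _ L, where Q = "\<lambda>y n. (\<lambda>a. \<alpha> a (lamp y)) ` carrier A" and M = "card (carrier A)"],
      intro conjI ballI impI)
    fix y n g assume y: "y \<in> Y" and g: "g \<in> carrier W"
    show "lamp (move g y) \<in> (\<lambda>a. \<alpha> a (lamp y)) ` carrier A"
      unfolding lamp_move[OF g y]
      by (rule imageI[OF fst_closed[OF g B.m_closed[OF W_D(2)[OF g] site_Zd[OF y]]]])
  qed (use fin card_image_le[OF fin] in auto)
  then show ?thesis by simp
qed

lemma growth_le:
  assumes S: "symmetric_generating_set W S"
  shows "action_growth W S Y act \<preceq>\<^sub>g (\<lambda>n. real n ^ (d + 1))"
proof -
  interpret word_metric W S by unfold_locales (rule S)
  obtain L where L: "\<forall>s\<in>S. displacement_bound L s"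
    using uniform_displacement_bound[OF S_finite S_carrier] by blast
  \<comment> \<open>Transporters for height difference \<open>0\<close> bound the number of lamps of
    one class at one height, and a ball of radius \<open>n\<close> only reaches
    \<open>2 * L * n + 1\<close> heights.\<close>
  obtain \<Lambda> where \<Lambda>: "finite \<Lambda>"
    "\<And>p q. p \<in> P \<Longrightarrow> q \<in> P \<Longrightarrow> \<kappa> p = \<kappa> q \<Longrightarrow> \<bar>\<eta> p - \<eta> q\<bar> \<le> 0 \<Longrightarrow> \<exists>a\<in>\<Lambda>. \<alpha> a p = q"
    using finite_transporter[of 0] by blast
  define fib where "fib k m = {p \<in> P. \<kappa> p = k \<and> \<eta> p = m}" for k m
  have fib: "finite (fib k m) \<and> card (fib k m) \<le> card \<Lambda>" for k m
  proof (cases "fib k m = {}")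
    case False
    then obtain p where p: "p \<in> fib k m" by blast
    have sub: "fib k m \<subseteq> (\<lambda>a. \<alpha> a p) ` \<Lambda>"
    proof
      fix q assume "q \<in> fib k m"
      then have "\<exists>a\<in>\<Lambda>. \<alpha> a p = q" using p by (intro \<Lambda>(2)) (auto simp: fib_def)
      then show "q \<in> (\<lambda>a. \<alpha> a p) ` \<Lambda>" by blast
    qed
    show ?thesis
      using surj_card_le[OF \<Lambda>(1) sub] finite_subset[OF sub finite_imageI[OF \<Lambda>(1)]] by blast
  qed simp
  define Q where "Q y n = (\<Union>m\<in>{\<eta> (lamp y) - int (L * n)..\<eta> (lamp y) + int (L * n)}. fib (\<kappa> (lamp y)) m)" for y n
  show ?thesis
  proof (rule growth_leI[OF S _ L, where Q = Q and M = "card \<Lambda>"], intro conjI ballI impI)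
    fix y n g assume y: "y \<in> Y" and g: "g \<in> carrier W" "wl g \<le> n"
    have "int (L * wl g) \<le> int (L * n)" using g(2) by (simp add: mult_left_mono)
    then have "\<eta> (lamp (move g y)) \<in> {\<eta> (lamp y) - int (L * n)..\<eta> (lamp y) + int (L * n)}"
      using word_displacement(1)[OF S L y g(1)] by (simp only: atLeastAtMost_iff) linarith
    then show "lamp (move g y) \<in> Q y n"
      using \<kappa>_move[OF g(1) y] lamp_P[OF move_closed[OF g(1) y]] unfolding Q_def fib_def by blast
  next
    fix y n
    have "card (Q y n) \<le> (\<Sum>m\<in>{\<eta> (lamp y) - int (L * n)..\<eta> (lamp y) + int (L * n)}. card (fib (\<kappa> (lamp y)) m))"
      unfolding Q_def by (rule card_UN_le) simp
    also have "\<dots> \<le> (\<Sum>m\<in>{\<eta> (lamp y) - int (L * n)..\<eta> (lamp y) + int (L * n)}. card \<Lambda>)"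
      using fib by (intro sum_mono) blast
    also have "\<dots> = (2 * L * n + 1) * card \<Lambda>"
    proof -
      have "card {\<eta> (lamp y) - int (L * n)..\<eta> (lamp y) + int (L * n)} = nat (2 * int (L * n) + 1)" by simp
      also have "\<dots> = 2 * L * n + 1" by (simp add: nat_add_distrib nat_mult_distrib)
      finally show ?thesis by simp
    qed
    finally show "card (Q y n) \<le> (2 * L * n + 1) ^ 1 * card \<Lambda>" by simp
  qed (use fib in \<open>simp add: Q_def\<close>)
qed

end

section \<open>Upper bound for the asymptotic dimension\<close>

text \<open>The left inequality is strict because a multiple of \<open>m\<close> equal to
  \<open>a - r\<close> opens the block of \<open>a - r\<close> and separates nothing.\<close>

lemma div_neq_imp_multiple_between:
  fixes a r m :: int
  assumes "0 < m" "0 \<le> r" "(a - r) div m \<noteq> (a + r) div m"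
  shows "\<exists>k. a - r < k * m \<and> k * m \<le> a + r"
proof (intro exI conjI)
  let ?k = "(a + r) div m"
  show "?k * m \<le> a + r"
    using assms(1) by (metis add.commute div_mult_mod_eq le_add_same_cancel1 mult.commute pos_mod_sign)
  show "a - r < ?k * m"
  proof (rule ccontr)
    assume "\<not> a - r < ?k * m"
    then have "?k \<le> (a - r) div m"
      using assms(1) by (metis not_less zdiv_mono1 nonzero_mult_div_cancel_right less_irrefl)
    moreover have "(a - r) div m \<le> ?k"
      using assms(1,2) by (intro zdiv_mono1) auto
    ultimately show False using assms(3) by simp
  qed
qed

text \<open>Among the \<open>d + 1\<close> cubical grids of mesh \<open>(d + 1) * T\<close> shifted diagonally by multiples of \<open>T\<close>,
  each coordinate hyperplane of a point is close to the walls of at most one, so that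
  some grid has the point deep inside one of its cells.\<close>

lemma shifted_grid:
  fixes x :: "nat \<Rightarrow> int" and T r :: int
  assumes r: "0 \<le> r" "2 * r < T"
  shows "\<exists>j\<le>d. \<forall>i<d. (x i + int j * T - r) div (int (d + 1) * T) = (x i + int j * T + r) div (int (d + 1) * T)"
proof (rule ccontr)
  let ?M = "int (d + 1) * T"
  have M: "0 < ?M" using r by simp
  assume "\<not> ?thesis"
  then have "\<forall>j\<in>{..d}. \<exists>i. i < d \<and> (x i + int j * T - r) div ?M \<noteq> (x i + int j * T + r) div ?M"
    by auto
  then obtain f where f: "\<And>j. j \<le> d \<Longrightarrow> f j < d"
    "\<And>j. j \<le> d \<Longrightarrow> (x (f j) + int j * T - r) div ?M \<noteq> (x (f j) + int j * T + r) div ?M"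
    by (metis atMost_iff)
  have "\<not> inj_on f {..d}"
  proof (rule pigeonhole)
    have "card (f ` {..d}) \<le> card {..<d}"
      using f(1) by (intro card_mono) auto
    then show "card (f ` {..d}) < card {..d}" by simp
  qed
  then obtain j j' where j: "j < j'" "j' \<le> d" "f j = f j'"
    unfolding inj_on_def by (metis atMost_iff linorder_neqE_nat)
  obtain k where k: "x (f j) + int j * T - r < k * ?M" "k * ?M \<le> x (f j) + int j * T + r"
    using div_neq_imp_multiple_between[OF M r(1) f(2)[of j]] j by auto
  obtain k' where k': "x (f j) + int j' * T - r < k' * ?M" "k' * ?M \<le> x (f j) + int j' * T + r"
    using div_neq_imp_multiple_between[OF M r(1) f(2)[of j']] j by auto
  \<comment> \<open>Two shifts that fail at the same coordinate give walls at \<open>k * ?M\<close>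
    and \<open>k' * ?M\<close> whose distance differs from \<open>(j' - j) * T\<close> by at most
    \<open>2 * r < T\<close>. Dividing by \<open>T\<close> leaves an integer of absolute value below
    \<open>1\<close>, so \<open>d + 1\<close> divides \<open>j' - j\<close>, which lies between
    \<open>1\<close> and \<open>d\<close>.\<close>
  define u where "u = (k' - k) * int (d + 1) - (int j' - int j)"
  have "u * T = k' * ?M - k * ?M - (int j' * T - int j * T)"
    by (simp add: u_def algebra_simps)
  then have "\<bar>u * T\<bar> < T" using k k' r(2) by linarith
  then have "\<bar>u\<bar> * T < 1 * T" using r by (simp add: abs_mult)
  then have "\<bar>u\<bar> < 1" using r by (simp only: mult_less_cancel_right)
  then have "u = 0" by simp
  then have "int (d + 1) dvd int j' - int j"
    unfolding u_def by (metis dvd_triv_right eq_iff_diff_eq_0)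
  then have "int (d + 1) \<le> int j' - int j"
    using j by (intro zdvd_imp_le) auto
  then show False using j by simp
qed

lemma div_eq_imp_abs_diff_less:
  fixes a b m :: int
  assumes "0 < m" "a div m = b div m"
  shows "\<bar>a - b\<bar> < m"
proof -
  have "a - b = a mod m - b mod m"
    using assms(2) by (metis add_diff_cancel_left div_mult_mod_eq)
  then show ?thesis
    using pos_mod_bound[OF assms(1), of a] pos_mod_sign[OF assms(1), of a]
      pos_mod_bound[OF assms(1), of b] pos_mod_sign[OF assms(1), of b] by linarith
qed

context lamplighter_model
begin

text \<open>Word lengths in a finite set are bounded, uniformly in the point moved. Diameters of
  cover sets are thus controlled by exhibiting finitely many elements that join any two of their
  points.\<close>

lemma transporter_bound:
  assumes S: "symmetric_generating_set W S" and "finite \<Gamma>" "\<Gamma> \<subseteq> carrier W"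
  shows "\<exists>D::real. \<forall>g\<in>\<Gamma>. \<forall>y\<in>Y. simplicial_dist (schreier_edges S Y act) y (move g y) \<le> ereal D"
proof -
  interpret faithful_action W Y act
    using act_faithful by (simp add: faithful_G_set_def)
  interpret word_action W S Y act
    by unfold_locales (rule S)
  have "sdist y (move g y) \<le> ereal (real (\<Sum>g\<in>\<Gamma>. wl g))" if "g \<in> \<Gamma>" "y \<in> Y" for g y
  proof -
    have "wl g \<le> (\<Sum>g\<in>\<Gamma>. wl g)" using assms(2) that(1) by (intro member_le_sum) auto
    then have "real (wl g) \<le> real (\<Sum>g\<in>\<Gamma>. wl g)" by (simp only: of_nat_le_iff)
    from sdist_action_le[OF that(2) subsetD[OF assms(3) that(1)] this]
    show ?thesis by (simp only: act_apply[OF that(2)])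
  qed
  then show ?thesis by blast
qed

lemma single_lamp:
  assumes "a \<in> carrier A"
  shows "(\<lambda>x\<in>carrier Zd. if x = c then a else \<one>) \<in> F"
proof -
  have "finite {x \<in> carrier Zd. (\<lambda>x\<in>carrier Zd. if x = c then a else \<one>) x \<noteq> \<one>}"
    by (rule finite_subset[of _ "{c}"]) auto
  then show ?thesis
    using assms unfolding F_eq by auto
qed

text \<open>There are two kinds of balls. Away from the origin all points of a ball have the same
  lamp, and each of the \<open>d + 1\<close> grids contributes at most one set. Near the origin the
  ball lies in the core, where only sets cut along the lamp lines occur and at most two are met;
  there \<open>d \<ge> 1\<close> gives \<open>2 \<le> d + 1\<close>.\<close>

lemma asdim_upper_bound:
  assumes d: "d \<ge> 1" and S: "symmetric_generating_set W S"
  shows "asdim_at_most Y (simplicial_dist (schreier_edges S Y act)) d"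
  unfolding asdim_at_most_def
proof (intro allI impI)
  fix R :: real assume "R > 0"
  interpret faithful_action W Y act
    using act_faithful by (simp add: faithful_G_set_def)
  interpret word_action W S Y act
    by unfold_locales (rule S)
  obtain L where L: "\<forall>s\<in>S. displacement_bound L s"
    using uniform_displacement_bound[OF S_finite S_carrier] by blast
  \<comment> \<open>No element of word length at most \<open>R\<close> moves a coordinate or a
    height by more than \<open>r\<close>.\<close>
  define r where "r = int (L * nat \<lfloor>R\<rfloor>)"
  have r: "0 \<le> r" by (simp add: r_def)
  \<comment> \<open>The core below, shifted by \<open>off\<close> and thickened by \<open>r\<close>
    on both sides, spans exactly \<open>0\<close> to \<open>2 * L + 6 * r\<close>. This
    \<open>T\<close> makes it fit into the first cell of grid \<open>0\<close> and also satisfies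
    \<open>2 * r < T\<close>.\<close>
  define T where "T = 2 * int L + 6 * r + 1"
  have T: "2 * r < T" "0 < T" using r by (simp_all add: T_def)
  define M where "M = int (d + 1) * T"
  have M: "T \<le> M" "0 < M"
    using T mult_right_mono[of 1 "int (d + 1)" T] by (simp_all add: M_def)
  define off where "off = int L + 3 * r"
  define deep where "deep j c \<longleftrightarrow> (\<forall>i<d. (c i + off + int j * T - r) div M = (c i + off + int j * T + r) div M)"
    for j :: nat and c :: "nat \<Rightarrow> int"
  define cell where "cell j c = (\<lambda>i\<in>{..<d}. (c i + off + int j * T) div M)" for j :: nat and c :: "nat \<Rightarrow> int"
  define z0 :: "nat \<Rightarrow> int" where "z0 = (\<lambda>i\<in>{..<d}. 0)"
  define core where "core c \<longleftrightarrow> (\<forall>i<d. \<bar>c i\<bar> \<le> int L + 2 * r)" for c :: "nat \<Rightarrow> int"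
  have deep_exists: "\<exists>j\<le>d. deep j c" for c
    using shifted_grid[OF r T(1), of d "\<lambda>i. c i + off"] unfolding deep_def M_def .
  have cell_eq: "cell j c' = cell j c" if dp: "deep j c'" and near: "\<And>i. i < d \<Longrightarrow> \<bar>c' i - c i\<bar> \<le> r" for j c c'
    unfolding cell_def
  proof (rule restrict_ext)
    fix i assume "i \<in> {..<d}"
    then have i: "i < d" by simp
    let ?x = "c' i + off + int j * T" and ?y = "c i + off + int j * T"
    have le: "?x - r \<le> ?y" "?y \<le> ?x + r" "?x - r \<le> ?x" "?x \<le> ?x + r"
      using near[OF i] r by linarith+
    have "(?x - r) div M \<le> ?y div M" "?y div M \<le> (?x + r) div M"
      "(?x - r) div M \<le> ?x div M" "?x div M \<le> (?x + r) div M"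
      using le M(2) by (auto intro: zdiv_mono1)
    moreover have "(?x - r) div M = (?x + r) div M"
      using dp i by (simp add: deep_def)
    ultimately show "?x div M = ?y div M" by linarith
  qed
  have core_deep: "deep 0 c" "cell 0 c = z0" if "core c" for c
  proof -
    have 1: "(c i + off - r) div M = 0" "(c i + off + r) div M = 0" "(c i + off) div M = 0" if i: "i < d" for i
      using \<open>core c\<close> i r M(1) unfolding core_def off_def T_def by (auto simp: abs_le_iff intro!: div_pos_pos_trivial)
    show "deep 0 c" using 1 by (simp add: deep_def)
    show "cell 0 c = z0" using 1 unfolding cell_def z0_def by (intro restrict_ext) simp
  qed
  \<comment> \<open>A window of radius \<open>r\<close> contains \<open>2 * r + 1\<close> heights,
    so it meets at most two blocks of length \<open>N\<close>.\<close>
  define N where "N = 2 * r + 1"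
  have N: "0 < N" using r by (simp add: N_def)
  \<comment> \<open>Lamps only change over the core, which lies in one cell of grid \<open>0\<close>. There the cover
    is \<open>U0\<close>, which cuts the lamps along \<open>\<eta>\<close>, and the sets \<open>U1\<close> with a constant lamp avoid the core.\<close>
  define U0 where "U0 k m = {y \<in> Y. \<kappa> (lamp y) = k \<and> \<eta> (lamp y) div N = m \<and> deep 0 (site y) \<and> cell 0 (site y) = z0}"
    for k m
  define U1 where "U1 j z p = {y \<in> Y. lamp y = p \<and> deep j (site y) \<and> cell j (site y) = z \<and> \<not> core (site y)}"
    for j z p
  \<comment> \<open>Over the cell \<open>z0\<close> of grid \<open>0\<close> the sets
    \<open>U0\<close> take the place of \<open>U1\<close>, so that grid \<open>0\<close> still
    contributes a single set as long as the lamp is constant.\<close>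
  define \<U> where "\<U> = {U0 k m | k m. True} \<union> {U1 j z p | j z p. j \<le> d \<and> (j = 0 \<longrightarrow> z \<noteq> z0)}"
  define Bx where "Bx = {..<d} \<rightarrow>\<^sub>E {-M..M}"
  have Bx: "finite Bx" "Bx \<subseteq> carrier Zd"
    by (auto simp: Bx_def finite_PiE)
  obtain \<Lambda> where \<Lambda>: "finite \<Lambda>" "\<Lambda> \<subseteq> carrier A"
    "\<And>p q. p \<in> P \<Longrightarrow> q \<in> P \<Longrightarrow> \<kappa> p = \<kappa> q \<Longrightarrow> \<bar>\<eta> p - \<eta> q\<bar> \<le> N \<Longrightarrow> \<exists>a\<in>\<Lambda>. \<alpha> a p = q"
    using finite_transporter[of N] by blast
  \<comment> \<open>Translates by \<open>b\<close> and then changes the lamp at the single site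
    \<open>x\<close>. Sites in the cell \<open>z0\<close> are bounded, so finitely many such
    elements join any two points of any \<open>U0\<close>.\<close>
  define g0 where "g0 a x b = ((\<lambda>c\<in>carrier Zd. if c = x then a else \<one>), b)" for a :: 'a and x b :: "nat \<Rightarrow> int"
  have g0_W: "g0 a x b \<in> carrier W" if "a \<in> carrier A" "b \<in> carrier Zd" for a x b
    unfolding g0_def W_carrier by (rule SigmaI[OF single_lamp[OF that(1)] that(2)])
  define \<Gamma> where "\<Gamma> = top_el ` Bx \<union> (\<Union>a\<in>\<Lambda>. \<Union>x\<in>Bx. g0 a x ` Bx)"
  have \<Gamma>: "finite \<Gamma>"
    unfolding \<Gamma>_def using Bx(1) \<Lambda>(1) by blast
  have "\<Gamma> \<subseteq> carrier W"
  proof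
    fix g assume "g \<in> \<Gamma>"
    then consider b where "b \<in> Bx" "g = top_el b" | a x b where "a \<in> \<Lambda>" "b \<in> Bx" "g = g0 a x b"
      unfolding \<Gamma>_def by blast
    then show "g \<in> carrier W"
      using top.hom_closed Bx(2) g0_W \<Lambda>(2) by cases blast+
  qed
  then obtain D where D: "\<And>g y. g \<in> \<Gamma> \<Longrightarrow> y \<in> Y \<Longrightarrow> sdist y (move g y) \<le> ereal D"
    using transporter_bound[OF S \<Gamma>] by blast
  have diff_Bx: "site y' \<otimes>\<^bsub>Zd\<^esub> inv\<^bsub>Zd\<^esub> site y \<in> Bx \<and> (site y' \<otimes>\<^bsub>Zd\<^esub> inv\<^bsub>Zd\<^esub> site y) \<otimes>\<^bsub>Zd\<^esub> site y = site y'"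
    if y: "y \<in> Y" "y' \<in> Y" and eq: "cell j (site y) = cell j (site y')" for y y' j
  proof
    have c: "site y \<in> {..<d} \<rightarrow>\<^sub>E UNIV" "site y' \<in> {..<d} \<rightarrow>\<^sub>E UNIV"
      using site_Zd y by simp_all
    have "\<bar>site y' i - site y i\<bar> \<le> M" if i: "i < d" for i
    proof -
      have "(site y' i + off + int j * T) div M = (site y i + off + int j * T) div M"
        using fun_cong[OF eq, of i] i by (simp add: cell_def)
      from div_eq_imp_abs_diff_less[OF M(2) this] show ?thesis by linarith
    qed
    then show "site y' \<otimes>\<^bsub>Zd\<^esub> inv\<^bsub>Zd\<^esub> site y \<in> Bx"
      using c by (simp add: Bx_def mult_int_power inv_int_power abs_le_iff) (fastforce)
    show "(site y' \<otimes>\<^bsub>Zd\<^esub> inv\<^bsub>Zd\<^esub> site y) \<otimes>\<^bsub>Zd\<^esub> site y = site y'"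
      using site_Zd[OF y(1)] site_Zd[OF y(2)] by (simp add: B.m_assoc B.l_inv del: carrier_int_power)
  qed
  have diam: "sdist y y' \<le> ereal D" if U: "U \<in> \<U>" "y \<in> U" "y' \<in> U" for U y y'
  proof -
    from U(1) consider k m where "U = U0 k m" | j z p where "U = U1 j z p"
      unfolding \<U>_def by blast
    then show ?thesis
    proof cases
      case 1
      have y: "y \<in> Y" "y' \<in> Y" and eq: "\<kappa> (lamp y) = \<kappa> (lamp y')" "\<eta> (lamp y) div N = \<eta> (lamp y') div N"
        "cell 0 (site y) = cell 0 (site y')" "cell 0 (site y') = z0"
        using U(2,3) unfolding 1 U0_def by auto
      define b where "b = site y' \<otimes>\<^bsub>Zd\<^esub> inv\<^bsub>Zd\<^esub> site y"
      have b: "b \<in> Bx" "b \<otimes>\<^bsub>Zd\<^esub> site y = site y'"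
        using diff_Bx[OF y eq(3)] by (simp_all add: b_def)
      have "\<bar>\<eta> (lamp y) - \<eta> (lamp y')\<bar> \<le> N"
        using div_eq_imp_abs_diff_less[OF N eq(2)] by linarith
      then obtain a where a: "a \<in> \<Lambda>" "\<alpha> a (lamp y) = lamp y'"
        using \<Lambda>(3)[OF lamp_P[OF y(1)] lamp_P[OF y(2)] eq(1)] by blast
      have "site y' \<in> Bx"
      proof -
        have "- M \<le> site y' i \<and> site y' i \<le> M" if i: "i < d" for i
        proof -
          have "(site y' i + off) div M = 0"
            using fun_cong[OF eq(4), of i] i by (simp add: cell_def z0_def)
          then have "0 \<le> site y' i + off \<and> site y' i + off < M"
            using pos_mod_sign[OF M(2), of "site y' i + off"] pos_mod_bound[OF M(2), of "site y' i + off"]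
              div_mult_mod_eq[of "site y' i + off" M] by simp
          then show ?thesis using M(1) r by (simp add: off_def T_def)
        qed
        then show ?thesis
          using site_Zd[OF y(2)] by (simp add: Bx_def PiE_iff)
      qed
      then have g: "g0 a (site y') b \<in> \<Gamma>"
        using a(1) b(1) unfolding \<Gamma>_def by blast
      have gW: "g0 a (site y') b \<in> carrier W"
        using g0_W a(1) \<Lambda>(2) b(1) Bx(2) by blast
      have "pos (move (g0 a (site y') b) y) = pos y'"
        using move_closed_pos[OF gW y(1)] b(2) a(2) site_Zd[OF y(2)]
        by (simp add: g0_def prod_eq_iff del: carrier_int_power)
      then have "move (g0 a (site y') b) y = y'"
        using pos_inj move_closed[OF gW y(1)] y(2) by blast
      then show ?thesis using D[OF g y(1)] by simp
    next
      case 2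
      have y: "y \<in> Y" "y' \<in> Y" and eq: "lamp y = lamp y'" "cell j (site y) = cell j (site y')"
        using U(2,3) unfolding 2 U1_def by auto
      define b where "b = site y' \<otimes>\<^bsub>Zd\<^esub> inv\<^bsub>Zd\<^esub> site y"
      have b: "b \<in> Bx" "b \<otimes>\<^bsub>Zd\<^esub> site y = site y'"
        using diff_Bx[OF y eq(2)] by (simp_all add: b_def)
      have gW: "top_el b \<in> carrier W"
        using top.hom_closed b(1) Bx(2) by blast
      have "pos (move (top_el b) y) = pos y'"
        using move_closed_pos[OF gW y(1)] b(2) eq(1) site_Zd[OF y(2)] \<alpha>_one[OF lamp_P[OF y(2)]]
        by (simp add: wreath_top_def prod_eq_iff del: carrier_int_power)
      then have "move (top_el b) y = y'"
        using pos_inj move_closed[OF gW y(1)] y(2) by blast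
      then show ?thesis using D[of "top_el b", OF _ y(1)] b(1) by (simp add: \<Gamma>_def)
    qed
  qed
  have cover: "\<Union>\<U> = Y"
  proof
    show "\<Union>\<U> \<subseteq> Y" by (auto simp: \<U>_def U0_def U1_def)
    show "Y \<subseteq> \<Union>\<U>"
    proof
      fix y assume y: "y \<in> Y"
      show "y \<in> \<Union>\<U>"
      proof (cases "deep 0 (site y) \<and> cell 0 (site y) = z0")
        case True
        then have "y \<in> U0 (\<kappa> (lamp y)) (\<eta> (lamp y) div N)"
          using y by (simp add: U0_def)
        moreover have "U0 (\<kappa> (lamp y)) (\<eta> (lamp y) div N) \<in> \<U>"
          unfolding \<U>_def by (intro UnI1 CollectI exI conjI, rule refl) simp
        ultimately show ?thesis by (rule UnionI[rotated])
      next
        case False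
        obtain j where j: "j \<le> d" "deep j (site y)" using deep_exists by blast
        have "\<not> core (site y)" using False core_deep by blast
        then have "y \<in> U1 j (cell j (site y)) (lamp y)"
          using y j by (simp add: U1_def)
        moreover have "U1 j (cell j (site y)) (lamp y) \<in> \<U>"
          unfolding \<U>_def
          by (intro UnI2 CollectI exI conjI, rule refl) (use False j in auto)
        ultimately show ?thesis by (rule UnionI[rotated])
      qed
    qed
  qed
  have mult: "finite {U \<in> \<U>. U \<inter> {y' \<in> Y. sdist y y' \<le> ereal R} \<noteq> {}} \<and>
    card {U \<in> \<U>. U \<inter> {y' \<in> Y. sdist y y' \<le> ereal R} \<noteq> {}} \<le> d + 1" if y: "y \<in> Y" for y
  proof -
    let ?p = "lamp y" and ?c = "site y"
    let ?V = "{U \<in> \<U>. U \<inter> {y' \<in> Y. sdist y y' \<le> ereal R} \<noteq> {}}"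
    have near: "\<kappa> (lamp y') = \<kappa> ?p \<and> \<bar>\<eta> (lamp y') - \<eta> ?p\<bar> \<le> r \<and> (\<forall>i<d. \<bar>site y' i - ?c i\<bar> \<le> r)
        \<and> ((\<exists>i<d. \<bar>?c i\<bar> > int L + r) \<longrightarrow> lamp y' = ?p)"
      if y': "sdist y y' \<le> ereal R" for y'
    proof -
      obtain g where g: "g \<in> carrier W" "wl g \<le> nat \<lfloor>R\<rfloor>" "y' = move g y"
        using sdist_le_imp_action[OF y y'] act_apply[OF y] by auto
      have le: "int (L * wl g) \<le> r"
        unfolding r_def of_nat_le_iff using g(2) by (rule mult_left_mono) simp
      show ?thesis
      proof (intro conjI allI impI)
        show "\<kappa> (lamp y') = \<kappa> ?p" unfolding g(3) by (rule \<kappa>_move[OF g(1) y])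
        show "\<bar>\<eta> (lamp y') - \<eta> ?p\<bar> \<le> r"
          using word_displacement(1)[OF S L y g(1)] le unfolding g(3) by linarith
        show "\<bar>site y' i - ?c i\<bar> \<le> r" if "i < d" for i
          using word_displacement(2)[OF S L y g(1) that] le unfolding g(3) by linarith
        assume "\<exists>i<d. \<bar>?c i\<bar> > int L + r"
        then obtain i where i: "i < d" "\<bar>?c i\<bar> > int L + r" by blast
        then have "\<bar>?c i\<bar> > int (L + L * wl g)" using le by simp
        from word_displacement(3)[OF S L y g(1) i(1) this]
        show "lamp y' = ?p" unfolding g(3) .
      qed
    qed
    show ?thesis
    \<comment> \<open>Beyond \<open>L + r\<close> in some coordinate no element of the ball changes
      the lamp; otherwise coordinates stay within \<open>L + 2 * r\<close>, that is, in the
      core.\<close>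
    proof (cases "\<exists>i<d. \<bar>?c i\<bar> > int L + r")
      case True
      define G where "G j = (if j = 0 \<and> cell 0 ?c = z0 then U0 (\<kappa> ?p) (\<eta> ?p div N) else U1 j (cell j ?c) ?p)" for j
      have sub: "?V \<subseteq> G ` {..d}"
      proof
        fix U assume "U \<in> ?V"
        then obtain y' where U: "U \<in> \<U>" and y': "y' \<in> U" "sdist y y' \<le> ereal R" by blast
        note nr = near[OF y'(2)]
        have lamp: "lamp y' = ?p" using nr True by blast
        from U consider k m where "U = U0 k m" | j z p where "U = U1 j z p" "j \<le> d" "j = 0 \<longrightarrow> z \<noteq> z0"
          unfolding \<U>_def by blast
        then show "U \<in> G ` {..d}"
        proof cases
          case 1
          have "k = \<kappa> ?p" "m = \<eta> ?p div N" "deep 0 (site y')" "cell 0 (site y') = z0"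
            using y'(1) lamp unfolding 1 U0_def by auto
          moreover from this have "cell 0 ?c = z0" using cell_eq[of 0 "site y'" ?c] nr by simp
          ultimately have "U = G 0" using 1 by (simp add: G_def)
          then show ?thesis by blast
        next
          case 2
          have "p = ?p" "deep j (site y')" "cell j (site y') = z"
            using y'(1) lamp unfolding 2(1) U1_def by auto
          moreover from this have "cell j ?c = z" using cell_eq[of j "site y'" ?c] nr by simp
          ultimately have "U = G j" using 2 by (auto simp: G_def)
          then show ?thesis using 2(2) by blast
        qed
      qed
      show ?thesis
        using finite_subset[OF sub] surj_card_le[OF _ sub] by simp
    next
      case False
      have sub: "?V \<subseteq> {U0 (\<kappa> ?p) ((\<eta> ?p - r) div N), U0 (\<kappa> ?p) ((\<eta> ?p + r) div N)}"
      proof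
        fix U assume "U \<in> ?V"
        then obtain y' where U: "U \<in> \<U>" and y': "y' \<in> U" "sdist y y' \<le> ereal R" by blast
        note nr = near[OF y'(2)]
        have "core (site y')"
          unfolding core_def
        proof (intro allI impI)
          fix i assume i: "i < d"
          have "\<bar>?c i\<bar> \<le> int L + r" "\<bar>site y' i - ?c i\<bar> \<le> r" using False i nr by force+
          then show "\<bar>site y' i\<bar> \<le> int L + 2 * r" by linarith
        qed
        then obtain k m where km: "U = U0 k m"
          using U y'(1) unfolding \<U>_def U1_def by blast
        have k: "k = \<kappa> ?p" "m = \<eta> (lamp y') div N"
          using y'(1) nr unfolding km U0_def by auto
        have "m = (\<eta> ?p - r) div N \<or> m = (\<eta> ?p + r) div N"
        proof (rule ccontr)
          assume "\<not> ?thesis"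
          moreover have "(\<eta> ?p - r) div N \<le> m" "m \<le> (\<eta> ?p + r) div N"
            unfolding k(2) using nr N by (auto intro!: zdiv_mono1 simp: abs_le_iff)
          ultimately have "(\<eta> ?p - r) div N + 2 \<le> (\<eta> ?p + r) div N" by linarith
          also have "(\<eta> ?p + r) div N \<le> (\<eta> ?p - r + 1 * N) div N"
            using N by (intro zdiv_mono1) (auto simp: N_def)
          also have "\<dots> = (\<eta> ?p - r) div N + 1"
            using N by (subst div_mult_self1) auto
          finally show False by simp
        qed
        then show "U \<in> {U0 (\<kappa> ?p) ((\<eta> ?p - r) div N), U0 (\<kappa> ?p) ((\<eta> ?p + r) div N)}"
          unfolding km k(1) by blast
      qed
      have "card ?V \<le> card {U0 (\<kappa> ?p) ((\<eta> ?p - r) div N), U0 (\<kappa> ?p) ((\<eta> ?p + r) div N)}"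
        by (rule card_mono[OF _ sub]) simp
      also have "\<dots> \<le> 2" by (simp add: card_insert_if)
      finally show ?thesis
        using finite_subset[OF sub] d by simp
    qed
  qed
  show "\<exists>\<U>. (\<forall>U\<in>\<U>. U \<subseteq> Y) \<and> \<Union>\<U> = Y \<and> (\<exists>D::real. \<forall>U\<in>\<U>. \<forall>x\<in>U. \<forall>y\<in>U. sdist x y \<le> ereal D) \<and>
        (\<forall>x\<in>Y. finite {U\<in>\<U>. U \<inter> {y\<in>Y. sdist x y \<le> ereal R} \<noteq> {}} \<and>
                card {U\<in>\<U>. U \<inter> {y\<in>Y. sdist x y \<le> ereal R} \<noteq> {}} \<le> d + 1)"
  proof (intro exI[of _ \<U>] conjI ballI)
    show "U \<subseteq> Y" if "U \<in> \<U>" for U using cover that by blast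
    show "\<Union>\<U> = Y" by (rule cover)
    show "\<exists>D::real. \<forall>U\<in>\<U>. \<forall>x\<in>U. \<forall>y\<in>U. sdist x y \<le> ereal D"
      using diam by blast
  qed (use mult in simp_all)
qed

lemma action_asdim_le:
  assumes "d \<ge> 1" "symmetric_generating_set W S"
  shows "action_asdim S Y act \<le> enat d"
  unfolding action_asdim_def asdim_def
  by (rule INF_lower) (use asdim_upper_bound[OF assms] in simp)

end

theorem theorem6p14:
  fixes A :: "('a, 'm) monoid_scheme"
    and d :: nat
    and Zd :: "(nat \<Rightarrow> int) monoid"
    and G :: "(((nat \<Rightarrow> int) \<Rightarrow> 'a) \<times> (nat \<Rightarrow> int)) monoid"
  assumes d: "d \<ge> 1"
    and A: "comm_group A" "finitely_generated A" "carrier A \<noteq> {\<one>\<^bsub>A\<^esub>}"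
    and Zd: "Zd = int_power_group d"
    and G: "G = A \<wr> Zd"
  shows
    "non_foldable TYPE('x) G (wreath_top A Zd ` carrier Zd) \<and>
     (\<forall>t\<in>carrier A. group.ord A t = 0 \<longrightarrow>
       non_foldable TYPE('x) G
         (wreath_top A Zd ` carrier Zd <#>\<^bsub>G\<^esub> generate G {wreath_base A Zd t})) \<and>
     (finite (carrier A) \<longrightarrow> schreier_growth_gap TYPE('x) G (\<lambda>n. real n ^ d)) \<and>
     (infinite (carrier A) \<longrightarrow> schreier_growth_gap TYPE('x) G (\<lambda>n. real n ^ (d + 1))) \<and>
     (\<forall>S (Y :: 'x set) \<phi>. symmetric_generating_set G S \<longrightarrow> faithful_G_set G Y \<phi> \<longrightarrow>
       action_asdim S Y \<phi> \<ge> enat d) \<and>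
     (finite (carrier A) \<longrightarrow>
       (\<exists>(Y :: nat set) \<phi>. faithful_G_set G Y \<phi> \<and>
          (\<forall>S. symmetric_generating_set G S \<longrightarrow>
             action_growth G S Y \<phi> \<simeq>\<^sub>g (\<lambda>n. real n ^ d)))) \<and>
     (infinite (carrier A) \<longrightarrow>
       (\<exists>(Y :: nat set) \<phi>. faithful_G_set G Y \<phi> \<and>
          (\<forall>S. symmetric_generating_set G S \<longrightarrow>
             action_growth G S Y \<phi> \<simeq>\<^sub>g (\<lambda>n. real n ^ (d + 1))))) \<and>
     (\<exists>(Y :: nat set) \<phi>. faithful_G_set G Y \<phi> \<and>
       (\<forall>S. symmetric_generating_set G S \<longrightarrow> action_asdim S Y \<phi> = enat d))"
proof -
  interpret comm_group A by (rule A(1))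
  interpret lamplighter A d by unfold_locales
  have G_eq: "G = W" using G Zd by simp
  obtain P :: "('a set + ('a \<Rightarrow> int) \<times> int) set" and \<alpha> and \<kappa> :: "_ \<Rightarrow> ('a \<Rightarrow> int) option" and \<eta>
    where line: "line_action A P \<alpha> \<kappa> \<eta>"
    using line_action_exists[OF A(2)] by (elim exE)
  interpret line: line_action A P \<alpha> \<kappa> \<eta> by (rule line)
  have "countable (carrier (int_power_group d))"
    unfolding carrier_int_power by (rule countable_PiE) auto
  then have cnt: "countable (P \<times> carrier (int_power_group d))"
    using line.P_countable by (rule countable_SIGMA[rotated])
  \<comment> \<open>The set of lamps and sites is countable although its type need not be; numbering
    it moves the model to natural numbers.\<close>
  define Y where "Y = to_nat_on (P \<times> carrier (int_power_group d)) ` (P \<times> carrier (int_power_group d))"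
  define pos where "pos = inv_into (P \<times> carrier (int_power_group d)) (to_nat_on (P \<times> carrier (int_power_group d)))"
  have "bij_betw pos Y (P \<times> carrier (int_power_group d))"
    unfolding pos_def Y_def
    by (rule bij_betw_inv_into[OF inj_on_imp_bij_betw[OF inj_on_to_nat_on[OF cnt]]])
  then interpret model: lamplighter_model A d P \<alpha> \<kappa> \<eta> Y pos
    by unfold_locales
  note lower = growth_lower_bound[OF A(3)]
  have gap: "schreier_growth_gap TYPE('x) W (\<lambda>n. real n ^ d)"
    unfolding schreier_growth_gap_def using finitely_generated_W[OF A(2)] lower by blast
  have gap': "schreier_growth_gap TYPE('x) W (\<lambda>n. real n ^ (d + 1))"
    and growth: "\<forall>S. symmetric_generating_set W S \<longrightarrow> action_growth W S Y model.act \<simeq>\<^sub>g (\<lambda>n. real n ^ (d + 1))"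
    if inf: "infinite (carrier A)"
  proof -
    obtain t where t: "t \<in> carrier A" "ord t = 0"
      using infinite_imp_infinite_order[OF A(2) inf] by blast
    show "schreier_growth_gap TYPE('x) W (\<lambda>n. real n ^ (d + 1))"
      unfolding schreier_growth_gap_def
      using finitely_generated_W[OF A(2)] growth_lower_bound_infinite_order[OF t] by blast
    show "\<forall>S. symmetric_generating_set W S \<longrightarrow> action_growth W S Y model.act \<simeq>\<^sub>g (\<lambda>n. real n ^ (d + 1))"
      unfolding growth_equiv_def
      using model.growth_le growth_lower_bound_infinite_order[OF t _ model.act_faithful] by blast
  qed
  have growth_fin: "\<forall>S. symmetric_generating_set W S \<longrightarrow> action_growth W S Y model.act \<simeq>\<^sub>g (\<lambda>n. real n ^ d)"
    if "finite (carrier A)"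
    unfolding growth_equiv_def using model.growth_le_finite[OF _ that] lower[OF _ model.act_faithful] by blast
  have asdim_eq: "\<forall>S. symmetric_generating_set W S \<longrightarrow> action_asdim S Y model.act = enat d"
    using model.action_asdim_le[OF d] action_asdim_ge[OF A(3) _ model.act_faithful]
    by (blast intro: antisym)
  show ?thesis
    unfolding G_eq Zd
  proof (intro conjI impI)
    show "non_foldable TYPE('x) W (wreath_top A (int_power_group d) ` carrier (int_power_group d))"
      by (rule non_foldable_top[OF A(3)])
    show "\<forall>t\<in>carrier A. ord t = 0 \<longrightarrow> non_foldable TYPE('x) W
      (wreath_top A (int_power_group d) ` carrier (int_power_group d) <#>\<^bsub>W\<^esub> generate W {wreath_base A (int_power_group d) t})"
      using non_foldable_top_base by blast
    show "\<forall>S (Y :: 'x set) \<phi>. symmetric_generating_set W S \<longrightarrow> faithful_G_set W Y \<phi> \<longrightarrow> enat d \<le> action_asdim S Y \<phi>"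
      using action_asdim_ge[OF A(3)] by blast
  qed (use gap gap' growth growth_fin asdim_eq model.act_faithful in blast)+
qed

end
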